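(* Let $Y$ be a connected graph with at least $n$ cycles $\mathcal{C}_1,\dots,\mathcal{C}_n$ satisfying $\mathcal{C}_i\cap\mathcal{C}_j=\emptyset$ for $i\ne j$, and let $X=C^n(Y\times I)$. Then $$\mathrm{TC}_X(C^n(Y)\times C^n(Y))=\mathrm{TC}(C^n(Y))=\mathrm{TC}(Y^n)=2n+1.$$
   Context: A connected graph is a connected 1-dimensional CW complex. A cycle in a graph $Y$ is a subset of $Y$ homeomorphic to $S^1$. $I=[0,1]$. For a space $X$, $P(X)$ is the space of all continuous maps $\sigma\colon I\to X$ with the compact-open topology. $\mathrm{TC}(X)$ is the smallest integer $k$ such that $X\times X$ has an open cover $U_1,\dots,U_k$ for which there are continuous maps $s_i\colon U_i\to P(X)$ with $s_i(x,y)(0)=x$ and $s_i(x,y)(1)=y$ for all $(x,y)\in U_i$; if no such $k$ exists, $\mathrm{TC}(X)=\infty$. For $A\subseteq X\times X$, $P_X(A)\subseteq P(X)$ is the subspace of paths $\sigma$ with $(\sigma(0),\sigma(1))\in A$, and $\mathrm{TC}_X(A)$ is the smallest integer $k$ such that $A$ has a cover by sets $U_1,\dots,U_k$ open in $A$ for which there are continuous maps $s_i\colon U_i\to P_X(A)$ with $s_i(x,y)(0)=x$ and $s_i(x,y)(1)=y$ for all $(x,y)\in U_i$; if no such $k$ exists, $\mathrm{TC}_X(A)=\infty$. (Paths may leave the subspaces in which their endpoints lie.) For any space $Z$, $C^n(Z)=\{(z_1,\dots,z_n)\in Z^n : z_i\neq z_j\text{ for }i\ne j\}$, the configuration space of $n$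 points in $Z$, with the subspace topology from $Z^n$. $Y$ is identified with the subspace $Y\times\{0\}$ of $Y\times I$, and correspondingly $C^n(Y)$ is viewed as a subspace of $C^n(Y\times I)$ via $(y_1,\dots,y_n)\mapsto((y_1,0),\dots,(y_n,0))$.
   Formalization: For n = 1 the graph Y is additionally assumed to contain two distinct cycles; with exactly one cycle (e.g. Y = S^1) the claim fails, since then TC(Y) = 2 rather than 3. *)

theory Defs
  imports "HOL-Analysis.Analysis"
begin

abbreviation unit_interval :: "real topology" where
  "unit_interval \<equiv> top_of_set {0..1}"

(* A CW structure on Y of dimension exactly 1: V is the set of 0-cells, E the (nonempty) set of
   open 1-cells, and \<Phi> e : [0,1] \<rightarrow> Y is the characteristic map of e, with [0,1] in the
   role of the closed 1-disc. V and E may be infinite and E need not be locally finite.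
   In the weak-topology clause the 0-cells impose no condition, points of Y being closed. *)
definition one_dim_CW_structure ::
    "'a topology \<Rightarrow> 'a set \<Rightarrow> 'a set set \<Rightarrow> ('a set \<Rightarrow> real \<Rightarrow> 'a) \<Rightarrow> bool" where
  "one_dim_CW_structure Y V E \<Phi> \<longleftrightarrow>
     Hausdorff_space Y \<and> E \<noteq> {} \<and>
     V \<union> \<Union>E = topspace Y \<and> V \<inter> \<Union>E = {} \<and> pairwise disjnt E \<and>
     (\<forall>e\<in>E. continuous_map unit_interval Y (\<Phi> e) \<and>
            homeomorphic_map (top_of_set {0<..<1}) (subtopology Y e) (\<Phi> e) \<and>
            \<Phi> e 0 \<in> V \<and> \<Phi> e 1 \<in> V) \<and>
     (\<forall>S. S \<subseteq> topspace Y \<longrightarrow>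
        (closedin Y S \<longleftrightarrow> (\<forall>e\<in>E. closedin Y (S \<inter> Y closure_of e))))"

definition connected_graph :: "'a topology \<Rightarrow> bool" where
  "connected_graph Y \<longleftrightarrow> connected_space Y \<and> (\<exists>V E \<Phi>. one_dim_CW_structure Y V E \<Phi>)"

definition cycle_in :: "'a topology \<Rightarrow> 'a set \<Rightarrow> bool" where
  "cycle_in Y C \<longleftrightarrow> C \<subseteq> topspace Y \<and>
     subtopology Y C homeomorphic_space top_of_set (sphere (0::complex) 1)"

(* P(X). Paths are functions on all of real, made extensional so that a point of the space is
   determined by its values on [0,1]. Taking K = {} shows that the carrier is the whole set of
   extensional paths. *)
definition path_space :: "'a topology \<Rightarrow> (real \<Rightarrow> 'a) topology" where
  "path_space X = topology_generated_by
     {{\<sigma> \<in> extensional {0..1}. continuous_map unit_interval X \<sigma> \<and> \<sigma> ` K \<subseteq> U} | K U.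
        compactin unit_interval K \<and> openin X U}"

definition TC :: "'a topology \<Rightarrow> enat" where
  "TC X = Inf {enat k | k. \<exists>U s.
     (\<Union>i\<in>{1..k}. U i) = topspace (prod_topology X X) \<and>
     (\<forall>i\<in>{1..k}. openin (prod_topology X X) (U i) \<and>
        continuous_map (subtopology (prod_topology X X) (U i)) (path_space X) (s i) \<and>
        (\<forall>(x, y)\<in>U i. s i (x, y) 0 = x \<and> s i (x, y) 1 = y))}"

definition path_space_on :: "'a topology \<Rightarrow> ('a \<times> 'a) set \<Rightarrow> (real \<Rightarrow> 'a) topology" where
  "path_space_on X A = subtopology (path_space X) {\<sigma>. (\<sigma> 0, \<sigma> 1) \<in> A}"

definition relative_TC :: "'a topology \<Rightarrow> ('a \<times> 'a) set \<Rightarrow> enat" where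
  "relative_TC X A = Inf {enat k | k. \<exists>U s.
     (\<Union>i\<in>{1..k}. U i) = A \<and>
     (\<forall>i\<in>{1..k}. openin (subtopology (prod_topology X X) A) (U i) \<and>
        continuous_map (subtopology (prod_topology X X) (U i)) (path_space_on X A) (s i) \<and>
        (\<forall>(x, y)\<in>U i. s i (x, y) 0 = x \<and> s i (x, y) 1 = y))}"

(* The points of the n-fold power are extensional functions on {1..n}. *)
definition power_space :: "nat \<Rightarrow> 'a topology \<Rightarrow> (nat \<Rightarrow> 'a) topology" where
  "power_space n Z = product_topology (\<lambda>_. Z) {1..n}"

definition config_space :: "nat \<Rightarrow> 'a topology \<Rightarrow> (nat \<Rightarrow> 'a) topology" where
  "config_space n Z = subtopology (power_space n Z) {z. inj_on z {1..n}}"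

(* The configuration space of Y, as a subset of the configuration space of Y \<times> [0,1]. *)
definition config_at_zero :: "nat \<Rightarrow> 'a topology \<Rightarrow> (nat \<Rightarrow> 'a \<times> real) set" where
  "config_at_zero n Y = (\<lambda>y. \<lambda>i\<in>{1..n}. (y i, 0)) ` topspace (config_space n Y)"

end

theory Submission
  imports Defs
begin

text \<open>
  Upper bound. In the power and in the configuration space, give each of the \<open>n\<close> coordinates a weight in
  \<open>[0,1]\<close> measuring how close it is to a vertex, relative to the other coordinates near the same vertex.
  On a pair of points there are \<open>2n\<close> weights; the set where the \<open>k\<close> smallest weights are strictly
  separated from the others is open and splits into disjoint open pieces according to the combinatorial
  type (which vertex, which edge, which order along the edge). Each piece is contractible in the space:
  first push the coordinates of small weight into their vertices, then move the others along
  their edges. Since the spaces are path connected, this gives \<open>2n + 1\<close> motion planners.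

  Lower bound. Let \<open>A\<^sub>i\<close> be the given cycles and \<open>B\<^sub>i\<close> the same cycles after a cyclic shift (two distinct cycles
  if \<open>n = 1\<close>). A map from the graph to the circle supported near a point of \<open>A\<^sub>i\<close> off \<open>B\<^sub>i\<close> has nonzero degree
  on \<open>A\<^sub>i\<close> and is constant on \<open>B\<^sub>i\<close>. A motion planner over an open subset of the
  \<open>2n\<close>-torus \<open>\<Prod>A\<^sub>i \<times> \<Prod>B\<^sub>i\<close>, with paths in any space over the \<open>n\<close>-th power of the graph, therefore lifts every coordinate
  of the torus to the reals there, and a torus of dimension \<open>m\<close> cannot be covered by \<open>m\<close> such sets.

  The configuration space is path connected for \<open>n \<ge> 2\<close> because a cycle that is not the whole graph forces a
  vertex with three half-edges, at which points can be permuted.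
\<close>

section \<open>Path spaces\<close>

text \<open>The graph need not be locally finite, so it need not be metrizable or locally compact.
  Hence functions and homotopies on it are written in edge parameters, and the weak topology turns
  continuity into a statement about one edge at a time; uniform estimates are made only in the
  complex plane and on the torus. In the configuration space a point may be pushed into a vertex
  only if no other point is in its way or goes there too. This is why a weight compares coordinates
  instead of measuring only the distance to the vertices: of several points near one vertex, at most
  one has weight below 1, and the others keep to their edges. Two different cycles per coordinate
  are the source of the summand 2n. On pairs of points of one circle the only available class is the
  difference of the two positions, one per coordinate. On a product of two cycles, two circle-valued
  maps, each constant on the other cycle, give two independent classes per coordinate.\<close>

lemma continuous_on_Ints_constant:
  fixes f :: "'a::topological_space \<Rightarrow> real"
  assumes "connected S" "continuous_on S f" "\<And>x. x \<in> S \<Longrightarrow> f x \<in> \<int>" "x \<in> S" "y \<in> S"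
  shows "f x = f y"
proof -
  have "f constant_on S"
  proof (rule continuous_discrete_range_constant[OF assms(1,2)])
    fix x assume "x \<in> S"
    then show "\<exists>e>0. \<forall>y. y \<in> S \<and> f y \<noteq> f x \<longrightarrow> e \<le> norm (f y - f x)"
      by (intro exI[of _ 1]) (auto intro!: Ints_nonzero_abs_ge1 Ints_diff assms(3))
  qed
  then show ?thesis using assms(4,5) by (auto simp: constant_on_def)
qed

text \<open>The tube lemma. Projection along the compact factor \<open>K\<close> is a closed map,
  and the points to be excluded are the projection of the closed set where \<open>H\<close> leaves
  \<open>U\<close>.\<close>

lemma openin_tube:
  assumes H: "continuous_map (prod_topology T Z) X H" and K: "compactin T K" and U: "openin X U"
  shows "openin Z {z \<in> topspace Z. \<forall>t\<in>K. H (t, z) \<in> U}"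
proof -
  let ?T = "subtopology T K"
  have KT: "K \<subseteq> topspace T" using K compactin_subset_topspace by blast
  have cH: "continuous_map (prod_topology ?T Z) X H"
    using H by (simp add: continuous_map_from_subtopology prod_topology_subtopology(1))
  have "closedin (prod_topology ?T Z) {p \<in> topspace (prod_topology ?T Z). H p \<in> topspace X - U}"
    by (rule closedin_continuous_map_preimage[OF cH]) (use U in auto)
  moreover have "closed_map (prod_topology ?T Z) Z snd"
    by (rule closed_map_snd) (use K compactin_subspace in blast)
  ultimately have "closedin Z (snd ` {p \<in> topspace (prod_topology ?T Z). H p \<in> topspace X - U})"
    by (simp add: closed_map_def)
  moreover have "snd ` {p \<in> topspace (prod_topology ?T Z). H p \<in> topspace X - U} =
      topspace Z - {z \<in> topspace Z. \<forall>t\<in>K. H (t, z) \<in> U}"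
    using continuous_map_image_subset_topspace[OF H] KT by (force simp: image_iff)
  ultimately show ?thesis
    by (simp add: closedin_def Diff_Diff_Int Int_absorb1 subset_iff)
qed

lemma topspace_path_space:
  "topspace (path_space X) = {\<sigma> \<in> extensional {0..1}. continuous_map unit_interval X \<sigma>}"
proof -
  have "compactin unit_interval {}" "openin X {}" by auto
  then show ?thesis unfolding path_space_def topology_generated_by_topspace by blast
qed

lemma openin_path_space_subbase:
  assumes "compactin unit_interval K" "openin X U"
  shows "openin (path_space X)
    {\<sigma> \<in> extensional {0..1}. continuous_map unit_interval X \<sigma> \<and> \<sigma> ` K \<subseteq> U}"
  unfolding path_space_def by (rule topology_generated_by_Basis) (use assms in blast)

text \<open>Half of the exponential law, turning homotopies into motion planners: a subbasic open
  set constrains a compact set of times, so its preimage is open by the tube lemma. The restriction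
  to \<open>{0..1}\<close> makes the curried paths extensional.\<close>

lemma continuous_map_into_path_space:
  assumes H: "continuous_map (prod_topology unit_interval Z) X H"
  shows "continuous_map Z (path_space X) (\<lambda>z. \<lambda>t\<in>{0..1}. H (t, z))"
proof -
  have path: "continuous_map unit_interval X (\<lambda>t\<in>{0..1}. H (t, z))" if "z \<in> topspace Z" for z
  proof -
    have "continuous_map unit_interval X (H \<circ> (\<lambda>t. (t, z)))"
      by (rule continuous_map_compose[OF _ H]) (use that in \<open>auto intro!: continuous_map_pairedI\<close>)
    then show ?thesis by (rule continuous_map_eq) auto
  qed
  show ?thesis unfolding path_space_def
  proof (rule continuous_on_generated_topo)
    fix B assume "B \<in> {{\<sigma> \<in> extensional {0..1}. continuous_map unit_interval X \<sigma> \<and> \<sigma> ` K \<subseteq> U} | K U.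
        compactin unit_interval K \<and> openin X U}"
    then obtain K U where K: "compactin unit_interval K" and U: "openin X U"
      and B: "B = {\<sigma> \<in> extensional {0..1}. continuous_map unit_interval X \<sigma> \<and> \<sigma> ` K \<subseteq> U}" by blast
    have K01: "K \<subseteq> {0..1}" using compactin_subset_topspace[OF K] by simp
    have "(\<lambda>z. \<lambda>t\<in>{0..1}. H (t, z)) -` B \<inter> topspace Z = {z \<in> topspace Z. \<forall>t\<in>K. H (t, z) \<in> U}"
      using K01 path by (auto simp: B image_subset_iff subset_iff)
    then show "openin Z ((\<lambda>z. \<lambda>t\<in>{0..1}. H (t, z)) -` B \<inter> topspace Z)"
      using openin_tube[OF H K U] by simp
  next
    show "(\<lambda>z. \<lambda>t\<in>{0..1}. H (t, z)) ` topspace Z \<subseteq> \<Union> {{\<sigma> \<in> extensional {0..1}.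
        continuous_map unit_interval X \<sigma> \<and> \<sigma> ` K \<subseteq> U} | K U. compactin unit_interval K \<and> openin X U}"
      using topspace_path_space[of X] path
      unfolding path_space_def topology_generated_by_topspace by auto
  qed
qed

text \<open>\<open>X\<close> carries no metric; distances are measured after \<open>r\<close>. Once
  the interval is cut so finely that \<open>r\<close> varies by less than \<open>e / 2\<close> along
  \<open>\<sigma>\<close> on each piece, finitely many subbasic conditions give a uniform
  neighbourhood.\<close>

lemma path_space_uniform_neighbourhood:
  fixes r :: "'a \<Rightarrow> complex"
  assumes \<sigma>: "\<sigma> \<in> topspace (path_space X)" and r: "continuous_map X euclidean r" and e: "0 < e"
  obtains N where "openin (path_space X) N" "\<sigma> \<in> N"
    "\<And>\<rho> t. \<rho> \<in> N \<Longrightarrow> t \<in> {0..1} \<Longrightarrow> dist (r (\<rho> t)) (r (\<sigma> t)) < e"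
proof -
  have \<sigma>c: "continuous_map unit_interval X \<sigma>" and \<sigma>e: "\<sigma> \<in> extensional {0..1}"
    using \<sigma> topspace_path_space by auto
  have "continuous_map unit_interval euclidean (r \<circ> \<sigma>)" by (rule continuous_map_compose[OF \<sigma>c r])
  then have "continuous_on {0..1} (r \<circ> \<sigma>)" by simp
  then have "uniformly_continuous_on {0..1} (r \<circ> \<sigma>)"
    by (intro compact_uniformly_continuous) auto
  then obtain d where d: "d > 0"
    and du: "\<And>t t'. t \<in> {0..1} \<Longrightarrow> t' \<in> {0..1} \<Longrightarrow> dist t' t < d \<Longrightarrow> dist (r (\<sigma> t')) (r (\<sigma> t)) < e / 2"
    using e unfolding uniformly_continuous_on_def o_def by (meson half_gt_zero)
  obtain n :: nat where n: "n > 0" "1 / real n < d"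
    using d by (metis gr0I inverse_eq_divide real_arch_inverse)
  define I where "I k = {real k / n .. (real k + 1) / n} \<inter> {0..1}" for k
  define U where "U k = {x \<in> topspace X. r x \<in> ball (r (\<sigma> (real k / n))) (e / 2)}" for k
  define N where "N = (\<Inter>k\<in>{..<n}. {\<rho> \<in> extensional {0..1}. continuous_map unit_interval X \<rho> \<and> \<rho> ` I k \<subseteq> U k})"
  have "openin (path_space X) N" unfolding N_def
  proof (rule openin_INT2)
    fix k
    have "compact (I k)" unfolding I_def by (intro compact_Int) auto
    then have "compactin unit_interval (I k)"
      by (simp add: compactin_subtopology) (auto simp: I_def)
    moreover have "openin X (U k)" unfolding U_def
      by (rule openin_continuous_map_preimage[OF r]) auto
    ultimately show "openin (path_space X)
       {\<rho> \<in> extensional {0..1}. continuous_map unit_interval X \<rho> \<and> \<rho> ` I k \<subseteq> U k}"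
      by (rule openin_path_space_subbase)
  qed (use n in auto)
  moreover have "\<sigma> \<in> N"
  proof -
    have "\<sigma> t \<in> U k" if "k < n" "t \<in> I k" for k t
    proof -
      have t01: "t \<in> {0..1}" using that(2) unfolding I_def by blast
      have k01: "real k / n \<in> {0..1}" using that(1) by simp
      have "(real k + 1) / n - real k / n = 1 / n" by (simp add: add_divide_distrib)
      then have "dist t (real k / n) \<le> 1 / n" using that
        by (auto simp: I_def dist_real_def abs_if)
      then have "dist (r (\<sigma> t)) (r (\<sigma> (real k / n))) < e/2" using du[OF k01 t01] n by simp
      moreover have "\<sigma> t \<in> topspace X"
        using continuous_map_image_subset_topspace[OF \<sigma>c] t01 by auto
      ultimately show ?thesis by (simp add: U_def dist_commute)
    qed
    then show ?thesis using \<sigma>c \<sigma>e by (auto simp: N_def)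
  qed
  moreover have "dist (r (\<rho> t)) (r (\<sigma> t)) < e" if \<rho>: "\<rho> \<in> N" and t: "t \<in> {0..1}" for \<rho> t
  proof -
    \<comment> \<open>The clamp matters for \<open>t = 1\<close>, which would otherwise be assigned
      to a piece with index \<open>n\<close>.\<close>
    define k where "k = min (nat \<lfloor>t * n\<rfloor>) (n - 1)"
    have kn: "k < n" using n by (auto simp: k_def)
    have k1: "real k \<le> t * n"
    proof -
      have "real (nat \<lfloor>t * n\<rfloor>) \<le> t * n" using t n by (simp add: of_nat_nat)
      then show ?thesis by (simp add: k_def min_def)
    qed
    have k2: "t * n \<le> real k + 1"
    proof (cases "nat \<lfloor>t * n\<rfloor> \<le> n - 1")
      case True
      then have "real k = of_int \<lfloor>t * n\<rfloor>" using t n by (simp add: k_def of_nat_nat)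
      then show ?thesis by linarith
    next
      case False
      then have "k = n - 1" by (simp add: k_def)
      then have "real k + 1 = n" using n by simp
      then show ?thesis using t n by (simp add: mult_left_le_one_le)
    qed
    have tI: "t \<in> I k" using k1 k2 n t by (auto simp: I_def field_simps)
    have "\<rho> ` I k \<subseteq> U k" "\<sigma> ` I k \<subseteq> U k" using \<rho> \<open>\<sigma> \<in> N\<close> kn by (auto simp: N_def)
    then have "\<rho> t \<in> U k" "\<sigma> t \<in> U k" using tI by auto
    then have "dist (r (\<sigma> (real k / n))) (r (\<rho> t)) < e/2" "dist (r (\<sigma> (real k / n))) (r (\<sigma> t)) < e/2"
      by (auto simp: U_def)
    then show ?thesis by (metis dist_commute dist_triangle_half_l)
  qed
  ultimately show ?thesis using that by blast
qed

lemma continuous_map_path_space_eval: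
  assumes t: "t \<in> {0..1}"
  shows "continuous_map (path_space X) X (\<lambda>\<sigma>. \<sigma> t)"
  unfolding continuous_map_def
proof (intro conjI allI impI)
  show "(\<lambda>\<sigma>. \<sigma> t) \<in> topspace (path_space X) \<rightarrow> topspace X"
    using t continuous_map_image_subset_topspace by (fastforce simp: topspace_path_space)
  fix U assume "openin X U"
  then have "openin (path_space X) {\<sigma> \<in> extensional {0..1}. continuous_map unit_interval X \<sigma> \<and> \<sigma> ` {t} \<subseteq> U}"
    by (intro openin_path_space_subbase) (use t in auto)
  moreover have "{\<sigma> \<in> extensional {0..1}. continuous_map unit_interval X \<sigma> \<and> \<sigma> ` {t} \<subseteq> U} =
      {\<sigma> \<in> topspace (path_space X). \<sigma> t \<in> U}" by (auto simp: topspace_path_space)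
  ultimately show "openin (path_space X) {\<sigma> \<in> topspace (path_space X). \<sigma> t \<in> U}" by simp
qed

text \<open>Along the path from \<open>s z 0\<close> to \<open>s z 1\<close> the argument of
  \<open>r\<close> has a well-defined total change. Up to sign and a factor 2 pi this is
  \<open>h z\<close>; it is a real number and not just a class modulo integers because the path is
  given.\<close>

lemma lift_to_real_along_paths:
  fixes r :: "'a \<Rightarrow> complex"
  assumes s: "continuous_map Z (path_space X) s" and r: "continuous_map X euclidean r"
    and norm_r: "\<And>x. x \<in> topspace X \<Longrightarrow> norm (r x) = 1"
  obtains h where "continuous_map Z euclideanreal h"
    "\<And>z. z \<in> topspace Z \<Longrightarrow> r (s z 0) = r (s z 1) * cis (2 * pi * h z)"
proof -
  have sP: "s z \<in> topspace (path_space X)" if "z \<in> topspace Z" for z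
    using s that by (auto simp: continuous_map_def)
  have s_in: "s z t \<in> topspace X" if "z \<in> topspace Z" "t \<in> {0..1}" for z t
    using sP[OF that(1)] that(2) continuous_map_image_subset_topspace
    by (fastforce simp: topspace_path_space)
  have path: "continuous_on {0..1} (\<lambda>t. r (s z t))" if "z \<in> topspace Z" for z
  proof -
    have "continuous_map unit_interval X (s z)" using sP[OF that] by (simp add: topspace_path_space)
    from continuous_map_compose[OF this r] show ?thesis by (simp add: o_def)
  qed
  have nz: "r (s z t) \<noteq> 0" if "z \<in> topspace Z" "t \<in> {0..1}" for z t
    using norm_r[OF s_in[OF that]] by auto
  have "\<exists>g. continuous_on {0..1} g \<and> (\<forall>t\<in>{0..1}. r (s z t) = exp (g t))" if z: "z \<in> topspace Z" for z
    by (rule continuous_logarithm_on_contractible[OF path[OF z]])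
       (use nz[OF z] in \<open>auto intro: convex_imp_contractible\<close>)
  then obtain g where gc: "\<And>z. z \<in> topspace Z \<Longrightarrow> continuous_on {0..1} (g z)"
    and g: "\<And>z t. z \<in> topspace Z \<Longrightarrow> t \<in> {0..1} \<Longrightarrow> r (s z t) = exp (g z t)" by metis
  have Re0: "Re (g z t) = 0" if "z \<in> topspace Z" "t \<in> {0..1}" for z t
    using norm_r[OF s_in[OF that]] g[OF that] by simp
  \<comment> \<open>The logarithms \<open>g z\<close> are picked separately for each
    \<open>z\<close> and need not depend continuously on it. Another choice shifts
    \<open>g z\<close> by a constant, which cancels here.\<close>
  define h where "h z = (Im (g z 0) - Im (g z 1)) / (2 * pi)" for z
  have hcis: "r (s z 0) = r (s z 1) * cis (2 * pi * h z)" if z: "z \<in> topspace Z" for z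
  proof -
    have "g z 0 = \<i> * complex_of_real (Im (g z 0))" "g z 1 = \<i> * complex_of_real (Im (g z 1))"
      using Re0[OF z, of 0] Re0[OF z, of 1] by (simp_all add: complex_eq_iff)
    then have "r (s z 0) = cis (Im (g z 0))" "r (s z 1) = cis (Im (g z 1))"
      using g[OF z, of 0] g[OF z, of 1] by (metis atLeastAtMost_iff cis_conv_exp order_refl zero_le_one)+
    moreover have "cis (2 * pi * h z) = cis (Im (g z 0)) / cis (Im (g z 1))"
      by (simp add: h_def cis_divide)
    ultimately show ?thesis by (simp add: cis_neq_zero)
  qed
  have loc: "\<exists>N. openin Z N \<and> z \<in> N \<and> continuous_map (subtopology Z N) euclideanreal h" if z: "z \<in> topspace Z" for z
  proof -
    obtain M where M: "openin (path_space X) M" "s z \<in> M"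
      and Md: "\<And>\<rho> t. \<rho> \<in> M \<Longrightarrow> t \<in> {0..1} \<Longrightarrow> dist (r (\<rho> t)) (r (s z t)) < 1"
      using path_space_uniform_neighbourhood[OF sP[OF z] r, of 1] by auto
    define N where "N = {w \<in> topspace Z. s w \<in> M}"
    have N: "openin Z N" unfolding N_def by (rule openin_continuous_map_preimage[OF s M(1)])
    have zN: "z \<in> N" using z M by (simp add: N_def)
    \<comment> \<open>Both values have norm 1 and differ by less than 1, so their quotient is at
      distance less than 1 from 1, where the principal branch of \<open>Ln\<close> is
      continuous.\<close>
    have right: "r (s w t) / r (s z t) \<in> {q. Re q > 0}" if "w \<in> N" "t \<in> {0..1}" for w t
    proof -
      let ?q = "r (s w t) / r (s z t)"
      have "w \<in> topspace Z" "s w \<in> M" using that by (auto simp: N_def)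
      have n1: "norm (r (s z t)) = 1" using norm_r s_in z that by blast
      have nz': "r (s z t) \<noteq> 0" using nz z that by blast
      have "?q - 1 = (r (s w t) - r (s z t)) / r (s z t)" using nz' by (simp add: diff_divide_distrib)
      then have "norm (?q - 1) = norm (r (s w t) - r (s z t))" using n1 by (simp add: norm_divide)
      also have "\<dots> < 1" using Md[OF \<open>s w \<in> M\<close> that(2)] by (simp add: dist_norm)
      finally have "\<bar>Re (?q - 1)\<bar> < 1" using abs_Re_le_cmod le_less_trans by blast
      then show ?thesis by simp
    qed
    have eq: "h w = h z + (Im (Ln (r (s w 0) / r (s z 0))) - Im (Ln (r (s w 1) / r (s z 1)))) / (2 * pi)" if w: "w \<in> N" for w
    proof -
      have wZ: "w \<in> topspace Z" using w by (simp add: N_def)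
      \<comment> \<open>\<open>D\<close> is continuous with \<open>exp (D t) = 1\<close>, so its
        imaginary part is constant; comparing the two ends removes the unknown multiple of 2 pi from
        \<open>h w - h z\<close>.\<close>
      define D where "D t = g w t - g z t - Ln (r (s w t) / r (s z t))" for t
      have Lc: "continuous_on {0..1} (\<lambda>t. Ln (r (s w t) / r (s z t)))"
        by (intro continuous_intros path z wZ)
           (use nz[OF z] right[OF w] in \<open>force simp: complex_nonpos_Reals_iff\<close>)+
      have Dc: "continuous_on {0..1} D" unfolding D_def
        by (intro continuous_on_diff Lc gc z wZ)
      have D: "exp (D t) = 1" if t: "t \<in> {0..1}" for t
        using g[OF z t] g[OF wZ t] nz[OF z t] nz[OF wZ t]
        by (simp add: D_def exp_diff)
      have DZ: "Im (D t) / (2*pi) \<in> \<int>" if t: "t \<in> {0..1}" for t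
        using D[OF t] by (auto simp: exp_eq_1)
      have "Im (D 0) / (2*pi) = Im (D 1) / (2*pi)"
        by (rule continuous_on_Ints_constant[of "{0..1::real}"])
           (use DZ in \<open>auto intro!: continuous_intros Dc\<close>)
      then have "Im (D 0) = Im (D 1)" by simp
      then have "Im (g w 0) - Im (g w 1) = (Im (g z 0) - Im (g z 1)) +
          (Im (Ln (r (s w 0) / r (s z 0))) - Im (Ln (r (s w 1) / r (s z 1))))"
        by (simp add: D_def)
      then show ?thesis by (simp only: h_def add_divide_distrib[symmetric])
    qed
    have lnc: "continuous_map (subtopology Z N) euclideanreal (\<lambda>w. Im (Ln (r (s w t) / r (s z t))))"
      if t: "t \<in> {0..1}" for t
    proof -
      have "continuous_map Z euclidean (r \<circ> ((\<lambda>\<sigma>. \<sigma> t) \<circ> s))"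
        by (intro continuous_map_compose[OF _ r] continuous_map_compose[OF s] continuous_map_path_space_eval t)
      then have "continuous_map (subtopology Z N) euclidean (\<lambda>w. r (s w t))"
        by (simp add: o_def continuous_map_from_subtopology)
      moreover have "continuous_map euclidean euclidean (\<lambda>c. c / r (s z t))"
        using nz[OF z t] by (auto intro!: continuous_intros)
      ultimately have "continuous_map (subtopology Z N) euclidean ((\<lambda>c. c / r (s z t)) \<circ> (\<lambda>w. r (s w t)))"
        by (rule continuous_map_compose)
      then have "continuous_map (subtopology Z N) (top_of_set {q. Re q > 0}) (\<lambda>w. r (s w t) / r (s z t))"
        using right[OF _ t] by (auto simp: continuous_map_in_subtopology o_def)
      moreover have "continuous_map (top_of_set {q. Re q > 0}) euclideanreal (\<lambda>q. Im (Ln q))"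
        by (auto simp: complex_nonpos_Reals_iff intro!: continuous_intros)
      ultimately have "continuous_map (subtopology Z N) euclideanreal ((\<lambda>q. Im (Ln q)) \<circ> (\<lambda>w. r (s w t) / r (s z t)))"
        by (rule continuous_map_compose)
      then show ?thesis by (simp add: o_def)
    qed
    have "continuous_map (subtopology Z N) euclideanreal
       (\<lambda>w. h z + (Im (Ln (r (s w 0) / r (s z 0))) - Im (Ln (r (s w 1) / r (s z 1)))) / (2 * pi))"
      by (intro continuous_map_add continuous_map_real_divide continuous_map_diff lnc) auto
    then have "continuous_map (subtopology Z N) euclideanreal h"
      by (rule continuous_map_eq) (use eq in auto)
    then show ?thesis using N zN by blast
  qed
  then obtain N where Nz: "\<And>z. z \<in> topspace Z \<Longrightarrow> openin Z (N z) \<and> z \<in> N z \<and> continuous_map (subtopology Z (N z)) euclideanreal h"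
    by metis
  have "continuous_map Z euclideanreal h"
    by (rule pasting_lemma[where I="topspace Z" and T=N and f="\<lambda>_. h"]) (use Nz in auto)
  then show ?thesis using that hcis by blast
qed

section \<open>One-dimensional CW complexes\<close>

locale cw_graph =
  fixes Y :: "'a topology" and V :: "'a set" and E :: "'a set set" and \<Phi> :: "'a set \<Rightarrow> real \<Rightarrow> 'a"
  assumes connected: "connected_space Y" and CW: "one_dim_CW_structure Y V E \<Phi>"
begin

section \<open>Cells, closed edges and the weak topology\<close>

lemma Hausdorff: "Hausdorff_space Y"
  and E_nonempty: "E \<noteq> {}"
  and cells_cover: "V \<union> \<Union>E = topspace Y"
  and V_E_disjoint: "V \<inter> \<Union>E = {}"
  and E_disjoint: "pairwise disjnt E"
  and \<Phi>_continuous: "e \<in> E \<Longrightarrow> continuous_map unit_interval Y (\<Phi> e)"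
  and \<Phi>_homeo: "e \<in> E \<Longrightarrow> homeomorphic_map (top_of_set {0<..<1}) (subtopology Y e) (\<Phi> e)"
  and \<Phi>_0: "e \<in> E \<Longrightarrow> \<Phi> e 0 \<in> V" and \<Phi>_1: "e \<in> E \<Longrightarrow> \<Phi> e 1 \<in> V"
  and weak_topology: "S \<subseteq> topspace Y \<Longrightarrow> closedin Y S \<longleftrightarrow> (\<forall>e\<in>E. closedin Y (S \<inter> Y closure_of e))"
  using CW unfolding one_dim_CW_structure_def by blast+

lemma V_subset: "V \<subseteq> topspace Y" and E_subset: "e \<in> E \<Longrightarrow> e \<subseteq> topspace Y"
  using cells_cover by auto

lemma edges_eq: "e \<in> E \<Longrightarrow> e' \<in> E \<Longrightarrow> y \<in> e \<Longrightarrow> y \<in> e' \<Longrightarrow> e = e'"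
  using E_disjoint by (auto simp: pairwise_def disjnt_iff)

lemma vertex_not_edge: "y \<in> V \<Longrightarrow> e \<in> E \<Longrightarrow> y \<notin> e"
  using V_E_disjoint by blast

lemma \<Phi>_in: "e \<in> E \<Longrightarrow> t \<in> {0..1} \<Longrightarrow> \<Phi> e t \<in> topspace Y"
  using continuous_map_image_subset_topspace[OF \<Phi>_continuous] by fastforce

lemma \<Phi>_image: "e \<in> E \<Longrightarrow> \<Phi> e ` {0<..<1} = e"
  using homeomorphic_imp_surjective_map[OF \<Phi>_homeo] E_subset by (simp add: Int_absorb1)

lemma \<Phi>_inj: "e \<in> E \<Longrightarrow> inj_on (\<Phi> e) {0<..<1}"
  using homeomorphic_imp_injective_map[OF \<Phi>_homeo] by simp

lemma \<Phi>_eq_iff: "e \<in> E \<Longrightarrow> t \<in> {0<..<1} \<Longrightarrow> s \<in> {0<..<1} \<Longrightarrow> \<Phi> e t = \<Phi> e s \<longleftrightarrow> t = s"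
  using \<Phi>_inj by (auto simp: inj_on_def)

lemma \<Phi>_mem_edge: "e \<in> E \<Longrightarrow> 0 < t \<Longrightarrow> t < 1 \<Longrightarrow> \<Phi> e t \<in> e"
  using \<Phi>_image by fastforce

lemma \<Phi>_mem_V: assumes "e \<in> E" "t \<in> {0..1}" shows "\<Phi> e t \<in> V \<longleftrightarrow> t = 0 \<or> t = 1"
proof (cases "t = 0 \<or> t = 1")
  case True then show ?thesis using \<Phi>_0 \<Phi>_1 assms by auto
next
  case False
  then have "\<Phi> e t \<in> e" using assms by (intro \<Phi>_mem_edge) auto
  then show ?thesis using False vertex_not_edge assms by blast
qed

lemma \<Phi>_mem_edge_iff:
  assumes "e \<in> E" "e' \<in> E" "t \<in> {0..1}"
  shows "\<Phi> e t \<in> e' \<longleftrightarrow> e = e' \<and> 0 < t \<and> t < 1"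
proof (cases "t = 0 \<or> t = 1")
  case True then show ?thesis using \<Phi>_0 \<Phi>_1 vertex_not_edge assms by auto
next
  case False
  then have "\<Phi> e t \<in> e" using assms by (intro \<Phi>_mem_edge) auto
  then have "\<Phi> e t \<in> e' \<longleftrightarrow> e = e'" using edges_eq[OF assms(1,2)] by blast
  then show ?thesis using False assms(3) by auto
qed

lemma closed_edge: assumes e: "e \<in> E" shows "\<Phi> e ` {0..1} = Y closure_of e"
proof
  have "\<Phi> e ` (top_of_set {0..1} closure_of {0<..<1}) \<subseteq> Y closure_of (\<Phi> e ` {0<..<1})"
    using \<Phi>_continuous[OF e] by (rule continuous_map_image_closure_subset)
  moreover have "top_of_set {0..1} closure_of {0<..<1::real} = {0..1}"
    by (simp add: closure_of_subtopology Int_absorb1 subset_iff)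
  ultimately show "\<Phi> e ` {0..1} \<subseteq> Y closure_of e" using \<Phi>_image[OF e] by simp
  have "compactin Y (\<Phi> e ` {0..1})"
    by (rule image_compactin[OF _ \<Phi>_continuous[OF e]]) (simp add: compactin_subtopology)
  then have "closedin Y (\<Phi> e ` {0..1})" using Hausdorff by (rule compactin_imp_closedin[rotated])
  then show "Y closure_of e \<subseteq> \<Phi> e ` {0..1}"
    by (rule closure_of_minimal[rotated]) (use \<Phi>_image[OF e] in fastforce)
qed

text \<open>Restates the weak topology through edge parameters, the form in which it is used below.
  A closed set of parameters is compact, so its image is compact and hence closed in the Hausdorff
  space \<open>Y\<close>.\<close>

lemma closedin_iff:
  assumes S: "S \<subseteq> topspace Y"
  shows "closedin Y S \<longleftrightarrow> (\<forall>e\<in>E. closedin unit_interval {t \<in> {0..1}. \<Phi> e t \<in> S})"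
proof
  assume "closedin Y S"
  then show "\<forall>e\<in>E. closedin unit_interval {t \<in> {0..1}. \<Phi> e t \<in> S}"
    using closedin_continuous_map_preimage[OF \<Phi>_continuous] by fastforce
next
  assume R: "\<forall>e\<in>E. closedin unit_interval {t \<in> {0..1}. \<Phi> e t \<in> S}"
  have "closedin Y (S \<inter> Y closure_of e)" if e: "e \<in> E" for e
  proof -
    have "compactin unit_interval {t \<in> {0..1}. \<Phi> e t \<in> S}"
      using R e by (intro closedin_compact_space) (auto simp: compact_space_subtopology)
    then have "compactin Y (\<Phi> e ` {t \<in> {0..1}. \<Phi> e t \<in> S})"
      by (rule image_compactin[OF _ \<Phi>_continuous[OF e]])
    moreover have "\<Phi> e ` {t \<in> {0..1}. \<Phi> e t \<in> S} = S \<inter> Y closure_of e"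
      unfolding closed_edge[OF e, symmetric] by auto
    ultimately show ?thesis using Hausdorff compactin_imp_closedin by metis
  qed
  then show "closedin Y S" using weak_topology[OF S] by blast
qed

lemma openin_iff:
  assumes S: "S \<subseteq> topspace Y"
  shows "openin Y S \<longleftrightarrow> (\<forall>e\<in>E. openin unit_interval {t \<in> {0..1}. \<Phi> e t \<in> S})"
proof -
  have "openin Y S \<longleftrightarrow> closedin Y (topspace Y - S)" using S by (simp add: openin_closedin_eq)
  also have "\<dots> \<longleftrightarrow> (\<forall>e\<in>E. closedin unit_interval {t \<in> {0..1}. \<Phi> e t \<in> topspace Y - S})"
    by (rule closedin_iff) auto
  also have "\<dots> \<longleftrightarrow> (\<forall>e\<in>E. openin unit_interval {t \<in> {0..1}. \<Phi> e t \<in> S})"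
  proof (intro ball_cong refl)
    fix e assume e: "e \<in> E"
    have eq: "{t \<in> {0..1}. \<Phi> e t \<in> topspace Y - S} = topspace unit_interval - {t \<in> {0..1}. \<Phi> e t \<in> S}"
      using \<Phi>_in[OF e] by auto
    have sub: "{t \<in> {0..1}. \<Phi> e t \<in> S} \<subseteq> topspace unit_interval" by auto
    show "closedin unit_interval {t \<in> {0..1}. \<Phi> e t \<in> topspace Y - S} =
        openin unit_interval {t \<in> {0..1}. \<Phi> e t \<in> S}"
      by (simp only: eq openin_closedin_eq sub simp_thms)
  qed
  finally show ?thesis .
qed

lemma closedin_vertices: assumes "S \<subseteq> V" shows "closedin Y S"
proof -
  have "closedin unit_interval {t \<in> {0..1}. \<Phi> e t \<in> S}" if "e \<in> E" for e
  proof -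
    have "{t \<in> {0..1}. \<Phi> e t \<in> S} \<subseteq> {0,1}" using \<Phi>_mem_V that assms by blast
    then have "finite {t \<in> {0..1}. \<Phi> e t \<in> S}" by (rule finite_subset) auto
    then show ?thesis by (auto simp: closedin_closed_eq intro!: closed_subset finite_imp_closed)
  qed
  then show ?thesis using closedin_iff assms V_subset by blast
qed

lemma openin_edge_piece:
  assumes e: "e \<in> E" and O: "open T" "T \<subseteq> {0<..<1}"
  shows "openin Y (\<Phi> e ` T)"
proof -
  have "openin unit_interval {t \<in> {0..1}. \<Phi> e' t \<in> \<Phi> e ` T}" if e': "e' \<in> E" for e'
  proof -
    have "{t \<in> {0..1}. \<Phi> e' t \<in> \<Phi> e ` T} = (if e' = e then T else {})"
    proof (intro set_eqI iffI)
      fix t assume "t \<in> {t \<in> {0..1}. \<Phi> e' t \<in> \<Phi> e ` T}"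
      then obtain s where t: "t \<in> {0..1}" "s \<in> T" "\<Phi> e' t = \<Phi> e s" by auto
      then have "\<Phi> e' t \<in> e" using \<Phi>_mem_edge[OF e, of s] O(2) by auto
      then have "e' = e" "0 < t" "t < 1" using \<Phi>_mem_edge_iff e e' t by blast+
      then show "t \<in> (if e' = e then T else {})" using t O(2) \<Phi>_eq_iff[OF e, of t s] by auto
    qed (use O(2) in \<open>auto split: if_splits\<close>)
    moreover have "openin unit_interval T"
      by (rule openin_subset_trans[of UNIV]) (use O in auto)
    ultimately show ?thesis by simp
  qed
  moreover have "\<Phi> e ` T \<subseteq> topspace Y" using O(2) \<Phi>_image[OF e] E_subset[OF e] by blast
  ultimately show ?thesis using openin_iff by blast
qed

lemma openin_edge: "e \<in> E \<Longrightarrow> openin Y e"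
  using openin_edge_piece[of e "{0<..<1}"] \<Phi>_image by simp

text \<open>Connectedness excludes isolated vertices: a vertex on no closed edge would be open by
  the weak topology, and closed, hence all of \<open>Y\<close>, although there is an edge.\<close>

lemma point_on_edge: assumes "y \<in> topspace Y" obtains e t where "e \<in> E" "t \<in> {0..1}" "y = \<Phi> e t"
proof -
  have "\<exists>e\<in>E. y \<in> \<Phi> e ` {0..1}"
  proof (rule ccontr)
    assume no: "\<not> (\<exists>e\<in>E. y \<in> \<Phi> e ` {0..1})"
    then have yV: "y \<in> V" using assms cells_cover \<Phi>_image by fastforce
    have "openin unit_interval {t \<in> {0..1}. \<Phi> e t \<in> {y}}" if "e \<in> E" for e
    proof -
      have "{t \<in> {0..1}. \<Phi> e t \<in> {y}} = {}" using no that by blast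
      then show ?thesis by (simp only: openin_empty)
    qed
    then have "openin Y {y}" using openin_iff[of "{y}"] assms by blast
    moreover have "closedin Y {y}" using yV closedin_vertices by simp
    ultimately have "{y} = topspace Y" using connected unfolding connected_space_clopen_in by blast
    moreover obtain e where "e \<in> E" using E_nonempty by blast
    ultimately show False using no \<Phi>_in[of e 0] by (metis atLeastAtMost_iff imageI order_refl singletonD zero_le_one)
  qed
  then show ?thesis using that by blast
qed

lemma continuous_map_from_graph:
  assumes F: "\<And>e. e \<in> E \<Longrightarrow> continuous_map unit_interval M (\<lambda>t. F (\<Phi> e t))"
  shows "continuous_map Y M F"
  unfolding continuous_map_def
proof (intro conjI allI impI)
  show "F \<in> topspace Y \<rightarrow> topspace M"
  proof
    fix y assume "y \<in> topspace Y"
    then obtain e t where "e \<in> E" "t \<in> {0..1}" "y = \<Phi> e t" by (rule point_on_edge)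
    then show "F y \<in> topspace M" using F[of e] by (auto simp: continuous_map_def)
  qed
  fix U assume U: "openin M U"
  have "openin unit_interval {t \<in> {0..1}. \<Phi> e t \<in> {x \<in> topspace Y. F x \<in> U}}" if e: "e \<in> E" for e
  proof -
    have "{t \<in> {0..1}. \<Phi> e t \<in> {x \<in> topspace Y. F x \<in> U}} = {t \<in> topspace unit_interval. F (\<Phi> e t) \<in> U}"
      using \<Phi>_in[OF e] by auto
    then show ?thesis using openin_continuous_map_preimage[OF F[OF e] U] by simp
  qed
  then show "openin Y {x \<in> topspace Y. F x \<in> U}" by (subst openin_iff) auto
qed

text \<open>The product of the interval with \<open>Y\<close> has the topology glued from squares,
  even without local finiteness, because the interval is locally compact: a compact interval of
  times around \<open>u0\<close> determines the set \<open>W\<close> of good points, whose trace on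
  each edge is open by the tube lemma.\<close>

lemma continuous_map_from_homotopy_on_graph:
  assumes F: "\<And>e. e \<in> E \<Longrightarrow> continuous_map (prod_topology unit_interval unit_interval) M (\<lambda>(u, t). F (u, \<Phi> e t))"
  shows "continuous_map (prod_topology unit_interval Y) M F"
  unfolding continuous_map_def
proof (intro conjI allI impI)
  show "F \<in> topspace (prod_topology unit_interval Y) \<rightarrow> topspace M"
  proof
    fix p assume "p \<in> topspace (prod_topology unit_interval Y)"
    then obtain u y where p: "p = (u, y)" "u \<in> {0..1}" "y \<in> topspace Y" by auto
    then obtain e t where "e \<in> E" "t \<in> {0..1}" "y = \<Phi> e t" by (blast elim: point_on_edge)
    then show "F p \<in> topspace M" using F[of e] p by (auto simp: continuous_map_def Pi_iff)
  qed
  fix U assume O: "openin M U"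
  show "openin (prod_topology unit_interval Y) {x \<in> topspace (prod_topology unit_interval Y). F x \<in> U}"
  proof (subst openin_subopen, intro ballI)
    fix p assume "p \<in> {x \<in> topspace (prod_topology unit_interval Y). F x \<in> U}"
    then obtain u0 y0 where p: "p = (u0, y0)" "u0 \<in> {0..1}" "y0 \<in> topspace Y" "F (u0, y0) \<in> U" by auto
    obtain e0 t0 where e0: "e0 \<in> E" "t0 \<in> {0..1}" "y0 = \<Phi> e0 t0" using p(3) by (rule point_on_edge)
    have "continuous_map unit_interval M ((\<lambda>(u, t). F (u, \<Phi> e0 t)) \<circ> (\<lambda>u. (u, t0)))"
      by (rule continuous_map_compose[OF _ F[OF e0(1)]]) (use e0 in \<open>auto simp: continuous_map_paired intro!: continuous_intros\<close>)
    then have "openin unit_interval {u \<in> topspace unit_interval. ((\<lambda>(u, t). F (u, \<Phi> e0 t)) \<circ> (\<lambda>u. (u, t0))) u \<in> U}"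
      using O by (rule openin_continuous_map_preimage)
    then have "openin unit_interval {u \<in> {0..1}. F (u, y0) \<in> U}" using e0 by simp
    \<comment> \<open>The closed ball serves the tube lemma, the open ball inside it the
      neighbourhood of \<open>p\<close>.\<close>
    then obtain d where d: "d > 0" "cball u0 d \<inter> {0..1} \<subseteq> {u \<in> {0..1}. F (u, y0) \<in> U}"
      using p by (subst (asm) openin_contains_cball) auto
    define J where "J = cball u0 d \<inter> {0..1}"
    define W where "W = {y \<in> topspace Y. \<forall>u\<in>J. F (u, y) \<in> U}"
    have "compact J" by (auto simp: J_def)
    then have J: "compactin unit_interval J" by (simp add: compactin_subtopology) (simp add: J_def)
    have "openin unit_interval {t \<in> {0..1}. \<Phi> e t \<in> W}" if e: "e \<in> E" for e
    proof -
      have "{t \<in> {0..1}. \<Phi> e t \<in> W} = {t \<in> topspace unit_interval. \<forall>u\<in>J. (\<lambda>(u, t). F (u, \<Phi> e t)) (u, t) \<in> U}"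
        using \<Phi>_in[OF e] by (auto simp: W_def)
      then show ?thesis using openin_tube[OF F[OF e] J O] by simp
    qed
    then have W: "openin Y W" by (subst openin_iff) (auto simp: W_def)
    have "openin unit_interval (ball u0 d \<inter> {0..1})" by (metis Int_commute open_ball openin_open_Int)
    with W have "openin (prod_topology unit_interval Y) ((ball u0 d \<inter> {0..1}) \<times> W)"
      by (simp add: openin_prod_Times_iff)
    moreover have "p \<in> (ball u0 d \<inter> {0..1}) \<times> W"
      using p d by (auto simp: W_def J_def)
    moreover have "(ball u0 d \<inter> {0..1}) \<times> W \<subseteq> {x \<in> topspace (prod_topology unit_interval Y). F x \<in> U}"
      by (auto simp: W_def J_def)
    ultimately show "\<exists>T. openin (prod_topology unit_interval Y) T \<and> p \<in> T \<and>
        T \<subseteq> {x \<in> topspace (prod_topology unit_interval Y). F x \<in> U}" by blast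
  qed
qed

text \<open>A path component contains or misses each closed edge, so its traces on the edges are
  trivial and it is open and closed.\<close>

lemma path_connected: "path_connected_space Y"
proof -
  have "path_component_of_set Y p = topspace Y" if p: "p \<in> topspace Y" for p
  proof -
    let ?P = "path_component_of_set Y p"
    have dich: "{t \<in> {0..1}. \<Phi> e t \<in> ?P} = {0..1} \<or> {t \<in> {0..1}. \<Phi> e t \<in> ?P} = {}" if e: "e \<in> E" for e
    proof -
      have "path_connectedin unit_interval {0..1}"
        by (simp add: path_connectedin_subtopology)
      then have pc: "path_connectedin Y (\<Phi> e ` {0..1})"
        by (rule path_connectedin_continuous_map_image[OF \<Phi>_continuous[OF e]])
      have "\<Phi> e s \<in> ?P" if "t \<in> {0..1}" "s \<in> {0..1}" "\<Phi> e t \<in> ?P" for s t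
      proof -
        have "\<Phi> e ` {0..1} \<subseteq> path_component_of_set Y (\<Phi> e t)"
          by (rule path_component_of_maximal[OF pc]) (use that in blast)
        then have "path_component_of Y (\<Phi> e t) (\<Phi> e s)" using that by blast
        moreover have "path_component_of Y p (\<Phi> e t)" using that by simp
        ultimately show ?thesis by (metis mem_Collect_eq path_component_of_trans)
      qed
      then show ?thesis by blast
    qed
    have sub: "?P \<subseteq> topspace Y" by (rule path_component_of_subset_topspace)
    have 1: "openin unit_interval {0..1}" "closedin unit_interval {0..1}"
      using openin_topspace[of unit_interval] closedin_topspace[of unit_interval] by simp_all
    have "openin unit_interval {t \<in> {0..1}. \<Phi> e t \<in> ?P} \<and> closedin unit_interval {t \<in> {0..1}. \<Phi> e t \<in> ?P}"
      if "e \<in> E" for e using dich[OF that] 1 by (elim disjE) (simp_all only: openin_empty closedin_empty simp_thms)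
    then have "openin Y ?P" "closedin Y ?P" using openin_iff[OF sub] closedin_iff[OF sub] by blast+
    moreover have "p \<in> ?P" using p by (simp add: path_component_of_refl)
    ultimately show ?thesis using connected unfolding connected_space_clopen_in by blast
  qed
  then show ?thesis unfolding path_connected_space_iff_path_component by blast
qed

section \<open>Edge coordinates, functions glued from edges, distances to vertices\<close>

definition coord :: "'a set \<Rightarrow> 'a \<Rightarrow> real" where
  "coord e = the_inv_into {0<..<1} (\<Phi> e)"

lemma coord_\<Phi>: "e \<in> E \<Longrightarrow> 0 < t \<Longrightarrow> t < 1 \<Longrightarrow> coord e (\<Phi> e t) = t"
  unfolding coord_def using the_inv_into_f_f[OF \<Phi>_inj] by simp

lemma \<Phi>_coord: "e \<in> E \<Longrightarrow> y \<in> e \<Longrightarrow> \<Phi> e (coord e y) = y"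
  unfolding coord_def using f_the_inv_into_f[OF \<Phi>_inj] \<Phi>_image by simp

lemma coord_bounds: assumes "e \<in> E" "y \<in> e" shows "0 < coord e y" "coord e y < 1"
proof -
  have "y \<in> \<Phi> e ` {0<..<1}" using \<Phi>_image[OF assms(1)] assms(2) by simp
  then obtain t where "y = \<Phi> e t" "0 < t" "t < 1" by auto
  then show "0 < coord e y" "coord e y < 1" using coord_\<Phi>[OF assms(1)] by simp_all
qed

lemma continuous_map_coord:
  assumes e: "e \<in> E" shows "continuous_map (subtopology Y e) euclideanreal (coord e)"
proof -
  obtain g where g: "homeomorphic_maps (top_of_set {0<..<1}) (subtopology Y e) (\<Phi> e) g"
    using \<Phi>_homeo[OF e] homeomorphic_map_maps by blast
  have "continuous_map (subtopology Y e) euclideanreal g"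
    using g by (auto simp: homeomorphic_maps_def continuous_map_in_subtopology)
  then show ?thesis
  proof (rule continuous_map_eq)
    fix y assume "y \<in> topspace (subtopology Y e)"
    then have y: "y \<in> e" by simp
    then have "y \<in> \<Phi> e ` {0<..<1}" using \<Phi>_image[OF e] by simp
    then obtain t where t: "y = \<Phi> e t" "t \<in> {0<..<1}" by blast
    then have "g y = t" using g by (simp add: homeomorphic_maps_def)
    then show "g y = coord e y" using t coord_\<Phi>[OF e] by simp
  qed
qed

definition glue :: "('a \<Rightarrow> 'b) \<Rightarrow> ('a set \<Rightarrow> real \<Rightarrow> 'b) \<Rightarrow> 'a \<Rightarrow> 'b" where
  "glue b \<phi> y = (if y \<in> V then b y else let e = THE e. e \<in> E \<and> y \<in> e in \<phi> e (coord e y))"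

lemma glue_vertex: "y \<in> V \<Longrightarrow> glue b \<phi> y = b y"
  by (simp add: glue_def)

lemma glue_\<Phi>:
  assumes "e \<in> E" "t \<in> {0..1}" "\<phi> e 0 = b (\<Phi> e 0)" "\<phi> e 1 = b (\<Phi> e 1)"
  shows "glue b \<phi> (\<Phi> e t) = \<phi> e t"
proof (cases "t = 0 \<or> t = 1")
  case True
  then show ?thesis using assms \<Phi>_0 \<Phi>_1 by (auto simp: glue_def)
next
  case False
  then have t: "0 < t" "t < 1" using assms by auto
  then have e: "\<Phi> e t \<in> e" using \<Phi>_mem_edge assms by blast
  have "(THE e'. e' \<in> E \<and> \<Phi> e t \<in> e') = e"
    by (rule the_equality) (use e edges_eq assms(1) in blast)+
  moreover have "\<Phi> e t \<notin> V" using e vertex_not_edge assms by blast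
  ultimately show ?thesis using coord_\<Phi> assms t by (simp add: glue_def)
qed

lemma continuous_map_glue:
  assumes "\<And>e. e \<in> E \<Longrightarrow> continuous_map unit_interval M (\<phi> e)"
    and "\<And>e. e \<in> E \<Longrightarrow> \<phi> e 0 = b (\<Phi> e 0) \<and> \<phi> e 1 = b (\<Phi> e 1)"
  shows "continuous_map Y M (glue b \<phi>)"
proof (rule continuous_map_from_graph)
  fix e assume e: "e \<in> E"
  show "continuous_map unit_interval M (\<lambda>t. glue b \<phi> (\<Phi> e t))"
    by (rule continuous_map_eq[OF assms(1)[OF e]]) (use assms(2)[OF e] in \<open>simp add: glue_\<Phi>[OF e]\<close>)
qed

text \<open>With the factor \<open>3\<close> the middle third of each edge lies outside all stars \<open>vdist v < 1\<close>, so that collapsing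
  the stars to their centres extends continuously over the edge.\<close>

definition vdist :: "'a \<Rightarrow> 'a \<Rightarrow> real" where
  "vdist v = glue (\<lambda>w. if w = v then 0 else 1)
     (\<lambda>e t. min (if \<Phi> e 0 = v then min 1 (3*t) else 1) (if \<Phi> e 1 = v then min 1 (3*(1-t)) else 1))"

lemma vdist_\<Phi>: "e \<in> E \<Longrightarrow> t \<in> {0..1} \<Longrightarrow>
   vdist v (\<Phi> e t) = min (if \<Phi> e 0 = v then min 1 (3*t) else 1) (if \<Phi> e 1 = v then min 1 (3*(1-t)) else 1)"
  unfolding vdist_def by (rule glue_\<Phi>) auto

lemma vdist_vertex: "w \<in> V \<Longrightarrow> vdist v w = (if w = v then 0 else 1)"
  unfolding vdist_def by (rule glue_vertex)

lemma continuous_map_vdist: "continuous_map Y euclideanreal (vdist v)"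
  unfolding vdist_def
proof (rule continuous_map_glue)
  fix e show "continuous_map unit_interval euclideanreal
      (\<lambda>t. min (if \<Phi> e 0 = v then min 1 (3*t) else 1) (if \<Phi> e 1 = v then min 1 (3*(1-t)) else 1))"
    by (cases "\<Phi> e 0 = v"; cases "\<Phi> e 1 = v") (auto intro!: continuous_intros)
qed auto

text \<open>\<open>sk\<close> stands for the 0-skeleton. The value is the smallest of all
  \<open>vdist v\<close>, written edgewise because there may be infinitely many vertices.\<close>

definition skdist :: "'a \<Rightarrow> real" where
  "skdist = glue (\<lambda>_. 0) (\<lambda>e t. min 1 (min (3*t) (3*(1-t))))"

lemma skdist_\<Phi>: "e \<in> E \<Longrightarrow> t \<in> {0..1} \<Longrightarrow> skdist (\<Phi> e t) = min 1 (min (3*t) (3*(1-t)))"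
  unfolding skdist_def by (rule glue_\<Phi>) auto

lemma continuous_map_skdist: "continuous_map Y euclideanreal skdist"
  unfolding skdist_def by (rule continuous_map_glue) (auto intro!: continuous_intros)

lemma vdist_bounds: "y \<in> topspace Y \<Longrightarrow> 0 \<le> vdist v y \<and> vdist v y \<le> 1"
  by (erule point_on_edge) (auto simp: vdist_\<Phi>)

lemma skdist_bounds: "y \<in> topspace Y \<Longrightarrow> 0 \<le> skdist y \<and> skdist y \<le> 1"
  by (erule point_on_edge) (auto simp: skdist_\<Phi>)

lemma vdist_eq_0: assumes "y \<in> topspace Y" shows "vdist v y = 0 \<longleftrightarrow> y = v \<and> v \<in> V"
proof (cases "y \<in> V")
  case True then show ?thesis by (auto simp: vdist_vertex)
next
  case False
  obtain e t where "e \<in> E" "t \<in> {0..1}" "y = \<Phi> e t" using assms by (rule point_on_edge)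
  moreover from this False have "t \<noteq> 0" "t \<noteq> 1" using \<Phi>_mem_V by auto
  ultimately show ?thesis using False by (auto simp: vdist_\<Phi> min_def)
qed

lemma skdist_eq_0: assumes "y \<in> topspace Y" shows "skdist y = 0 \<longleftrightarrow> y \<in> V"
proof -
  obtain e t where "e \<in> E" "t \<in> {0..1}" "y = \<Phi> e t" using assms by (rule point_on_edge)
  then show ?thesis by (auto simp: skdist_\<Phi> \<Phi>_mem_V min_def)
qed

text \<open>A parameter cannot lie in the first and in the last third of its edge at once, and each
  of these thirds belongs to one end vertex.\<close>

lemma vdist_unique:
  assumes "y \<in> topspace Y" "vdist v y < 1" "vdist w y < 1" shows "v = w"
proof -
  obtain e t where "e \<in> E" "t \<in> {0..1}" "y = \<Phi> e t" using assms(1) by (rule point_on_edge)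
  then show ?thesis using assms(2,3) by (auto simp: vdist_\<Phi> split: if_splits)
qed

lemma vdist_vertex_of_less_1:
  assumes "y \<in> topspace Y" "vdist v y < 1" shows "v \<in> V" "skdist y = vdist v y"
proof -
  obtain e t where "e \<in> E" "t \<in> {0..1}" "y = \<Phi> e t" using assms(1) by (rule point_on_edge)
  then show "v \<in> V" "skdist y = vdist v y"
    using assms(2) \<Phi>_0 \<Phi>_1 by (auto simp: vdist_\<Phi> skdist_\<Phi> split: if_splits)
qed

lemma skdist_less_1:
  assumes "y \<in> topspace Y" "skdist y < 1" obtains v where "v \<in> V" "vdist v y < 1"
proof -
  obtain e t where e: "e \<in> E" "t \<in> {0..1}" "y = \<Phi> e t" using assms(1) by (rule point_on_edge)
  show ?thesis
  proof (cases "3 * t < 1")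
    case True
    then show ?thesis using that[of "\<Phi> e 0"] e by (auto simp: vdist_\<Phi> \<Phi>_0)
  next
    case False
    then show ?thesis using that[of "\<Phi> e 1"] e assms(2) by (auto simp: vdist_\<Phi> \<Phi>_1 skdist_\<Phi>)
  qed
qed

text \<open>At \<open>u = 1\<close> the outer thirds of the edge sit at the ends and the middle
  third is stretched over the whole edge; \<open>u\<close> interpolates linearly from the identity.
  The ends stay fixed, so that the edges fit together at the vertices.\<close>

definition collapse_coord :: "real \<Rightarrow> real \<Rightarrow> real" where
  "collapse_coord u t = (1 - u) * t + u * max 0 (min 1 (3 * t - 1))"

lemma collapse_coord_bounds:
  assumes "u \<in> {0..1}" "t \<in> {0..1}" shows "collapse_coord u t \<in> {0..1}"
proof -
  have "closed_segment t (max 0 (min 1 (3 * t - 1))) \<subseteq> {0..1}"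
    by (rule closed_segment_subset) (use assms in \<open>auto\<close>)
  moreover have "collapse_coord u t \<in> closed_segment t (max 0 (min 1 (3 * t - 1)))"
    unfolding collapse_coord_def in_segment using assms by auto
  ultimately show ?thesis by blast
qed

definition collapse :: "real \<Rightarrow> 'a \<Rightarrow> 'a" where
  "collapse u = glue (\<lambda>y. y) (\<lambda>e t. \<Phi> e (collapse_coord u t))"

lemma collapse_\<Phi>: "e \<in> E \<Longrightarrow> t \<in> {0..1} \<Longrightarrow> collapse u (\<Phi> e t) = \<Phi> e (collapse_coord u t)"
  unfolding collapse_def by (rule glue_\<Phi>) (auto simp: collapse_coord_def)

lemma continuous_map_collapse:
  "continuous_map (prod_topology unit_interval Y) Y (\<lambda>(u, y). collapse u y)"
proof (rule continuous_map_from_homotopy_on_graph)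
  fix e assume e: "e \<in> E"
  have "continuous_map (prod_topology unit_interval unit_interval) unit_interval (\<lambda>(u, t). collapse_coord u t)"
  proof -
    have "continuous_on ({0..1} \<times> {0..1}) (\<lambda>p. collapse_coord (fst p) (snd p))"
      unfolding collapse_coord_def by (intro continuous_intros)
    moreover have "prod_topology unit_interval unit_interval = top_of_set ({0..1} \<times> {0..1})"
      by (simp add: prod_topology_subtopology subtopology_subtopology euclidean_product_topology Times_Int_Times)
    ultimately show ?thesis using collapse_coord_bounds
      by (auto simp: case_prod_unfold Pi_iff)
  qed
  then have "continuous_map (prod_topology unit_interval unit_interval) Y (\<Phi> e \<circ> (\<lambda>(u, t). collapse_coord u t))"
    by (rule continuous_map_compose[OF _ \<Phi>_continuous[OF e]])
  then show "continuous_map (prod_topology unit_interval unit_interval) Y (\<lambda>(u, t). (\<lambda>(u, y). collapse u y) (u, \<Phi> e t))"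
    by (rule continuous_map_eq) (use collapse_\<Phi>[OF e] in auto)
qed

lemma collapse_0: "y \<in> topspace Y \<Longrightarrow> collapse 0 y = y"
  by (erule point_on_edge) (auto simp: collapse_\<Phi> collapse_coord_def)

lemma collapse_in: "y \<in> topspace Y \<Longrightarrow> u \<in> {0..1} \<Longrightarrow> collapse u y \<in> topspace Y"
  using continuous_map_image_subset_topspace[OF continuous_map_collapse] by (simp add: image_subset_iff)

text \<open>Inside a star the collapse is radial. Distances to the centre only shrink, so a
  collapsing point remains nearer to it than a point that was farther off and stays put.\<close>

lemma vdist_collapse:
  assumes "y \<in> topspace Y" "vdist v y < 1" "u \<in> {0..1}"
  shows "vdist v (collapse u y) = (1 - u) * vdist v y"
proof -
  obtain e t where e: "e \<in> E" "t \<in> {0..1}" "y = \<Phi> e t" using assms(1) by (rule point_on_edge)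
  have c: "collapse_coord u t \<in> {0..1}" using collapse_coord_bounds e assms by blast
  consider "\<Phi> e 0 = v" "3 * t < 1" | "\<Phi> e 1 = v" "3 * (1 - t) < 1"
    using assms(2) e by (auto simp: vdist_\<Phi> min_def split: if_splits)
  then show ?thesis
  proof cases
    case 1
    then have "collapse_coord u t = (1 - u) * t" by (simp add: collapse_coord_def)
    moreover have "(1 - u) * t \<le> t" using e assms(3) by (simp add: mult_left_le_one_le)
    ultimately show ?thesis using 1 e c assms(3) by (simp add: collapse_\<Phi> vdist_\<Phi>)
  next
    case 2
    then have "collapse_coord u t = 1 - (1 - u) * (1 - t)" by (simp add: collapse_coord_def algebra_simps)
    moreover have "(1 - u) * (1 - t) \<le> 1 - t" using e assms(3) by (simp add: mult_left_le_one_le)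
    ultimately show ?thesis using 2 e c assms(3) by (simp add: collapse_\<Phi> vdist_\<Phi>)
  qed
qed

end

section \<open>Motion planners from coloured open covers\<close>

lemma openin_Collect_ball:
  assumes "finite I" "\<And>i. i \<in> I \<Longrightarrow> openin X {x \<in> topspace X. P i x}"
  shows "openin X {x \<in> topspace X. \<forall>i\<in>I. P i x}"
proof -
  have "openin X ((\<Inter>i\<in>I. {x \<in> topspace X. P i x}) \<inter> topspace X)" using assms by (rule openin_INT)
  moreover have "(\<Inter>i\<in>I. {x \<in> topspace X. P i x}) \<inter> topspace X = {x \<in> topspace X. \<forall>i\<in>I. P i x}" by auto
  ultimately show ?thesis by simp
qed

lemma openin_less:
  assumes "continuous_map X euclideanreal f" "continuous_map X euclideanreal g"
  shows "openin X {x \<in> topspace X. f x < g x}"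
proof -
  have "continuous_map X euclideanreal (\<lambda>x. g x - f x)" by (intro continuous_map_diff assms)
  then have "openin X {x \<in> topspace X. g x - f x \<in> {0<..}}"
    by (rule openin_continuous_map_preimage) auto
  then show ?thesis by simp
qed

text \<open>Homotopies on disjoint open pieces need not match anywhere. So all pieces of one index
  share a motion planner, and planners are counted by indices, however many pieces there
  are.\<close>

lemma homotopic_with_Union_disjoint_open:
  assumes op: "\<And>T. T \<in> \<T> \<Longrightarrow> openin Z T" and disj: "pairwise disjnt \<T>"
    and hom: "\<And>T. T \<in> \<T> \<Longrightarrow> homotopic_with (\<lambda>_. True) (subtopology Z T) X f g"
  shows "homotopic_with (\<lambda>_. True) (subtopology Z (\<Union>\<T>)) X f g"
proof -
  have "\<forall>T\<in>\<T>. \<exists>h. continuous_map (prod_topology unit_interval (subtopology Z T)) X h \<and>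
           (\<forall>x. h (0, x) = f x) \<and> (\<forall>x. h (1, x) = g x)"
    using hom by (auto simp: homotopic_with_def)
  then obtain h where h: "\<And>T. T \<in> \<T> \<Longrightarrow> continuous_map (prod_topology unit_interval (subtopology Z T)) X (h T)"
    and h0: "\<And>T x. T \<in> \<T> \<Longrightarrow> h T (0, x) = f x" and h1: "\<And>T x. T \<in> \<T> \<Longrightarrow> h T (1, x) = g x" by metis
  define J where "J x = (THE T. T \<in> \<T> \<and> x \<in> T)" for x
  have J: "J x = T" if "T \<in> \<T>" "x \<in> T" for T x
    unfolding J_def by (rule the_equality) (use that disj in \<open>auto simp: pairwise_def disjnt_iff\<close>)
  define H where "H = (\<lambda>(t::real, x). h (J x) (t, x))"
  let ?P = "prod_topology unit_interval (subtopology Z (\<Union>\<T>))"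
  have "continuous_map ?P X H"
  proof (rule pasting_lemma[where I=\<T> and T="\<lambda>T. {0..1} \<times> T" and f=h])
    fix T assume T: "T \<in> \<T>"
    have "openin (subtopology Z (\<Union>\<T>)) T"
      using op[OF T] T by (auto simp: openin_subtopology intro!: exI[of _ T])
    then show "openin ?P ({0..1} \<times> T)" using openin_topspace[of unit_interval] by (simp add: openin_prod_Times_iff)
    have "topspace Z \<inter> \<Union>\<T> \<inter> T = topspace Z \<inter> T" using T by blast
    then have "subtopology ?P ({0..1} \<times> T) = prod_topology unit_interval (subtopology Z T)"
      using T by (simp add: prod_topology_subtopology subtopology_subtopology Times_Int_Times)
    then show "continuous_map (subtopology ?P ({0..1} \<times> T)) X (h T)" using h[OF T] by simp
  next
    fix S T x assume "S \<in> \<T>" "T \<in> \<T>" "x \<in> topspace ?P \<inter> {0..1} \<times> S \<inter> {0..1} \<times> T"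
    then have "S = T" using J by (metis IntE SigmaE2 prod.collapse)
    then show "h S x = h T x" by simp
  next
    fix p assume "p \<in> topspace ?P"
    then obtain t x T where "p = (t, x)" "t \<in> {0..1}" "T \<in> \<T>" "x \<in> T" by auto
    then show "\<exists>T. T \<in> \<T> \<and> p \<in> {0..1} \<times> T \<and> H p = h T p" using J by (auto simp: H_def)
  qed
  moreover have "\<forall>x\<in>topspace (subtopology Z (\<Union>\<T>)). H (0, x) = f x \<and> H (1, x) = g x"
    using J h0 h1 by (auto simp: H_def)
  ultimately show ?thesis by (subst homotopic_with) auto
qed

text \<open>Contractible inside \<open>Z\<close>, not in itself: the homotopy may leave
  \<open>N\<close>, and \<open>c\<close> need not lie in \<open>N\<close>.\<close>

definition null_in :: "'z topology \<Rightarrow> 'z set \<Rightarrow> bool" where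
  "null_in Z N \<longleftrightarrow> (\<exists>c\<in>topspace Z. homotopic_with (\<lambda>_. True) (subtopology Z N) Z (\<lambda>z. z) (\<lambda>_. c))"

text \<open>Contract the first point to \<open>c\<close>, travel to \<open>c'\<close>, and run the
  contraction of the second point backwards.\<close>

lemma homotopic_fst_snd_null:
  assumes Z: "path_connected_space Z" and N: "null_in Z N" "null_in Z N'" and Q: "Q \<subseteq> N \<times> N'"
  shows "homotopic_with (\<lambda>_. True) (subtopology (prod_topology Z Z) Q) Z fst snd"
proof -
  let ?Q = "subtopology (prod_topology Z Z) Q"
  obtain c c' where c: "c \<in> topspace Z" "homotopic_with (\<lambda>_. True) (subtopology Z N) Z (\<lambda>z. z) (\<lambda>_. c)"
    and c': "c' \<in> topspace Z" "homotopic_with (\<lambda>_. True) (subtopology Z N') Z (\<lambda>z. z) (\<lambda>_. c')"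
    using N by (auto simp: null_in_def)
  have cf: "continuous_map ?Q (subtopology Z N) fst" "continuous_map ?Q (subtopology Z N') snd"
    using Q by (auto simp: continuous_map_in_subtopology continuous_map_from_subtopology continuous_map_fst continuous_map_snd)
  have 1: "homotopic_with (\<lambda>_. True) ?Q Z fst (\<lambda>_. c)"
    using homotopic_with_compose_continuous_map_right[OF c(2) cf(1), of "\<lambda>_. True"] by (simp add: o_def)
  have 2: "homotopic_with (\<lambda>_. True) ?Q Z snd (\<lambda>_. c')"
    using homotopic_with_compose_continuous_map_right[OF c'(2) cf(2), of "\<lambda>_. True"] by (simp add: o_def)
  have "path_component_of Z c c'" using Z c(1) c'(1) by (simp add: path_connected_space_iff_path_component)
  then have 3: "homotopic_with (\<lambda>_. True) ?Q Z (\<lambda>_. c) (\<lambda>_. c')" by (simp add: homotopic_constant_maps)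
  show ?thesis using 1 2 3 by (meson homotopic_with_sym homotopic_with_trans)
qed

text \<open>\<open>S\<close> is the set of coordinates treated as close to vertices, and
  \<open>\<N> S\<close> lists the disjoint pieces of the corresponding region. A subset
  \<open>T\<close> of the 2n weights of a pair is coded by \<open>Inl\<close> for the first point
  and \<open>Inr\<close> for the second; its cardinality runs from 0 to 2n, whence 2n + 1 open
  sets.\<close>

lemma motion_planning_cover:
  fixes g :: "nat \<Rightarrow> 'z \<Rightarrow> real"
  assumes Z: "path_connected_space Z"
    and g: "\<And>i. i \<in> {1..n} \<Longrightarrow> continuous_map Z euclideanreal (g i)"
    and op: "\<And>S N. S \<subseteq> {1..n} \<Longrightarrow> N \<in> \<N> S \<Longrightarrow> openin Z N"
    and null: "\<And>S N. S \<subseteq> {1..n} \<Longrightarrow> N \<in> \<N> S \<Longrightarrow> null_in Z N"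
    and disj: "\<And>S. S \<subseteq> {1..n} \<Longrightarrow> pairwise disjnt (\<N> S)"
    and cov: "\<And>S. S \<subseteq> {1..n} \<Longrightarrow>
       \<Union>(\<N> S) = {z \<in> topspace Z. (\<forall>i\<in>S. g i z < 1) \<and> (\<forall>i\<in>{1..n}-S. 0 < g i z)}"
  obtains U :: "nat \<Rightarrow> ('z \<times> 'z) set" where
    "(\<Union>k\<in>{..2*n}. U k) = topspace (prod_topology Z Z)"
    "\<And>k. openin (prod_topology Z Z) (U k)"
    "\<And>k. homotopic_with (\<lambda>_. True) (subtopology (prod_topology Z Z) (U k)) Z fst snd"
proof -
  let ?ZZ = "prod_topology Z Z"
  define I where "I = {1..n} <+> {1..n}"
  define G :: "'z \<times> 'z \<Rightarrow> nat + nat \<Rightarrow> real"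
    where "G p a = (case a of Inl i \<Rightarrow> g i (fst p) | Inr i \<Rightarrow> g i (snd p))" for p a
  define Q where "Q T N N' = {p \<in> N \<times> N'. \<forall>a\<in>T. \<forall>b\<in>I - T. G p a < G p b}" for T N N'
  define \<T> where "\<T> k = {Q T N N' | T N N'. T \<subseteq> I \<and> card T = k \<and> N \<in> \<N> (Inl -` T) \<and> N' \<in> \<N> (Inr -` T)}" for k
  define U where "U k = \<Union>(\<T> k)" for k
  have finI: "finite I" and cardI: "card I = 2 * n" by (simp_all add: I_def card_Plus)
  have sub: "Inl -` T \<subseteq> {1..n}" "Inr -` T \<subseteq> {1..n}" if "T \<subseteq> I" for T
    using that by (auto simp: I_def)
  have Gc: "continuous_map ?ZZ euclideanreal (\<lambda>p. G p a)" if "a \<in> I" for a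
  proof (cases a)
    case (Inl i)
    then have "i \<in> {1..n}" using that by (auto simp: I_def)
    from continuous_map_compose[OF continuous_map_fst g[OF this]] show ?thesis
      by (simp add: Inl G_def o_def)
  next
    case (Inr i)
    then have "i \<in> {1..n}" using that by (auto simp: I_def)
    from continuous_map_compose[OF continuous_map_snd g[OF this]] show ?thesis
      by (simp add: Inr G_def o_def)
  qed
  have Qopen: "openin ?ZZ (Q T N N')" if T: "T \<subseteq> I" "N \<in> \<N> (Inl -` T)" "N' \<in> \<N> (Inr -` T)" for T N N'
  proof -
    have NN: "openin ?ZZ (N \<times> N')" using op[OF sub(1)[OF T(1)] T(2)] op[OF sub(2)[OF T(1)] T(3)]
      by (simp add: openin_prod_Times_iff)
    have "openin ?ZZ {p \<in> topspace ?ZZ. \<forall>q\<in>T \<times> (I - T). G p (fst q) < G p (snd q)}"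
    proof (rule openin_Collect_ball)
      show "finite (T \<times> (I - T))" using T(1) finI finite_subset by blast
      fix q assume "q \<in> T \<times> (I - T)"
      then show "openin ?ZZ {p \<in> topspace ?ZZ. G p (fst q) < G p (snd q)}"
        using T(1) by (intro openin_less Gc) auto
    qed
    then have "openin ?ZZ (N \<times> N' \<inter> {p \<in> topspace ?ZZ. \<forall>q\<in>T \<times> (I - T). G p (fst q) < G p (snd q)})"
      using NN by (rule openin_Int[rotated])
    moreover have "N \<times> N' \<inter> {p \<in> topspace ?ZZ. \<forall>q\<in>T \<times> (I - T). G p (fst q) < G p (snd q)} = Q T N N'"
      using openin_subset[OF NN] by (auto simp: Q_def)
    ultimately show ?thesis by simp
  qed
  \<comment> \<open>Two different sets of equal size have elements \<open>a\<close> and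
    \<open>b\<close>, each outside the other set, and the separations would demand both
    \<open>G p a < G p b\<close> and \<open>G p b < G p a\<close>.\<close>
  have Teq: "T = T'" if TT: "T \<subseteq> I" "T' \<subseteq> I" "card T = card T'" "p \<in> Q T N N'" "p \<in> Q T' M M'" for T T' p N N' M M'
  proof (rule ccontr)
    assume "T \<noteq> T'"
    have "finite T" "finite T'" using TT finI finite_subset by auto
    then obtain a b where "a \<in> T" "a \<notin> T'" "b \<in> T'" "b \<notin> T"
      using \<open>T \<noteq> T'\<close> TT(3) by (metis card_subset_eq subsetI)
    then have "G p a < G p b" "G p b < G p a" using TT by (auto simp: Q_def)
    then show False by simp
  qed
  have Tdisj: "pairwise disjnt (\<T> k)" for k
    unfolding pairwise_def
  proof (intro ballI impI)
    fix A B assume "A \<in> \<T> k" "B \<in> \<T> k" and AB: "A \<noteq> B"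
    then obtain T N N' T' M M' where A: "A = Q T N N'" "T \<subseteq> I" "card T = k" "N \<in> \<N> (Inl -` T)" "N' \<in> \<N> (Inr -` T)"
      and B: "B = Q T' M M'" "T' \<subseteq> I" "card T' = k" "M \<in> \<N> (Inl -` T')" "M' \<in> \<N> (Inr -` T')"
      unfolding \<T>_def by blast
    show "disjnt A B"
    proof (rule ccontr)
      assume "\<not> disjnt A B"
      then obtain p where p: "p \<in> Q T N N'" "p \<in> Q T' M M'" using A B by (auto simp: disjnt_iff)
      then have T: "T = T'" using Teq A B by metis
      have "fst p \<in> N \<inter> M" "snd p \<in> N' \<inter> M'" using p by (auto simp: Q_def)
      then have "\<not> disjnt N M" "\<not> disjnt N' M'" by (auto simp: disjnt_iff)
      moreover have "N \<noteq> M \<Longrightarrow> disjnt N M" "N' \<noteq> M' \<Longrightarrow> disjnt N' M'"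
        using pairwiseD[OF disj[OF sub(1)[OF A(2)]]] pairwiseD[OF disj[OF sub(2)[OF A(2)]]] A B T by simp_all
      ultimately have "N = M" "N' = M'" by blast+
      then show False using A B AB T by simp
    qed
  qed
  have Topen: "openin ?ZZ A" if "A \<in> \<T> k" for A k
    using that Qopen unfolding \<T>_def by blast
  have "openin ?ZZ (U k)" for k unfolding U_def using Topen by blast
  moreover have "homotopic_with (\<lambda>_. True) (subtopology ?ZZ (U k)) Z fst snd" for k
    unfolding U_def
  proof (rule homotopic_with_Union_disjoint_open[OF Topen Tdisj])
    fix A assume "A \<in> \<T> k"
    then obtain T N N' where A: "A = Q T N N'" "T \<subseteq> I" "N \<in> \<N> (Inl -` T)" "N' \<in> \<N> (Inr -` T)"
      unfolding \<T>_def by blast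
    show "homotopic_with (\<lambda>_. True) (subtopology ?ZZ A) Z fst snd"
      by (rule homotopic_fst_snd_null[OF Z null[OF sub(1)[OF A(2)] A(3)] null[OF sub(2)[OF A(2)] A(4)]])
         (auto simp: A Q_def)
  qed auto
  moreover have "(\<Union>k\<in>{..2*n}. U k) = topspace ?ZZ"
  proof
    show "(\<Union>k\<in>{..2*n}. U k) \<subseteq> topspace ?ZZ"
      using \<open>\<And>k. openin ?ZZ (U k)\<close> openin_subset by blast
    show "topspace ?ZZ \<subseteq> (\<Union>k\<in>{..2*n}. U k)"
    proof
      fix p assume p: "p \<in> topspace ?ZZ"
      \<comment> \<open>With threshold 1 the chosen weights are strictly below the rest, and the
        rest are at least 1, in particular positive, as the region of \<open>T\<close>
        demands.\<close>
      define T where "T = {a \<in> I. G p a < 1}"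
      have T: "T \<subseteq> I" by (auto simp: T_def)
      have less: "\<forall>a\<in>T. \<forall>b\<in>I - T. G p a < G p b" by (force simp: T_def)
      have "fst p \<in> \<Union>(\<N> (Inl -` T))" "snd p \<in> \<Union>(\<N> (Inr -` T))"
        unfolding cov[OF sub(1)[OF T]] cov[OF sub(2)[OF T]] using p
        by (auto simp: T_def G_def I_def)
      then obtain N N' where N: "N \<in> \<N> (Inl -` T)" "N' \<in> \<N> (Inr -` T)" "fst p \<in> N" "snd p \<in> N'" by blast
      then have "p \<in> Q T N N'" using less by (auto simp: Q_def mem_Times_iff)
      then have "p \<in> U (card T)" using N T unfolding U_def \<T>_def by blast
      moreover have "card T \<le> 2 * n" using card_mono[OF finI T] cardI by simp
      ultimately show "p \<in> (\<Union>k\<in>{..2*n}. U k)" by blast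
    qed
  qed
  ultimately show ?thesis using that by blast
qed

lemma motion_planner_of_homotopy:
  assumes "homotopic_with (\<lambda>_. True) (subtopology (prod_topology X X) U) X fst snd"
  obtains s where "continuous_map (subtopology (prod_topology X X) U) (path_space X) s"
    "\<And>p. s p 0 = fst p" "\<And>p. s p 1 = snd p"
proof -
  obtain h where h: "continuous_map (prod_topology unit_interval (subtopology (prod_topology X X) U)) X h"
    "\<And>x. h (0, x) = fst x" "\<And>x. h (1, x) = snd x"
    using assms unfolding homotopic_with_def by metis
  show ?thesis by (rule that[OF continuous_map_into_path_space[OF h(1)]]) (simp_all add: h)
qed

lemma relative_TC_le:
  assumes "(\<Union>k\<in>{..m}. U k) = A" and A: "A \<subseteq> topspace (prod_topology X X)"
    and "\<And>k. openin (subtopology (prod_topology X X) A) (U k)"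
    and "\<And>k. homotopic_with (\<lambda>_. True) (subtopology (prod_topology X X) (U k)) X fst snd"
  shows "relative_TC X A \<le> enat (m + 1)"
proof -
  have "\<forall>k. \<exists>s. continuous_map (subtopology (prod_topology X X) (U k)) (path_space X) s \<and>
      (\<forall>p. s p 0 = fst p \<and> s p 1 = snd p)"
    using motion_planner_of_homotopy[OF assms(4)] by metis
  then obtain s where s: "\<And>k. continuous_map (subtopology (prod_topology X X) (U k)) (path_space X) (s k)"
     "\<And>k p. s k p 0 = fst p" "\<And>k p. s k p 1 = snd p" by metis
  have UA: "U k \<subseteq> A" for k using assms(3) openin_subset by fastforce
  have "(\<Union>i\<in>{1..m+1}. U (i - 1)) = A"
  proof -
    have "(\<lambda>i. i - 1) ` {1..m+1} = {..m}" by (force simp: image_iff)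
    then show ?thesis using assms(1) by (metis image_image)
  qed
  \<comment> \<open>\<open>path_space_on\<close> restricts only the pair of endpoints, and
    \<open>U k\<close> lies in \<open>A\<close>; the paths themselves may run anywhere in
    \<open>X\<close>.\<close>
  moreover have "continuous_map (subtopology (prod_topology X X) (U k)) (path_space_on X A) (s k)" for k
    unfolding path_space_on_def using s UA by (fastforce simp: continuous_map_in_subtopology)
  ultimately show ?thesis unfolding relative_TC_def
    by (intro Inf_lower CollectI exI[of _ "m+1"] conjI exI[of _ "\<lambda>i. U (i - 1)"] exI[of _ "\<lambda>i. s (i - 1)"] ballI refl)
       (auto simp: s assms(3) split: prod.splits)
qed

lemma TC_le:
  assumes "(\<Union>k\<in>{..m}. U k) = topspace (prod_topology X X)"
    and "\<And>k. openin (prod_topology X X) (U k)"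
    and "\<And>k. homotopic_with (\<lambda>_. True) (subtopology (prod_topology X X) (U k)) X fst snd"
  shows "TC X \<le> enat (m + 1)"
proof -
  have "\<forall>k. \<exists>s. continuous_map (subtopology (prod_topology X X) (U k)) (path_space X) s \<and>
      (\<forall>p. s p 0 = fst p \<and> s p 1 = snd p)"
    using motion_planner_of_homotopy[OF assms(3)] by metis
  then obtain s where s: "\<And>k. continuous_map (subtopology (prod_topology X X) (U k)) (path_space X) (s k)"
     "\<And>k p. s k p 0 = fst p" "\<And>k p. s k p 1 = snd p" by metis
  have "(\<Union>i\<in>{1..m+1}. U (i - 1)) = topspace (prod_topology X X)"
  proof -
    have "(\<lambda>i. i - 1) ` {1..m+1} = {..m}" by (force simp: image_iff)
    then show ?thesis using assms(1) by (metis image_image)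
  qed
  then show ?thesis unfolding TC_def
    by (intro Inf_lower CollectI exI[of _ "m+1"] conjI exI[of _ "\<lambda>i. U (i - 1)"] exI[of _ "\<lambda>i. s (i - 1)"] ballI refl)
       (auto simp: s assms(2) split: prod.splits)
qed

section \<open>The upper bound\<close>

text \<open>A common generalization of the power and the configuration space: only the pairs related by
  \<open>R\<close> are required to be distinct.\<close>

definition partial_config_space :: "nat \<Rightarrow> (nat \<Rightarrow> nat \<Rightarrow> bool) \<Rightarrow> 'a topology \<Rightarrow> (nat \<Rightarrow> 'a) topology" where
  "partial_config_space n R Y =
     subtopology (power_space n Y) {z. \<forall>i\<in>{1..n}. \<forall>j\<in>{1..n}. R i j \<longrightarrow> z i \<noteq> z j}"

lemma power_space_eq_partial: "power_space n Y = partial_config_space n (\<lambda>_ _. False) Y"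
  by (simp add: partial_config_space_def)

lemma config_space_eq_partial: "config_space n Y = partial_config_space n (\<noteq>) Y"
proof -
  have "{z. inj_on z {1..n}} = {z. \<forall>i\<in>{1..n}. \<forall>j\<in>{1..n}. i \<noteq> j \<longrightarrow> z i \<noteq> z j}"
    by (auto simp: inj_on_def)
  then show ?thesis unfolding config_space_def partial_config_space_def by (rule arg_cong)
qed

lemma topspace_partial_config_space:
  "topspace (partial_config_space n R Y) =
     {z \<in> {1..n} \<rightarrow>\<^sub>E topspace Y. \<forall>i\<in>{1..n}. \<forall>j\<in>{1..n}. R i j \<longrightarrow> z i \<noteq> z j}"
  by (auto simp: partial_config_space_def power_space_def)

lemma continuous_map_partial_config_proj:
  "i \<in> {1..n} \<Longrightarrow> continuous_map (partial_config_space n R Y) Y (\<lambda>z. z i)"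
  unfolding partial_config_space_def power_space_def
  by (intro continuous_map_from_subtopology continuous_map_product_projection)

lemma continuous_map_into_partial_config:
  assumes "\<And>i. i \<in> {1..n} \<Longrightarrow> continuous_map X Y (f i)"
    and "\<And>x i j. x \<in> topspace X \<Longrightarrow> i \<in> {1..n} \<Longrightarrow> j \<in> {1..n} \<Longrightarrow> R i j \<Longrightarrow> f i x \<noteq> f j x"
  shows "continuous_map X (partial_config_space n R Y) (\<lambda>x. \<lambda>i\<in>{1..n}. f i x)"
  unfolding partial_config_space_def power_space_def continuous_map_in_subtopology
  using assms by (auto simp: continuous_map_componentwise)

section \<open>Weights of the coordinates\<close>

context cw_graph begin

definition vert :: "'a \<Rightarrow> 'a" where "vert y = (THE v. vdist v y < 1)"

lemma vert_eq: "y \<in> topspace Y \<Longrightarrow> vdist v y < 1 \<Longrightarrow> vert y = v"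
  unfolding vert_def by (rule the_equality) (auto intro: vdist_unique)

text \<open>How much farther \<open>y'\<close> is than \<open>y\<close> from the vertex near
  \<open>y\<close>. \<open>vert\<close> is meaningful only inside a star, hence the case
  distinction.\<close>

definition excess :: "'a \<Rightarrow> 'a \<Rightarrow> real" where
  "excess y y' = (if skdist y < 1 then max 0 (vdist (vert y) y' - skdist y) else 0)"

lemma excess_nonneg: "0 \<le> excess y y'"
  by (simp add: excess_def)

text \<open>Continuity across the boundary of a star holds since \<open>vdist\<close> is at most 1:
  the positive part tends to 0 as \<open>skdist y\<close> tends to 1. Because \<open>vert\<close>
  jumps from star to star, sub- and superlevel sets are written as unions of open sets over all
  vertices.\<close>

lemma continuous_map_excess: "continuous_map (prod_topology Y Y) euclideanreal (\<lambda>(y, y'). excess y y')"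
  unfolding continuous_map_upper_lower_semicontinuous_lt
proof (intro conjI allI)
  let ?P = "prod_topology Y Y"
  have d1: "continuous_map ?P euclideanreal (\<lambda>p. vdist v (fst p))" and
    d2: "continuous_map ?P euclideanreal (\<lambda>p. vdist v (snd p))" for v
    using continuous_map_compose[OF continuous_map_fst continuous_map_vdist]
      continuous_map_compose[OF continuous_map_snd continuous_map_vdist] by (auto simp: o_def)
  have d3: "continuous_map ?P euclideanreal (\<lambda>p. skdist (fst p))"
    using continuous_map_compose[OF continuous_map_fst continuous_map_skdist] by (auto simp: o_def)
  fix a :: real
  show "openin ?P {p \<in> topspace ?P. a < (case p of (y, y') \<Rightarrow> excess y y')}"
  proof (cases "a < 0")
    case True
    then have "{p \<in> topspace ?P. a < (case p of (y, y') \<Rightarrow> excess y y')} = topspace ?P"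
      using excess_nonneg by (force intro: less_le_trans)
    then show ?thesis by (simp only: openin_topspace)
  next
    case False
    \<comment> \<open>For \<open>a \<ge> 0\<close> the inequality on the right itself puts
      \<open>y\<close> into the star of \<open>v\<close>, as \<open>vdist v y'\<close> is at most
      1.\<close>
    have "{p \<in> topspace ?P. a < (case p of (y, y') \<Rightarrow> excess y y')} =
        (\<Union>v\<in>V. {p \<in> topspace ?P. vdist v (fst p) + a < vdist v (snd p)})" (is "?L = ?R")
    proof
      show "?L \<subseteq> ?R"
      proof
        fix p assume p: "p \<in> ?L"
        then obtain y y' where yy: "p = (y, y')" "y \<in> topspace Y" "y' \<in> topspace Y" "a < excess y y'" by auto
        then have sk: "skdist y < 1" using False by (auto simp: excess_def split: if_splits)
        then obtain v where v: "v \<in> V" "vdist v y < 1" using yy skdist_less_1 by blast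
        then have "vert y = v" "skdist y = vdist v y" using yy vert_eq vdist_vertex_of_less_1 by auto
        then have "vdist v y + a < vdist v y'" using yy sk False by (simp add: excess_def max_def split: if_splits)
        then show "p \<in> ?R" using yy v by auto
      qed
      show "?R \<subseteq> ?L"
      proof
        fix p assume "p \<in> ?R"
        then obtain v where p: "p \<in> topspace ?P" "vdist v (fst p) + a < vdist v (snd p)" by auto
        then obtain y y' where yy: "p = (y, y')" "y \<in> topspace Y" "y' \<in> topspace Y" by auto
        then have "vdist v y < 1" using p(2) False vdist_bounds[of y' v] by auto
        then have "vert y = v" "skdist y = vdist v y" "skdist y < 1" using yy vert_eq vdist_vertex_of_less_1 by auto
        then show "p \<in> ?L" using yy p by (auto simp: excess_def)
      qed
    qed
    moreover have "openin ?P \<dots>"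
      by (intro openin_clauses(3) ballI) (auto intro!: openin_less continuous_map_add d1 d2 simp del: topspace_prod_topology)
    ultimately show ?thesis by simp
  qed
  show "openin ?P {p \<in> topspace ?P. (case p of (y, y') \<Rightarrow> excess y y') < a}"
  proof (cases "a \<le> 0")
    case True
    then have "{p \<in> topspace ?P. (case p of (y, y') \<Rightarrow> excess y y') < a} = {}"
      using excess_nonneg by (auto simp: not_less intro: order_trans)
    then show ?thesis by (simp only: openin_empty)
  next
    case False
    \<comment> \<open>The first set on the right takes care of points outside the stars or close to
      their boundary, where the excess is at most \<open>1 - skdist y\<close>.\<close>
    have "{p \<in> topspace ?P. (case p of (y, y') \<Rightarrow> excess y y') < a} =
        {p \<in> topspace ?P. 1 - a < skdist (fst p)} \<union>
        (\<Union>v\<in>V. {p \<in> topspace ?P. vdist v (fst p) < 1} \<inter> {p \<in> topspace ?P. vdist v (snd p) < vdist v (fst p) + a})" (is "?L = ?R")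
    proof
      show "?L \<subseteq> ?R"
      proof
        fix p assume p: "p \<in> ?L"
        then obtain y y' where yy: "p = (y, y')" "y \<in> topspace Y" "y' \<in> topspace Y" "excess y y' < a" by auto
        show "p \<in> ?R"
        proof (cases "skdist y < 1")
          case sk: True
          then obtain v where v: "v \<in> V" "vdist v y < 1" using yy skdist_less_1 by blast
          then have "vert y = v" "skdist y = vdist v y" using yy vert_eq vdist_vertex_of_less_1 by auto
          then have "vdist v y' < vdist v y + a" using yy sk False by (simp add: excess_def)
          then show "p \<in> ?R" using yy v by auto
        qed (use yy False in auto)
      qed
      show "?R \<subseteq> ?L"
      proof
        fix p assume R: "p \<in> ?R"
        then obtain y y' where yy: "p = (y, y')" "y \<in> topspace Y" "y' \<in> topspace Y" by auto
        from R yy consider "1 - a < skdist y" | v where "vdist v y < 1" "vdist v y' < vdist v y + a" by auto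
        then show "p \<in> ?L"
        proof cases
          case 1
          then show ?thesis using yy vdist_bounds[of y' "vert y"] False by (auto simp: excess_def)
        next
          case 2
          then have "vert y = v" "skdist y = vdist v y" using yy vert_eq vdist_vertex_of_less_1 by auto
          then show ?thesis using yy 2 False by (auto simp: excess_def)
        qed
      qed
    qed
    moreover have "openin ?P \<dots>"
      by (intro openin_Un openin_clauses(3) ballI)
         (auto intro!: openin_less openin_Int continuous_map_add d1 d2 d3 simp del: topspace_prod_topology)
    ultimately show ?thesis by simp
  qed
qed

text \<open>Continuous off the diagonal, and less than \<open>1\<close> iff \<open>y\<close> lies in a star and is closer to its centre than \<open>y'\<close>.\<close>

definition closeness :: "'a \<Rightarrow> 'a \<Rightarrow> real" where
  "closeness y y' = skdist y / (skdist y + excess y y')"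

text \<open>Both summands vanish only if \<open>y\<close> is a vertex and \<open>y'\<close> is at
  distance 0 from it, that is, if \<open>y' = y\<close>.\<close>

lemma closeness_denom_pos:
  assumes "y \<in> topspace Y" "y' \<in> topspace Y" "y \<noteq> y'" shows "0 < skdist y + excess y y'"
proof (cases "skdist y = 0")
  case True
  then have "y \<in> V" using assms skdist_eq_0 by blast
  then have "vdist y y = 0" by (simp add: vdist_vertex)
  then have "vert y = y" using vert_eq[OF assms(1), of y] by simp
  moreover have "vdist y y' > 0" using vdist_eq_0[OF assms(2), of y] vdist_bounds[OF assms(2), of y] assms(3) by auto
  ultimately show ?thesis using True by (simp add: excess_def)
next
  case False
  then have "0 < skdist y" using skdist_bounds[OF assms(1)] by simp
  then show ?thesis using excess_nonneg[of y y'] by simp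
qed

lemma closeness_bounds:
  assumes "y \<in> topspace Y" "y' \<in> topspace Y" "y \<noteq> y'" shows "0 \<le> closeness y y'" "closeness y y' \<le> 1"
  using closeness_denom_pos[OF assms] skdist_bounds[OF assms(1)] excess_nonneg[of y y'] by (auto simp: closeness_def)

lemma closeness_less_1:
  assumes y: "y \<in> topspace Y" "y' \<in> topspace Y" "y \<noteq> y'" and c: "closeness y y' < 1" and v: "vdist v y < 1"
  shows "vdist v y < vdist v y'"
proof -
  have "0 < excess y y'"
    using c closeness_denom_pos[OF y] by (simp add: closeness_def divide_less_eq)
  moreover have "vert y = v" "skdist y = vdist v y" using y v vert_eq vdist_vertex_of_less_1 by auto
  ultimately show ?thesis using v by (auto simp: excess_def)
qed

text \<open>On the space considered the factors lie in \<open>[0,1]\<close>, so a weight below 1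
  means that all are positive: coordinate \<open>i\<close> is in a star and strictly closer to its
  centre than every related coordinate. At a vertex all factors are 1 and the weight is 0. For empty
  \<open>R\<close> the weight is \<open>skdist (z i)\<close>.\<close>

definition weight :: "nat \<Rightarrow> (nat \<Rightarrow> nat \<Rightarrow> bool) \<Rightarrow> nat \<Rightarrow> (nat \<Rightarrow> 'a) \<Rightarrow> real" where
  "weight n R i z = 1 - (1 - skdist (z i)) * (\<Prod>j\<in>{j\<in>{1..n}. R i j}. 1 - closeness (z i) (z j))"

lemma continuous_map_weight:
  assumes i: "i \<in> {1..n}"
  shows "continuous_map (partial_config_space n R Y) euclideanreal (weight n R i)"
proof -
  let ?Z = "partial_config_space n R Y"
  have s: "continuous_map ?Z euclideanreal (\<lambda>z. skdist (z i))"
    using continuous_map_compose[OF continuous_map_partial_config_proj[OF i] continuous_map_skdist] by (simp add: o_def)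
  have c: "continuous_map ?Z euclideanreal (\<lambda>z. closeness (z i) (z j))" if j: "j \<in> {1..n}" "R i j" for j
    unfolding closeness_def
  proof (rule continuous_map_real_divide)
    have "continuous_map ?Z (prod_topology Y Y) (\<lambda>z. (z i, z j))"
      by (intro continuous_map_pairedI continuous_map_partial_config_proj i j)
    from continuous_map_compose[OF this continuous_map_excess]
    have "continuous_map ?Z euclideanreal (\<lambda>z. excess (z i) (z j))" by (simp add: o_def)
    then show "continuous_map ?Z euclideanreal (\<lambda>z. skdist (z i) + excess (z i) (z j))"
      by (intro continuous_map_add s)
    fix z assume "z \<in> topspace ?Z"
    then have "z i \<in> topspace Y" "z j \<in> topspace Y" "z i \<noteq> z j"
      using i j unfolding topspace_partial_config_space by blast+
    then show "skdist (z i) + excess (z i) (z j) \<noteq> 0" using closeness_denom_pos by fastforce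
  qed (rule s)
  show ?thesis unfolding weight_def
    by (intro continuous_map_diff continuous_map_real_mult continuous_map_prod s c) auto
qed

lemma weight_less_1:
  assumes z: "z \<in> topspace (partial_config_space n R Y)" and i: "i \<in> {1..n}" and w: "weight n R i z < 1"
  shows "skdist (z i) < 1" "j \<in> {1..n} \<Longrightarrow> R i j \<Longrightarrow> closeness (z i) (z j) < 1"
proof -
  have zY: "z j \<in> topspace Y" if "j \<in> {1..n}" for j using z that by (auto simp: topspace_partial_config_space)
  have ne: "z i \<noteq> z j" if "j \<in> {1..n}" "R i j" for j using z i that by (auto simp: topspace_partial_config_space)
  have "(1 - skdist (z i)) * (\<Prod>j\<in>{j\<in>{1..n}. R i j}. 1 - closeness (z i) (z j)) > 0"
    using w by (simp add: weight_def)
  then have nz: "1 - skdist (z i) \<noteq> 0" "(\<Prod>j\<in>{j\<in>{1..n}. R i j}. 1 - closeness (z i) (z j)) \<noteq> 0"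
    by (metis less_irrefl mult_zero_left, metis less_irrefl mult_zero_right)
  then show "skdist (z i) < 1" using skdist_bounds[OF zY[OF i]] by auto
  assume j: "j \<in> {1..n}" "R i j"
  then have "1 - closeness (z i) (z j) \<noteq> 0" using nz(2) by (auto simp: prod_zero_iff)
  then show "closeness (z i) (z j) < 1" using closeness_bounds(2)[OF zY[OF i] zY[OF j(1)] ne[OF j]] by auto
qed

lemma weight_pos:
  assumes z: "z \<in> topspace (partial_config_space n R Y)" and i: "i \<in> {1..n}" and w: "0 < weight n R i z"
  shows "z i \<notin> V"
proof
  assume "z i \<in> V"
  then have "skdist (z i) = 0" using skdist_eq_0 V_subset by blast
  then have "weight n R i z = 0" by (simp add: weight_def closeness_def)
  then show False using w by simp
qed

section \<open>Pieces of constant combinatorial type\<close>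

definition weight_region :: "nat \<Rightarrow> (nat \<Rightarrow> nat \<Rightarrow> bool) \<Rightarrow> nat set \<Rightarrow> (nat \<Rightarrow> 'a) set" where
  "weight_region n R S = {z \<in> topspace (partial_config_space n R Y).
     (\<forall>i\<in>S. weight n R i z < 1) \<and> (\<forall>i\<in>{1..n}-S. 0 < weight n R i z)}"

text \<open>The combinatorial type is never given a name; it exists only through this relation,
  whose classes are the pieces. Disjointness of the pieces is then the usual fact about equivalence
  classes.\<close>

definition same_type :: "nat \<Rightarrow> (nat \<Rightarrow> nat \<Rightarrow> bool) \<Rightarrow> nat set \<Rightarrow> (nat \<Rightarrow> 'a) \<Rightarrow> (nat \<Rightarrow> 'a) \<Rightarrow> bool" where
  "same_type n R S w z \<longleftrightarrow> (\<forall>i\<in>S. \<forall>v. vdist v (w i) < 1 \<longleftrightarrow> vdist v (z i) < 1) \<and>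
     (\<forall>i\<in>{1..n}-S. \<forall>e\<in>E. w i \<in> e \<longleftrightarrow> z i \<in> e) \<and>
     (\<forall>i\<in>{1..n}-S. \<forall>j\<in>{1..n}-S. R i j \<longrightarrow> (\<forall>e\<in>E. w i \<in> e \<and> w j \<in> e \<longrightarrow>
        (coord e (w i) < coord e (w j) \<longleftrightarrow> coord e (z i) < coord e (z j))))"

definition type_piece :: "nat \<Rightarrow> (nat \<Rightarrow> nat \<Rightarrow> bool) \<Rightarrow> nat set \<Rightarrow> (nat \<Rightarrow> 'a) \<Rightarrow> (nat \<Rightarrow> 'a) set" where
  "type_piece n R S w = {z \<in> weight_region n R S. same_type n R S w z}"

lemma same_type_vdist:
  assumes "same_type n R S w z" "i \<in> S"
  shows "vdist v (w i) < 1 \<longleftrightarrow> vdist v (z i) < 1"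
  by (rule assms(1)[unfolded same_type_def, THEN conjunct1, THEN bspec, OF assms(2), THEN spec])

lemma same_type_edge:
  assumes "same_type n R S w z" "i \<in> {1..n}-S" "e \<in> E"
  shows "w i \<in> e \<longleftrightarrow> z i \<in> e"
  by (rule assms(1)[unfolded same_type_def, THEN conjunct2, THEN conjunct1, THEN bspec, OF assms(2),
        THEN bspec, OF assms(3)])

lemma same_type_coord:
  assumes "same_type n R S w z" "i \<in> {1..n}-S" "j \<in> {1..n}-S" "R i j" "e \<in> E" "w i \<in> e" "w j \<in> e"
  shows "coord e (w i) < coord e (w j) \<longleftrightarrow> coord e (z i) < coord e (z j)"
  by (rule assms(1)[unfolded same_type_def, THEN conjunct2, THEN conjunct2, THEN bspec, OF assms(2),
        THEN bspec, OF assms(3), THEN mp, OF assms(4), THEN bspec, OF assms(5), THEN mp, OF conjI[OF assms(6,7)]])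

lemma same_type_refl: "same_type n R S w w" by (simp add: same_type_def)

lemma same_typeI:
  assumes "\<And>i v. i \<in> S \<Longrightarrow> vdist v (w i) < 1 \<longleftrightarrow> vdist v (z i) < 1"
    and "\<And>i e. i \<in> {1..n}-S \<Longrightarrow> e \<in> E \<Longrightarrow> w i \<in> e \<longleftrightarrow> z i \<in> e"
    and "\<And>i j e. i \<in> {1..n}-S \<Longrightarrow> j \<in> {1..n}-S \<Longrightarrow> R i j \<Longrightarrow> e \<in> E \<Longrightarrow> w i \<in> e \<Longrightarrow> w j \<in> e \<Longrightarrow>
      coord e (w i) < coord e (w j) \<longleftrightarrow> coord e (z i) < coord e (z j)"
  shows "same_type n R S w z"
  unfolding same_type_def by (intro conjI ballI allI impI; (elim conjE)?; rule assms; assumption)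

lemma same_type_sym: assumes st: "same_type n R S w z" shows "same_type n R S z w"
proof (rule same_typeI)
  fix i v assume "i \<in> S"
  then show "vdist v (z i) < 1 \<longleftrightarrow> vdist v (w i) < 1" using same_type_vdist[OF st] by simp
next
  fix i e assume "i \<in> {1..n}-S" "e \<in> E"
  then show "z i \<in> e \<longleftrightarrow> w i \<in> e" using same_type_edge[OF st] by metis
next
  fix i j e assume *: "i \<in> {1..n}-S" "j \<in> {1..n}-S" "R i j" "e \<in> E" "z i \<in> e" "z j \<in> e"
  then have "w i \<in> e" "w j \<in> e" using same_type_edge[OF st] by metis+
  then show "coord e (z i) < coord e (z j) \<longleftrightarrow> coord e (w i) < coord e (w j)"
    using same_type_coord[OF st *(1-4)] by simp
qed

lemma same_type_trans:
  assumes st: "same_type n R S w z" "same_type n R S z x" shows "same_type n R S w x"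
proof (rule same_typeI)
  fix i v assume "i \<in> S"
  then show "vdist v (w i) < 1 \<longleftrightarrow> vdist v (x i) < 1"
    using same_type_vdist[OF st(1)] same_type_vdist[OF st(2)] by simp
next
  fix i e assume "i \<in> {1..n}-S" "e \<in> E"
  then show "w i \<in> e \<longleftrightarrow> x i \<in> e" using same_type_edge[OF st(1)] same_type_edge[OF st(2)] by metis
next
  fix i j e assume *: "i \<in> {1..n}-S" "j \<in> {1..n}-S" "R i j" "e \<in> E" "w i \<in> e" "w j \<in> e"
  then have "z i \<in> e" "z j \<in> e" using same_type_edge[OF st(1)] by metis+
  then show "coord e (w i) < coord e (w j) \<longleftrightarrow> coord e (x i) < coord e (x j)"
    using same_type_coord[OF st(1) *] same_type_coord[OF st(2) *(1-4)] by simp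
qed

text \<open>\<open>coord e\<close> has no meaning off \<open>e\<close>. The order is therefore
  expressed by a number \<open>r\<close> between the two coordinates, and each \<open>r\<close>
  gives a condition on open parts of the edge.\<close>

lemma coord_less_open:
  assumes e: "e \<in> E" and ij: "i \<in> {1..n}" "j \<in> {1..n}"
  shows "openin (partial_config_space n R Y)
    {z \<in> topspace (partial_config_space n R Y). z i \<in> e \<and> z j \<in> e \<and> coord e (z i) < coord e (z j)}"
    (is "openin ?Z ?A")
proof -
  have "?A = (\<Union>r\<in>{0<..<1}. {z \<in> topspace ?Z. z i \<in> \<Phi> e ` {0<..<r}} \<inter> {z \<in> topspace ?Z. z j \<in> \<Phi> e ` {r<..<1}})" (is "_ = ?B")
  proof
    show "?A \<subseteq> ?B"
    proof
      fix z assume z: "z \<in> ?A"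
      then obtain r where r: "coord e (z i) < r" "r < coord e (z j)" using dense by blast
      have "z i = \<Phi> e (coord e (z i))" "z j = \<Phi> e (coord e (z j))" using z \<Phi>_coord[OF e] by auto
      moreover have "0 < coord e (z i)" "coord e (z j) < 1" using z coord_bounds[OF e] by auto
      ultimately have "z i \<in> \<Phi> e ` {0<..<r}" "z j \<in> \<Phi> e ` {r<..<1}" "r \<in> {0<..<1}" using r
        by (auto intro: rev_image_eqI)
      then show "z \<in> ?B" using z by blast
    qed
    show "?B \<subseteq> ?A"
    proof
      fix z assume "z \<in> ?B"
      then obtain r t s where *: "0 < r" "r < 1" "z \<in> topspace ?Z" "z i = \<Phi> e t" "0 < t" "t < r"
        "z j = \<Phi> e s" "r < s" "s < 1" by auto
      then show "z \<in> ?A" using \<Phi>_mem_edge[OF e, of t] \<Phi>_mem_edge[OF e, of s] coord_\<Phi>[OF e, of t] coord_\<Phi>[OF e, of s] by auto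
    qed
  qed
  moreover have "openin ?Z ?B"
  proof (intro openin_clauses(3) ballI openin_Int)
    fix K assume "K \<in> (\<lambda>r. {z \<in> topspace ?Z. z i \<in> \<Phi> e ` {0<..<r}} \<inter> {z \<in> topspace ?Z. z j \<in> \<Phi> e ` {r<..<1}}) ` {0<..<1}"
    then obtain r where r: "r \<in> {0<..<1}"
      and K: "K = {z \<in> topspace ?Z. z i \<in> \<Phi> e ` {0<..<r}} \<inter> {z \<in> topspace ?Z. z j \<in> \<Phi> e ` {r<..<1}}" by blast
    show "openin ?Z K" unfolding K
      by (intro openin_Int openin_continuous_map_preimage[OF continuous_map_partial_config_proj] openin_edge_piece[OF e] ij)
         (use r in auto)
  qed
  ultimately show ?thesis by simp
qed

lemma weight_region_data:
  assumes w: "w \<in> weight_region n R S" and S: "S \<subseteq> {1..n}"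
  obtains v e where "\<And>i. i \<in> S \<Longrightarrow> v i \<in> V \<and> vdist (v i) (w i) < 1"
    "\<And>i. i \<in> {1..n} - S \<Longrightarrow> e i \<in> E \<and> w i \<in> e i"
proof -
  have wZ: "w \<in> topspace (partial_config_space n R Y)" using w by (simp add: weight_region_def)
  have wY: "w i \<in> topspace Y" if "i \<in> {1..n}" for i using wZ that by (auto simp: topspace_partial_config_space)
  have "\<exists>v. v \<in> V \<and> vdist v (w i) < 1" if i: "i \<in> S" for i
  proof -
    have "skdist (w i) < 1" using weight_less_1(1)[OF wZ] w i S by (auto simp: weight_region_def)
    then show ?thesis using skdist_less_1 wY i S by blast
  qed
  moreover have "\<exists>e. e \<in> E \<and> w i \<in> e" if i: "i \<in> {1..n} - S" for i
  proof -
    have "w i \<notin> V" using weight_pos[OF wZ] w i by (auto simp: weight_region_def)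
    then show ?thesis using wY[of i] i cells_cover by blast
  qed
  ultimately have "\<exists>v. \<forall>i\<in>S. v i \<in> V \<and> vdist (v i) (w i) < 1"
    "\<exists>e. \<forall>i\<in>{1..n} - S. e i \<in> E \<and> w i \<in> e i" by (intro bchoice, blast)+
  then show ?thesis using that by blast
qed

text \<open>With the vertices and edges of \<open>w\<close> fixed, membership is a finite
  conjunction of open conditions. The order clause is open in both cases because related coordinates
  on one edge are different, so that failure of \<open><\<close> is the reversed strict
  inequality.\<close>

lemma openin_type_piece:
  assumes w: "w \<in> weight_region n R S" and S: "S \<subseteq> {1..n}" and R: "\<And>i j. R i j \<Longrightarrow> R j i"
  shows "openin (partial_config_space n R Y) (type_piece n R S w)"
proof -
  let ?Z = "partial_config_space n R Y"
  obtain v e where v: "\<And>i. i \<in> S \<Longrightarrow> v i \<in> V \<and> vdist (v i) (w i) < 1"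
    and e: "\<And>i. i \<in> {1..n} - S \<Longrightarrow> e i \<in> E \<and> w i \<in> e i" using weight_region_data[OF w S] by blast
  have wZ: "w \<in> topspace ?Z" using w by (simp add: weight_region_def)
  have ZY: "z i \<in> topspace Y" if "z \<in> topspace ?Z" "i \<in> {1..n}" for z i
    using that by (auto simp: topspace_partial_config_space)
  define A where "A i z \<longleftrightarrow> (if i \<in> S then weight n R i z < 1 \<and> vdist (v i) (z i) < 1
     else 0 < weight n R i z \<and> z i \<in> e i)" for i z
  define B where "B i j z \<longleftrightarrow> (i \<notin> S \<and> j \<notin> S \<and> R i j \<and> e i = e j \<longrightarrow>
     (if coord (e i) (w i) < coord (e i) (w j) then z i \<in> e i \<and> z j \<in> e i \<and> coord (e i) (z i) < coord (e i) (z j)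
      else z j \<in> e i \<and> z i \<in> e i \<and> coord (e i) (z j) < coord (e i) (z i)))" for i j z
  have "openin ?Z {z \<in> topspace ?Z. A i z}" if i: "i \<in> {1..n}" for i
  proof (cases "i \<in> S")
    case True
    have "continuous_map ?Z euclideanreal (\<lambda>z. vdist (v i) (z i))"
      using continuous_map_compose[OF continuous_map_partial_config_proj[OF i] continuous_map_vdist] by (simp add: o_def)
    then have "openin ?Z ({z \<in> topspace ?Z. weight n R i z < 1} \<inter> {z \<in> topspace ?Z. vdist (v i) (z i) < 1})"
      by (intro openin_Int openin_less continuous_map_weight i) auto
    moreover have "{z \<in> topspace ?Z. weight n R i z < 1} \<inter> {z \<in> topspace ?Z. vdist (v i) (z i) < 1} = {z \<in> topspace ?Z. A i z}"
      using True by (auto simp: A_def)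
    ultimately show ?thesis by simp
  next
    case False
    then have "openin Y (e i)" using e i openin_edge by blast
    then have "openin ?Z ({z \<in> topspace ?Z. 0 < weight n R i z} \<inter> {z \<in> topspace ?Z. z i \<in> e i})"
      by (intro openin_Int openin_less continuous_map_weight i
          openin_continuous_map_preimage[OF continuous_map_partial_config_proj[OF i]]) auto
    moreover have "{z \<in> topspace ?Z. 0 < weight n R i z} \<inter> {z \<in> topspace ?Z. z i \<in> e i} = {z \<in> topspace ?Z. A i z}"
      using False by (auto simp: A_def)
    ultimately show ?thesis by simp
  qed
  then have oA: "openin ?Z {z \<in> topspace ?Z. \<forall>i\<in>{1..n}. A i z}" by (intro openin_Collect_ball) auto
  have "openin ?Z {z \<in> topspace ?Z. B i j z}" if ij: "i \<in> {1..n}" "j \<in> {1..n}" for i j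
  proof (cases "i \<notin> S \<and> j \<notin> S \<and> R i j \<and> e i = e j")
    case True
    then have "e i \<in> E" using e ij by blast
    then show ?thesis using True coord_less_open[of "e i" i n j R] coord_less_open[of "e i" j n i R] ij
      by (cases "coord (e i) (w i) < coord (e i) (w j)") (simp_all only: B_def if_True if_False simp_thms)
  next
    case False
    then have "{z \<in> topspace ?Z. B i j z} = topspace ?Z" by (auto simp: B_def)
    then show ?thesis by (simp only: openin_topspace)
  qed
  then have "openin ?Z {z \<in> topspace ?Z. \<forall>p\<in>{1..n}\<times>{1..n}. B (fst p) (snd p) z}"
    by (intro openin_Collect_ball) auto
  with oA have "openin ?Z ({z \<in> topspace ?Z. \<forall>i\<in>{1..n}. A i z} \<inter> {z \<in> topspace ?Z. \<forall>p\<in>{1..n}\<times>{1..n}. B (fst p) (snd p) z})"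
    by (rule openin_Int)
  moreover have "{z \<in> topspace ?Z. \<forall>i\<in>{1..n}. A i z} \<inter> {z \<in> topspace ?Z. \<forall>p\<in>{1..n}\<times>{1..n}. B (fst p) (snd p) z} = type_piece n R S w"
    (is "?L = _")
  proof (intro set_eqI iffI)
    fix z assume zL: "z \<in> ?L"
    then have z: "z \<in> topspace ?Z" and Az: "\<And>i. i \<in> {1..n} \<Longrightarrow> A i z"
      and Bz: "\<And>i j. i \<in> {1..n} \<Longrightarrow> j \<in> {1..n} \<Longrightarrow> B i j z" by auto
    have "z \<in> weight_region n R S"
      using z Az S unfolding weight_region_def A_def by (auto split: if_splits)
    moreover have "same_type n R S w z"
    proof (rule same_typeI)
      fix i u assume i: "i \<in> S"
      then have "vdist (v i) (z i) < 1" "i \<in> {1..n}" using Az[of i] S by (auto simp: A_def)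
      then show "vdist u (w i) < 1 \<longleftrightarrow> vdist u (z i) < 1"
        using v[OF i] vdist_unique[OF ZY[OF wZ]] vdist_unique[OF ZY[OF z]] by metis
    next
      fix i f assume i: "i \<in> {1..n} - S" and f: "f \<in> E"
      have "z i \<in> e i" using Az[of i] i by (auto simp: A_def)
      then show "w i \<in> f \<longleftrightarrow> z i \<in> f" using e[OF i] edges_eq[OF _ f] by metis
    next
      fix i j f assume i: "i \<in> {1..n} - S" and j: "j \<in> {1..n} - S" and "R i j" and f: "f \<in> E" and wf: "w i \<in> f" "w j \<in> f"
      have ei: "e i = f" "e j = f" using e[OF i] e[OF j] edges_eq f wf by metis+
      have "B i j z" using Bz i j by blast
      then show "coord f (w i) < coord f (w j) \<longleftrightarrow> coord f (z i) < coord f (z j)"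
        using i j \<open>R i j\<close> ei by (auto simp: B_def split: if_splits)
    qed
    ultimately show "z \<in> type_piece n R S w" by (simp add: type_piece_def)
  next
    fix z assume "z \<in> type_piece n R S w"
    then have zr: "z \<in> weight_region n R S" and st: "same_type n R S w z" by (auto simp: type_piece_def)
    then have z: "z \<in> topspace ?Z" by (simp add: weight_region_def)
    have ze: "z i \<in> e i" if "i \<in> {1..n} - S" for i using same_type_edge[OF st that] e[OF that] by blast
    have "A i z" if "i \<in> {1..n}" for i
      using zr same_type_vdist[OF st] v[of i] ze[of i] that by (auto simp: A_def weight_region_def)
    moreover have "B i j z" if ij: "i \<in> {1..n}" "j \<in> {1..n}" for i j
      unfolding B_def
    proof (intro impI)
      assume a: "i \<notin> S \<and> j \<notin> S \<and> R i j \<and> e i = e j"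
      then have i: "i \<in> {1..n} - S" and j: "j \<in> {1..n} - S" using ij by auto
      have eE: "e i \<in> E" "w i \<in> e i" "w j \<in> e i" "z i \<in> e i" "z j \<in> e i" using e[OF i] e[OF j] ze[OF i] ze[OF j] a by auto
      have "w i \<noteq> w j" "z i \<noteq> z j" using wZ z ij a by (auto simp: topspace_partial_config_space)
      then have "coord (e i) (w i) \<noteq> coord (e i) (w j)" "coord (e i) (z i) \<noteq> coord (e i) (z j)"
        using \<Phi>_coord[OF eE(1)] eE by metis+
      moreover have "coord (e i) (w i) < coord (e i) (w j) \<longleftrightarrow> coord (e i) (z i) < coord (e i) (z j)"
        using same_type_coord[OF st i j] a eE by blast
      ultimately show "if coord (e i) (w i) < coord (e i) (w j) then z i \<in> e i \<and> z j \<in> e i \<and> coord (e i) (z i) < coord (e i) (z j)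
      else z j \<in> e i \<and> z i \<in> e i \<and> coord (e i) (z j) < coord (e i) (z i)" using eE by auto
    qed
    ultimately show "z \<in> ?L" using z by auto
  qed
  ultimately show ?thesis by simp
qed

text \<open>What has to be checked is that related coordinates never collide. In the first stage the
  pushed ones go to different vertices, and each is nearer to its vertex than the related ones that
  stay. In the second stage the order along each edge is preserved.\<close>

lemma null_in_type_piece:
  assumes w: "w \<in> weight_region n R S" and S: "S \<subseteq> {1..n}" and R: "\<And>i j. R i j \<Longrightarrow> R j i"
  shows "null_in (partial_config_space n R Y) (type_piece n R S w)"
proof -
  let ?Z = "partial_config_space n R Y"
  define N where "N = type_piece n R S w"
  let ?N = "subtopology ?Z N"
  let ?P = "prod_topology unit_interval ?N"
  obtain v e where v: "\<And>i. i \<in> S \<Longrightarrow> v i \<in> V \<and> vdist (v i) (w i) < 1"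
    and e: "\<And>i. i \<in> {1..n} - S \<Longrightarrow> e i \<in> E \<and> w i \<in> e i" using weight_region_data[OF w S] by blast
  have wZ: "w \<in> topspace ?Z" and wN: "w \<in> N" using w same_type_refl by (auto simp: weight_region_def N_def type_piece_def)
  have NZ: "z \<in> topspace ?Z" if "z \<in> N" for z using that by (simp add: N_def type_piece_def weight_region_def)
  have ZY: "z i \<in> topspace Y" if "z \<in> N" "i \<in> {1..n}" for z i
    using NZ[OF that(1)] that by (auto simp: topspace_partial_config_space)
  have Zne: "z i \<noteq> z j" if "z \<in> N" "i \<in> {1..n}" "j \<in> {1..n}" "R i j" for z i j
    using NZ[OF that(1)] that by (auto simp: topspace_partial_config_space)
  have Nv: "vdist (v i) (z i) < 1" if "z \<in> N" "i \<in> S" for z i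
    using that v same_type_vdist by (auto simp: N_def type_piece_def)
  have Ne: "z i \<in> e i" if "z \<in> N" "i \<in> {1..n} - S" for z i
    using that(1) e[OF that(2)] same_type_edge[OF _ that(2)] unfolding N_def type_piece_def by blast
  have Nlt: "vdist (v i) (z i) < vdist (v i) (z j)" if "z \<in> N" "i \<in> S" "j \<in> {1..n}" "R i j" for z i j
  proof -
    have i: "i \<in> {1..n}" using that S by auto
    have "weight n R i z < 1" using that by (simp add: N_def type_piece_def weight_region_def)
    then have "closeness (z i) (z j) < 1" using weight_less_1(2)[OF NZ i] that by blast
    then show ?thesis using closeness_less_1 ZY Zne Nv that i by metis
  qed
  \<comment> \<open>With a common vertex, each of the two would have to be strictly closer to it
    than the other.\<close>
  have vne: "v i \<noteq> v j" if "i \<in> S" "j \<in> S" "R i j" for i j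
  proof
    assume "v i = v j"
    moreover have "vdist (v i) (w i) < vdist (v i) (w j)" "vdist (v j) (w j) < vdist (v j) (w i)"
      using Nlt wN that R S by blast+
    ultimately show False by simp
  qed
  have proj: "continuous_map ?P Y (\<lambda>p. snd p i)" if i: "i \<in> {1..n}" for i
  proof -
    have "continuous_map ?N Y (\<lambda>z. z i)"
      by (intro continuous_map_from_subtopology continuous_map_partial_config_proj i)
    from continuous_map_compose[OF continuous_map_snd this] show ?thesis by (simp add: o_def)
  qed
  have fstc: "continuous_map ?P unit_interval fst" by (rule continuous_map_fst)
  have tP: "topspace ?P = {0..1} \<times> N" using NZ by auto
  define h1 where "h1 i p = (if i \<in> S then collapse (fst p) (snd p i) else snd p i)" for i and p :: "real \<times> (nat \<Rightarrow> 'a)"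
  define H1 where "H1 p = (\<lambda>i\<in>{1..n}. h1 i p)" for p
  have H1: "continuous_map ?P ?Z H1" unfolding H1_def
  proof (rule continuous_map_into_partial_config)
    fix i assume i: "i \<in> {1..n}"
    have "continuous_map ?P (prod_topology unit_interval Y) (\<lambda>p. (fst p, snd p i))"
      by (intro continuous_map_pairedI fstc proj i)
    from continuous_map_compose[OF this continuous_map_collapse] proj[OF i]
    show "continuous_map ?P Y (h1 i)" by (cases "i \<in> S") (simp_all add: h1_def[abs_def] o_def)
  next
    fix p i j assume p: "p \<in> topspace ?P" and ij: "i \<in> {1..n}" "j \<in> {1..n}" "R i j"
    obtain u z where uz: "p = (u, z)" "u \<in> {0..1}" "z \<in> N" using p tP by auto
    have near: "vdist (v k) (h1 k p) < 1 \<and> vdist (v k) (h1 k p) \<le> vdist (v k) (z k)" if k: "k \<in> S" for k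
    proof -
      have kn: "k \<in> {1..n}" using k S by blast
      have "vdist (v k) (h1 k p) = (1 - u) * vdist (v k) (z k)"
        using vdist_collapse[OF ZY[OF uz(3) kn] Nv[OF uz(3) k] uz(2)] k uz(1) by (simp add: h1_def)
      moreover have "(1 - u) * vdist (v k) (z k) \<le> vdist (v k) (z k)"
        using uz(2) vdist_bounds[OF ZY[OF uz(3) kn]] by (intro mult_left_le_one_le) auto
      ultimately show ?thesis using Nv[OF uz(3) k] by simp
    qed
    have hY: "h1 k p \<in> topspace Y" if "k \<in> {1..n}" for k
      using collapse_in[OF ZY[OF uz(3) that] uz(2)] ZY[OF uz(3) that] uz by (simp add: h1_def)
    \<comment> \<open>\<open>j\<close> does not move, and \<open>i\<close> only gets nearer to
      \<open>v i\<close>, to which it was strictly nearer than \<open>j\<close> from the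
      start.\<close>
    have mixed: "h1 i p \<noteq> h1 j p" if "i \<in> S" "j \<notin> S" "i \<in> {1..n}" "j \<in> {1..n}" "R i j" for i j
    proof -
      have "vdist (v i) (h1 i p) < vdist (v i) (z j)"
        using near[OF that(1)] Nlt[OF uz(3) that(1,4,5)] by simp
      moreover have "h1 j p = z j" using that uz by (simp add: h1_def)
      ultimately show ?thesis by auto
    qed
    show "h1 i p \<noteq> h1 j p"
    proof (cases "i \<in> S"; cases "j \<in> S")
      assume S2: "i \<in> S" "j \<in> S"
      then show ?thesis using near[OF S2(1)] near[OF S2(2)] vne[OF S2 ij(3)] vdist_unique[OF hY[OF ij(1)]] by metis
    next
      assume "i \<notin> S" "j \<notin> S"
      then show ?thesis using Zne[OF uz(3) ij] uz by (simp add: h1_def)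
    qed (use mixed ij R in metis)+
  qed
  have h1_end: "h1 i (1, z) = v i" if "z \<in> N" "i \<in> S" for i z
  proof -
    have i: "i \<in> {1..n}" using that S by blast
    have "vdist (v i) (collapse 1 (z i)) = 0" using vdist_collapse[OF ZY[OF that(1) i] Nv[OF that], of 1] by simp
    then show ?thesis using vdist_eq_0 collapse_in[OF ZY[OF that(1) i], of 1] that(2) by (simp add: h1_def)
  qed
  \<comment> \<open>The remaining coordinates slide linearly to their places in \<open>w\<close>.
    Linear interpolation between two equally ordered pairs keeps the order.\<close>
  define c where "c i u z = (1 - u) * coord (e i) (z i) + u * coord (e i) (w i)" for i u and z :: "nat \<Rightarrow> 'a"
  have cb: "0 < c i u z" "c i u z < 1" if "z \<in> N" "i \<in> {1..n} - S" "u \<in> {0..1}" for i u z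
  proof -
    have ei: "e i \<in> E" "z i \<in> e i" "w i \<in> e i" using e Ne that by auto
    have "c i u z \<in> closed_segment (coord (e i) (z i)) (coord (e i) (w i))"
      unfolding c_def in_segment using that by auto
    moreover have "closed_segment (coord (e i) (z i)) (coord (e i) (w i)) \<subseteq> {0<..<1}"
      by (rule closed_segment_subset) (use coord_bounds ei in auto)
    ultimately show "0 < c i u z" "c i u z < 1" by auto
  qed
  define h2 where "h2 i p = (if i \<in> S then v i else \<Phi> (e i) (c i (fst p) (snd p)))" for i and p :: "real \<times> (nat \<Rightarrow> 'a)"
  define H2 where "H2 p = (\<lambda>i\<in>{1..n}. h2 i p)" for p
  have H2: "continuous_map ?P ?Z H2" unfolding H2_def
  proof (rule continuous_map_into_partial_config)
    fix i assume i: "i \<in> {1..n}"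
    show "continuous_map ?P Y (h2 i)"
    proof (cases "i \<in> S")
      case True
      then show ?thesis using v V_subset by (auto simp: h2_def[abs_def])
    next
      case False
      then have iS: "i \<in> {1..n} - S" using i by auto
      have "continuous_map ?P (subtopology Y (e i)) (\<lambda>p. snd p i)"
        using proj[OF i] Ne iS tP by (auto simp: continuous_map_in_subtopology)
      from continuous_map_compose[OF this continuous_map_coord] e[OF iS]
      have cc: "continuous_map ?P euclideanreal (\<lambda>p. coord (e i) (snd p i))" by (simp add: o_def)
      have fr: "continuous_map ?P euclideanreal fst" using fstc by (simp add: continuous_map_in_subtopology)
      have "continuous_map ?P unit_interval (\<lambda>p. c i (fst p) (snd p))"
        unfolding continuous_map_in_subtopology
      proof
        show "continuous_map ?P euclideanreal (\<lambda>p. c i (fst p) (snd p))" unfolding c_def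
          by (intro continuous_map_add continuous_map_real_mult continuous_map_diff fr cc) auto
        show "(\<lambda>p. c i (fst p) (snd p)) \<in> topspace ?P \<rightarrow> {0..1}"
          using cb[OF _ iS] tP by (fastforce intro: less_imp_le)
      qed
      from continuous_map_compose[OF this \<Phi>_continuous] e[OF iS] False
      show ?thesis by (simp add: h2_def[abs_def] o_def)
    qed
  next
    fix p i j assume p: "p \<in> topspace ?P" and ij: "i \<in> {1..n}" "j \<in> {1..n}" "R i j"
    obtain u z where uz: "p = (u, z)" "u \<in> {0..1}" "z \<in> N" using p tP by auto
    have he: "h2 k p \<in> e k" if "k \<in> {1..n} - S" for k
      using \<Phi>_mem_edge cb[OF uz(3) that uz(2)] e[OF that] that uz by (simp add: h2_def)
    have hv: "h2 k p = v k" "h2 k p \<in> V" if "k \<in> S" for k using that v by (simp_all add: h2_def)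
    show "h2 i p \<noteq> h2 j p"
    proof (cases "i \<in> S"; cases "j \<in> S")
      assume "i \<in> S" "j \<in> S" then show ?thesis using vne ij hv by metis
    next
      assume "i \<in> S" "j \<notin> S"
      then show ?thesis using hv he[of j] e[of j] vertex_not_edge ij by (metis DiffI)
    next
      assume "i \<notin> S" "j \<in> S"
      then show ?thesis using hv he[of i] e[of i] vertex_not_edge ij by (metis DiffI)
    next
      assume "i \<notin> S" "j \<notin> S"
      then have iS: "i \<in> {1..n} - S" and jS: "j \<in> {1..n} - S" using ij by auto
      show ?thesis
      proof (cases "e i = e j")
        case False
        then show ?thesis using he[OF iS] he[OF jS] e[OF iS] e[OF jS] edges_eq by metis
      next
        case True
        have eE: "e i \<in> E" using e iS by blast
        have st: "coord (e i) (w i) < coord (e i) (w j) \<longleftrightarrow> coord (e i) (z i) < coord (e i) (z j)"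
          using uz(3) same_type_coord[OF _ iS jS] ij(3) e[OF iS] e[OF jS] True unfolding N_def type_piece_def by auto
        have "coord (e i) (w i) \<noteq> coord (e i) (w j)" "coord (e i) (z i) \<noteq> coord (e i) (z j)"
          using \<Phi>_coord[OF eE] Zne[OF wN ij] Zne[OF uz(3) ij] Ne[OF wN iS] Ne[OF wN jS] Ne[OF uz(3) iS] Ne[OF uz(3) jS] True
          by metis+
        then consider "coord (e i) (w i) < coord (e i) (w j)" "coord (e i) (z i) < coord (e i) (z j)"
          | "coord (e i) (w j) < coord (e i) (w i)" "coord (e i) (z j) < coord (e i) (z i)" using st by linarith
        then have "c i u z \<noteq> c j u z"
        proof cases
          case 1
          \<comment> \<open>At \<open>u = 0\<close> strictness comes from \<open>z\<close>, for
            \<open>u > 0\<close> from \<open>w\<close>.\<close>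
          then have "c i u z < c j u z" using uz(2) True unfolding c_def
            by (cases "u = 0") (auto intro!: add_le_less_mono mult_left_mono mult_strict_left_mono)
          then show ?thesis by simp
        next
          case 2
          then have "c j u z < c i u z" using uz(2) True unfolding c_def
            by (cases "u = 0") (auto intro!: add_le_less_mono mult_left_mono mult_strict_left_mono)
          then show ?thesis by simp
        qed
        then show ?thesis using \<Phi>_eq_iff[OF eE] cb[OF uz(3) iS uz(2)] cb[OF uz(3) jS uz(2)] True iS jS uz
          by (simp add: h2_def)
      qed
    qed
  qed
  define c0 where "c0 = H2 (1, w)"
  have c0: "c0 \<in> topspace ?Z" using continuous_map_image_subset_topspace[OF H2] tP wN by (auto simp: c0_def)
  have a: "homotopic_with (\<lambda>_. True) ?N ?Z (\<lambda>z. z) (\<lambda>z. H1 (1, z))"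
  proof (subst homotopic_with, simp, intro exI[of _ H1] conjI ballI)
    fix z assume z: "z \<in> topspace ?N"
    then have zN: "z \<in> N" by simp
    then have "h1 i (0, z) = z i" if "i \<in> {1..n}" for i using collapse_0 ZY that by (simp add: h1_def)
    moreover have "z \<in> extensional {1..n}" using NZ[OF zN] by (auto simp: topspace_partial_config_space PiE_def)
    ultimately show "H1 (0, z) = z" by (auto simp: H1_def fun_eq_iff extensional_def)
  qed (use H1 in auto)
  have b: "homotopic_with (\<lambda>_. True) ?N ?Z (\<lambda>z. H1 (1, z)) (\<lambda>_. c0)"
  proof (subst homotopic_with, simp, intro exI[of _ H2] conjI ballI)
    fix z assume z: "z \<in> topspace ?N"
    then have zN: "z \<in> N" by simp
    have "h2 i (0, z) = h1 i (1, z)" if i: "i \<in> {1..n}" for i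
    proof (cases "i \<in> S")
      case True then show ?thesis using h1_end[OF zN] by (simp add: h2_def)
    next
      case False
      then have "i \<in> {1..n} - S" using i by blast
      then show ?thesis using \<Phi>_coord e Ne[OF zN] False by (simp add: h2_def h1_def c_def)
    qed
    then show "H2 (0, z) = H1 (1, z)" by (auto simp: H1_def H2_def)
    have "h2 i (1, z) = h2 i (1, w)" for i by (simp add: h2_def c_def)
    then show "H2 (1, z) = c0" by (simp add: c0_def H2_def)
  qed (use H2 in auto)
  show ?thesis unfolding null_in_def N_def[symmetric] using a b c0 homotopic_with_trans by blast
qed

text \<open>Recorded as a cover with homotopies and not only as a bound for \<open>TC\<close>,
  because the relative upper bound transports the cover to the slice at height zero.\<close>

theorem partial_config_motion_planning:
  assumes Z: "path_connected_space (partial_config_space n R Y)" and R: "\<And>i j. R i j \<Longrightarrow> R j i"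
  obtains U where "(\<Union>k\<in>{..2*n}. U k) = topspace (prod_topology (partial_config_space n R Y) (partial_config_space n R Y))"
    "\<And>k. openin (prod_topology (partial_config_space n R Y) (partial_config_space n R Y)) (U k)"
    "\<And>k. homotopic_with (\<lambda>_. True)
       (subtopology (prod_topology (partial_config_space n R Y) (partial_config_space n R Y)) (U k))
       (partial_config_space n R Y) fst snd"
proof -
  let ?Z = "partial_config_space n R Y"
  define \<N> where "\<N> S = type_piece n R S ` weight_region n R S" for S
  have piece: "w \<in> type_piece n R S w" if "w \<in> weight_region n R S" for w S
    using that same_type_refl by (simp add: type_piece_def)
  show ?thesis
  proof (rule motion_planning_cover[OF Z, of n "weight n R" \<N>])
    show "continuous_map ?Z euclideanreal (weight n R i)" if "i \<in> {1..n}" for i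
      using that by (rule continuous_map_weight)
    fix S assume S: "S \<subseteq> {1..n}"
    show "openin ?Z N" if "N \<in> \<N> S" for N
      using that openin_type_piece[where R=R, OF _ S R] unfolding \<N>_def by blast
    show "null_in ?Z N" if "N \<in> \<N> S" for N
      using that null_in_type_piece[where R=R, OF _ S R] unfolding \<N>_def by blast
    show "pairwise disjnt (\<N> S)" unfolding pairwise_def
    proof (intro ballI impI)
      fix A B assume "A \<in> \<N> S" "B \<in> \<N> S" "A \<noteq> B"
      then obtain a b where ab: "A = type_piece n R S a" "B = type_piece n R S b" unfolding \<N>_def by blast
      show "disjnt A B"
      proof (rule ccontr)
        assume "\<not> disjnt A B"
        then obtain x where "same_type n R S a x" "same_type n R S b x" by (auto simp: disjnt_iff ab type_piece_def)
        then have "same_type n R S a b" "same_type n R S b a" using same_type_sym same_type_trans by metis+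
        then have "A = B" unfolding ab type_piece_def using same_type_trans by blast
        then show False using \<open>A \<noteq> B\<close> by simp
      qed
    qed
    have "\<Union>(\<N> S) = weight_region n R S" using piece by (auto simp: \<N>_def type_piece_def)
    then show "\<Union>(\<N> S) = {z \<in> topspace ?Z. (\<forall>i\<in>S. weight n R i z < 1) \<and> (\<forall>i\<in>{1..n}-S. 0 < weight n R i z)}"
      by (simp add: weight_region_def)
  qed (use that in blast)
qed

lemma TC_partial_config_le:
  assumes Z: "path_connected_space (partial_config_space n R Y)" and R: "\<And>i j. R i j \<Longrightarrow> R j i"
  shows "TC (partial_config_space n R Y) \<le> enat (2 * n + 1)"
  by (rule partial_config_motion_planning[OF Z R]) (assumption, rule TC_le)

end

section \<open>Open covers of the torus\<close>

text \<open>The metric on functions sums the coordinate distances, truncated at 1, with powers of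
  1/2 as factors; these factors add up to 2.\<close>

lemma dist_fun_le:
  fixes x y :: "nat \<Rightarrow> real"
  assumes "\<And>i. dist (x i) (y i) \<le> c"
  shows "dist x y \<le> 2 * c"
proof -
  have geo: "summable (\<lambda>n. (1/2)^n :: real)" by (simp add: summable_geometric)
  have c: "0 \<le> c" using assms[of 0] zero_le_dist order_trans by blast
  have "dist x y = (\<Sum>n. (1/2)^n * min (dist (x (from_nat n)) (y (from_nat n))) 1)" by (rule dist_fun_def)
  also have "\<dots> \<le> (\<Sum>n. (1/2)^n * c)"
  proof (rule suminf_le)
    show "(1/2)^n * min (dist (x (from_nat n)) (y (from_nat n))) 1 \<le> (1/2)^n * c" for n :: nat
      using assms[of "from_nat n"] by (intro mult_left_mono) auto
    show "summable (\<lambda>n. (1/2)^n * min (dist (x (from_nat n)) (y (from_nat n))) 1)"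
      by (rule summable_comparison_test'[OF geo]) auto
    show "summable (\<lambda>n. (1/2)^n * c)" using geo by (rule summable_mult2)
  qed
  also have "\<dots> = (\<Sum>n. (1/2)^n) * c" using geo by (rule suminf_mult2[symmetric])
  also have "\<dots> = 2 * c" by (simp add: suminf_geometric)
  finally show ?thesis .
qed

lemma compact_box_fun:
  fixes a b :: "nat \<Rightarrow> real"
  shows "compact {x. \<forall>i. a i \<le> x i \<and> x i \<le> b i}"
proof -
  have "compactin (product_topology (\<lambda>_. euclidean) UNIV) (\<Pi>\<^sub>E i\<in>UNIV. {a i..b i})"
    unfolding compactin_PiE by (auto simp: compactin_euclidean_iff)
  moreover have "(\<Pi>\<^sub>E i\<in>UNIV. {a i..b i}) = {x. \<forall>i. a i \<le> x i \<and> x i \<le> b i}" by auto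
  ultimately show ?thesis by (simp add: euclidean_product_topology compactin_euclidean_iff)
qed

text \<open>The cup-length bound for the \<open>m\<close>-torus, in elementary form: on each of \<open>m\<close> open sets one
  coordinate function lifts to the reals. Such a lift labels the grid points of a large cube by the sheet
  they belong to, and Kuhn's lemma, the combinatorial core of Brouwer's fixed point theorem,
  produces a small cell on which every label changes.\<close>

lemma no_cover_of_torus:
  fixes m :: nat and W :: "nat \<Rightarrow> (nat \<Rightarrow> real) set" and h :: "nat \<Rightarrow> (nat \<Rightarrow> real) \<Rightarrow> real"
    and G :: "nat \<Rightarrow> real \<Rightarrow> real" and d :: "nat \<Rightarrow> real"
  assumes W_open: "\<And>j. j < m \<Longrightarrow> open (W j)"
    and W_cover: "\<And>x. \<exists>j<m. x \<in> W j"
    and h_cont: "\<And>j. j < m \<Longrightarrow> continuous_on (W j) (h j)"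
    and G_cont: "\<And>j. j < m \<Longrightarrow> continuous_on UNIV (G j)"
    and G_shift: "\<And>j t. j < m \<Longrightarrow> G j (t + 1) = G j t + d j"
    and d: "\<And>j. j < m \<Longrightarrow> d j \<noteq> 0"
    and integral: "\<And>j x. j < m \<Longrightarrow> x \<in> W j \<Longrightarrow> G j (x j) - h j x \<in> \<int>"
    and periodic: "\<And>j x y. j < m \<Longrightarrow> (\<And>i. i < m \<Longrightarrow> x i - y i \<in> \<int>) \<Longrightarrow> (x \<in> W j \<longleftrightarrow> y \<in> W j) \<and> h j x = h j y"
  shows False
proof -
  \<comment> \<open>Coordinates from \<open>m\<close> on are frozen at 0, which makes
    \<open>Q\<close> compact in the infinite product. \<open>\<epsilon>\<close> is a Lebesgue number
    of the cover on it.\<close>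
  define Q :: "(nat \<Rightarrow> real) set" where "Q = {x. \<forall>i. 0 \<le> x i \<and> x i \<le> (if i < m then 1 else 0)}"
  have "compact Q" unfolding Q_def by (rule compact_box_fun)
  moreover have "Q \<subseteq> \<Union>(W ` {..<m})" using W_cover by fastforce
  ultimately obtain \<epsilon> where \<epsilon>: "0 < \<epsilon>" "\<And>x. x \<in> Q \<Longrightarrow> \<exists>G \<in> W ` {..<m}. ball x \<epsilon> \<subseteq> G"
    using Heine_Borel_lemma[of Q "W ` {..<m}"] W_open by blast
  \<comment> \<open>A cell of side \<open>1 / M\<close> is coordinatewise within
    \<open>1 / M\<close> of its corner, hence within \<open>2 / M\<close> in the metric of
    functions.\<close>
  obtain M :: nat where M: "M > 0" "2 / real M < \<epsilon>"
  proof -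
    obtain M :: nat where "M > 0" "inverse (real M) < \<epsilon> / 2" using \<epsilon>(1) real_arch_inverse[of "\<epsilon>/2"] by auto
    then show ?thesis using that[of M] by (simp add: field_simps)
  qed
  define cell :: "(nat \<Rightarrow> nat) \<Rightarrow> (nat \<Rightarrow> real) set" where
    "cell a = {x. \<forall>i. (if i < m then a i / M else 0) \<le> x i \<and> x i \<le> (if i < m then (real (a i) + 1) / M else 0)}" for a
  define \<A> :: "(nat \<Rightarrow> nat) set" where
    "\<A> = {a. \<forall>i. (i \<in> {..<m} \<longrightarrow> a i \<in> {..<M}) \<and> (i \<notin> {..<m} \<longrightarrow> a i = 0)}"
  have fin: "finite \<A>" unfolding \<A>_def by (rule finite_set_of_finite_funs) auto
  have cell_sub: "\<exists>j<m. cell a \<subseteq> W j" if a: "a \<in> \<A>" for a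
  proof -
    define x where "x = (\<lambda>i. if i < m then real (a i) / M else 0)"
    have "x \<in> Q" using a M by (auto simp: Q_def x_def \<A>_def intro: less_imp_le)
    then obtain j where j: "j < m" "ball x \<epsilon> \<subseteq> W j" using \<epsilon>(2) by blast
    have "cell a \<subseteq> ball x \<epsilon>"
    proof
      fix y assume y: "y \<in> cell a"
      have "dist (x i) (y i) \<le> 1 / M" for i
      proof -
        have yi: "(if i < m then a i / M else 0) \<le> y i \<and> y i \<le> (if i < m then (real (a i) + 1) / M else 0)"
          using y unfolding cell_def by blast
        show ?thesis
        proof (cases "i < m")
          case True
          then have "real (a i) / M \<le> y i" "y i \<le> real (a i) / M + 1 / M" using yi by (simp_all add: add_divide_distrib)
          then show ?thesis using True by (simp add: x_def dist_real_def)
        next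
          case False
          then have "y i = 0" using yi by simp
          then show ?thesis using False by (simp add: x_def)
        qed
      qed
      then have "dist x y \<le> 2 * (1 / M)" by (rule dist_fun_le)
      then show "y \<in> ball x \<epsilon>" using M by simp
    qed
    then show ?thesis using j by blast
  qed
  have h_bdd: "\<exists>b. \<forall>x\<in>cell a. cell a \<subseteq> W j \<longrightarrow> \<bar>h j x\<bar> \<le> b" if j: "j < m" for a j
  proof (cases "cell a \<subseteq> W j")
    case True
    have "compact (cell a)" unfolding cell_def by (rule compact_box_fun)
    then have "bounded (h j ` cell a)"
      using True h_cont[OF j] by (intro compact_imp_bounded compact_continuous_image) (auto intro: continuous_on_subset)
    then show ?thesis by (auto simp: bounded_iff)
  qed auto
  define b where "b a j = (SOME b. \<forall>x\<in>cell a. cell a \<subseteq> W j \<longrightarrow> \<bar>h j x\<bar> \<le> b)" for a j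
  have b: "\<bar>h j x\<bar> \<le> b a j" if "j < m" "x \<in> cell a" "cell a \<subseteq> W j" for a j x
    using someI_ex[OF h_bdd[OF that(1), of a], folded b_def] that(2,3) by blast
  \<comment> \<open>The finitely many cells of the unit cube represent all cells of the large cube
    up to integer translations, so by periodicity one bound for the lifts suffices.\<close>
  define B where "B = (\<Sum>p\<in>\<A> \<times> {..<m}. \<bar>b (fst p) (snd p)\<bar>)"
  have hB: "\<bar>h j x\<bar> \<le> B" if "a \<in> \<A>" "j < m" "x \<in> cell a" "cell a \<subseteq> W j" for a j x
  proof -
    have "\<bar>b a j\<bar> = (\<lambda>p. \<bar>b (fst p) (snd p)\<bar>) (a, j)" by simp
    also have "\<dots> \<le> B" unfolding B_def by (rule member_le_sum) (use that fin in auto)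
    finally show ?thesis using b[OF that(2,3,4)] by simp
  qed
  \<comment> \<open>The side length of the large cube: over \<open>N\<close> periods
    \<open>G j\<close> must change by more than twice what \<open>h j\<close> and
    \<open>G j 0\<close> can account for.\<close>
  define N where "N = Suc (nat \<lceil>\<Sum>j<m. \<bar>2 * (B + \<bar>G j 0\<bar>) / \<bar>d j\<bar>\<bar>\<rceil>)"
  have N: "2 * (B + \<bar>G j 0\<bar>) < N * \<bar>d j\<bar>" if j: "j < m" for j
  proof -
    have "2 * (B + \<bar>G j 0\<bar>) / \<bar>d j\<bar> \<le> \<bar>2 * (B + \<bar>G j 0\<bar>) / \<bar>d j\<bar>\<bar>" by (rule abs_ge_self)
    also have "\<dots> \<le> (\<Sum>j<m. \<bar>2 * (B + \<bar>G j 0\<bar>) / \<bar>d j\<bar>\<bar>)"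
      by (rule member_le_sum) (use j in auto)
    also have "\<dots> < N" unfolding N_def by linarith
    finally show ?thesis using d[OF j] by (simp add: divide_less_eq)
  qed
  have Gn: "G j (t + real k) = G j t + real k * d j" if "j < m" for j t k
  proof (induction k)
    case (Suc k)
    have "G j (t + real (Suc k)) = G j ((t + real k) + 1)" by (simp add: add_ac)
    also have "\<dots> = G j (t + real k) + d j" using that by (rule G_shift)
    also have "\<dots> = G j t + real (Suc k) * d j" unfolding Suc by (simp add: algebra_simps)
    finally show ?case .
  qed simp
  define pt :: "(nat \<Rightarrow> nat) \<Rightarrow> nat \<Rightarrow> real" where "pt x i = (if i < m then x i / M else 0)" for x i
  \<comment> \<open>On \<open>W j\<close> this is an integer, the sheet. As \<open>h j\<close> is
    periodic and \<open>G j\<close> is not, it changes by \<open>d j\<close> when coordinate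
    \<open>j\<close> advances by one period.\<close>
  define L where "L j x = G j (x j) - h j x" for j x
  \<comment> \<open>The threshold is half of the total change \<open>N * d j\<close>; multiplying by
    \<open>d j\<close> treats both signs of \<open>d j\<close> at once.\<close>
  define high where "high j x \<longleftrightarrow> N * (d j)\<^sup>2 / 2 < L j (pt x) * d j" for j x
  \<comment> \<open>Kuhn's lemma prescribes the labels on opposite faces. By the choice of
    \<open>N\<close> they agree with \<open>high\<close> on cells where the lift is defined.\<close>
  define label :: "(nat \<Rightarrow> nat) \<Rightarrow> nat \<Rightarrow> nat" where
    "label x j = (if x j = 0 then 0 else if x j = N * M then 1 else if high j x then 1 else 0)" for x j
  have NM: "0 < N * M" using M by (simp add: N_def)
  then obtain q where q: "\<forall>i<m. q i < N * M"
    and qrs: "\<forall>i<m. \<exists>r s. (\<forall>j<m. q j \<le> r j \<and> r j \<le> q j + 1) \<and> (\<forall>j<m. q j \<le> s j \<and> s j \<le> q j + 1) \<and> label r i \<noteq> label s i"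
    by (rule kuhn_lemma[of "N * M" m label]) (use NM in \<open>auto simp: label_def\<close>)
  define a where "a i = (if i < m then q i mod M else 0)" for i
  have a: "a \<in> \<A>" using M by (auto simp: \<A>_def a_def)
  then obtain j where j: "j < m" "cell a \<subseteq> W j" using cell_sub by blast
  \<comment> \<open>The integer translation is read off from \<open>q\<close> and not from
    \<open>x\<close>, so that all corners of the Kuhn cell land in the same closed cell
    \<open>cell a\<close>.\<close>
  define red :: "(nat \<Rightarrow> nat) \<Rightarrow> nat \<Rightarrow> real" where "red x i = (if i < m then pt x i - real (q i div M) else 0)" for x i
  have red_cell: "red x \<in> cell a" if x: "\<forall>i<m. q i \<le> x i \<and> x i \<le> q i + 1" for x
  proof -
    have "a i / M \<le> red x i \<and> red x i \<le> (real (a i) + 1) / M" if i: "i < m" for i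
    proof -
      have "real (q i) = real (q i div M) * M + real (a i)"
        using i by (simp add: a_def flip: of_nat_mult of_nat_add)
      moreover have "real (q i) \<le> real (x i)" "real (x i) \<le> real (q i + 1)" using x i of_nat_mono by blast+
      moreover have "red x i = (real (x i) - real (q i div M) * M) / M"
        using i M(1) by (simp add: red_def pt_def diff_divide_distrib)
      ultimately show ?thesis by (auto intro!: divide_right_mono)
    qed
    then show ?thesis by (auto simp: cell_def red_def)
  qed
  \<comment> \<open>The cell is convex, and a continuous integer-valued function is constant along a
    segment.\<close>
  have L_const: "L j x = L j y" if x: "x \<in> cell a" and y: "y \<in> cell a" for x y
  proof -
    define \<gamma> where "\<gamma> t = (\<lambda>i. (1 - t) * x i + t * y i)" for t :: real
    have \<gamma>: "\<gamma> t \<in> cell a" if t: "t \<in> {0..1}" for t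
    proof -
      have "l \<le> \<gamma> t i \<and> \<gamma> t i \<le> u" if "l \<le> x i" "x i \<le> u" "l \<le> y i" "y i \<le> u" for l u i
      proof -
        have "closed_segment (x i) (y i) \<subseteq> {l..u}" by (rule closed_segment_subset) (use that in auto)
        moreover have "\<gamma> t i \<in> closed_segment (x i) (y i)" unfolding \<gamma>_def in_segment using t by auto
        ultimately show ?thesis by auto
      qed
      then show ?thesis using x y unfolding cell_def by blast
    qed
    have \<gamma>c: "continuous_on {0..1} \<gamma>" unfolding \<gamma>_def
      by (intro continuous_on_coordinatewise_then_product continuous_intros)
    have "continuous_on {0..1} (\<lambda>t. L j (\<gamma> t))" unfolding L_def
    proof (rule continuous_on_diff)
      show "continuous_on {0..1} (\<lambda>t. G j (\<gamma> t j))"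
        by (rule continuous_on_compose2[OF G_cont[OF j(1)]]) (auto simp: \<gamma>_def intro!: continuous_intros)
      show "continuous_on {0..1} (\<lambda>t. h j (\<gamma> t))"
        by (rule continuous_on_compose2[OF h_cont[OF j(1)] \<gamma>c]) (use \<gamma> j(2) in auto)
    qed
    then have "L j (\<gamma> 0) = L j (\<gamma> 1)"
      by (rule continuous_on_Ints_constant[rotated]) (use \<gamma> j integral in \<open>auto simp: L_def\<close>)
    then show ?thesis by (simp add: \<gamma>_def)
  qed
  have diffZ: "pt x i - red x i \<in> \<int>" if "i < m" for x i using that by (simp add: red_def)
  have h_red: "h j (pt x) = h j (red x)" for x using periodic[OF j(1), of "pt x" "red x"] diffZ by blast
  have L_red: "L j (pt x) = L j (red x) + real (q j div M) * d j" for x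
  proof -
    have "pt x j = red x j + real (q j div M)" using j by (simp add: red_def)
    then show ?thesis using Gn[OF j(1)] h_red[of x] by (simp add: L_def)
  qed
  have high: "label x j = (if high j x then 1 else 0)" if x: "\<forall>i<m. q i \<le> x i \<and> x i \<le> q i + 1" for x
  proof -
    have hb: "\<bar>h j (pt x)\<bar> \<le> B" using hB[OF a j(1) red_cell[OF x] j(2)] h_red by simp
    have bound: "\<bar>(G j 0 - h j (pt x)) * d j\<bar> < N * (d j)\<^sup>2 / 2"
    proof -
      have "\<bar>G j 0 - h j (pt x)\<bar> \<le> B + \<bar>G j 0\<bar>" using hb by linarith
      then have "\<bar>G j 0 - h j (pt x)\<bar> < N * \<bar>d j\<bar> / 2"
        by (rule le_less_trans) (use N[OF j(1)] in simp)
      then have "\<bar>G j 0 - h j (pt x)\<bar> * \<bar>d j\<bar> < (N * \<bar>d j\<bar> / 2) * \<bar>d j\<bar>"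
        using d[OF j(1)] by (intro mult_strict_right_mono) auto
      then show ?thesis by (simp add: abs_mult power2_eq_square)
    qed
    have 0: "\<not> high j x" if "x j = 0"
      using bound that j by (simp add: high_def L_def pt_def abs_less_iff)
    have 1: "high j x" if "x j = N * M"
    proof -
      have "pt x j = 0 + real N" using that M j by (simp add: pt_def)
      then have "L j (pt x) = (G j 0 - h j (pt x)) + N * d j" using Gn[OF j(1), of 0 N] by (simp add: L_def)
      then have "L j (pt x) * d j = (G j 0 - h j (pt x)) * d j + N * (d j)\<^sup>2"
        by (simp only: distrib_right power2_eq_square mult.assoc)
      then show ?thesis using bound unfolding high_def abs_less_iff by linarith
    qed
    show ?thesis using 0 1 NM by (auto simp: label_def)
  qed
  obtain r s where r: "\<forall>i<m. q i \<le> r i \<and> r i \<le> q i + 1" and s: "\<forall>i<m. q i \<le> s i \<and> s i \<le> q i + 1"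
    and rs: "label r j \<noteq> label s j" using qrs j(1) by blast
  \<comment> \<open>The two corners undergo the same translation and \<open>L j\<close> is constant
    on the cell, so label \<open>j\<close> cannot change there, against Kuhn's lemma.\<close>
  have "L j (pt r) = L j (pt s)" using L_red L_const red_cell r s by metis
  then show False using rs high[OF r] high[OF s] by (simp add: high_def)
qed

section \<open>The lower bound\<close>

lemma cis_2pi_eq_iff: "cis (2 * pi * s) = cis (2 * pi * t) \<longleftrightarrow> s - t \<in> \<int>"
proof -
  have "cis (2 * pi * s) = cis (2 * pi * t) \<longleftrightarrow> (\<exists>n::int. 2 * pi * s = 2 * pi * t + 2 * pi * n)"
    unfolding cis_conv_exp exp_eq by (auto simp: complex_eq_iff algebra_simps)
  also have "\<dots> \<longleftrightarrow> (\<exists>n::int. s = t + n)"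
  proof -
    have "2 * pi * s = 2 * pi * t + 2 * pi * n \<longleftrightarrow> 2 * pi * s = 2 * pi * (t + n)" for n :: real
      by (simp add: algebra_simps)
    then show ?thesis by simp
  qed
  also have "\<dots> \<longleftrightarrow> s - t \<in> \<int>" by (auto simp: Ints_def algebra_simps)
  finally show ?thesis .
qed

lemma continuous_circle_lift:
  fixes f :: "real \<Rightarrow> complex"
  assumes f: "continuous_on UNIV f" and nf: "\<And>t. norm (f t) = 1"
  obtains G where "continuous_on UNIV G" "\<And>t. f t = cis (2 * pi * G t)"
proof -
  have "\<And>t. f t \<noteq> 0" using nf by (metis norm_zero zero_neq_one)
  then obtain L where L: "continuous_on UNIV L" "\<And>t. f t = exp (L t)"
    using continuous_logarithm_on_contractible[OF f] by (metis UNIV_I convex_UNIV convex_imp_contractible)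
  have "f t = cis (2 * pi * (Im (L t) / (2 * pi)))" for t
  proof -
    have "Re (L t) = 0" using nf[of t] L(2)[of t] by simp
    then have "L t = \<i> * complex_of_real (Im (L t))" by (simp add: complex_eq_iff)
    then have "f t = exp (\<i> * complex_of_real (Im (L t)))" using L(2) by metis
    then show ?thesis by (simp add: cis_conv_exp)
  qed
  moreover have "continuous_on UNIV (\<lambda>t. Im (L t) / (2 * pi))" by (intro continuous_intros L) auto
  ultimately show ?thesis using that by blast
qed

text \<open>No circle embeds into the line: the difference of the values at opposite points changes
  sign over half a turn, so some two opposite points have the same value.\<close>

lemma not_injective_on_circle:
  fixes \<psi> :: "real \<Rightarrow> real"
  assumes c: "continuous_on UNIV \<psi>" and p: "\<And>s t. \<psi> s = \<psi> t \<longleftrightarrow> s - t \<in> \<int>"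
  shows False
proof -
  define u where "u t = \<psi> (t + 1/2) - \<psi> t" for t
  have uc: "continuous_on {0..1/2} u" unfolding u_def
    by (intro continuous_on_diff continuous_on_compose2[OF c] continuous_intros) auto
  have "\<psi> (1/2 + 1/2) = \<psi> 0" using p[of "1/2 + 1/2" 0] by simp
  then have "u (1/2) = - u 0" by (simp add: u_def)
  then have "\<exists>t\<ge>0. t \<le> 1/2 \<and> u t = 0"
  proof (cases "u 0 \<le> 0")
    case True then show ?thesis using \<open>u (1/2) = - u 0\<close> by (intro IVT' uc) auto
  next
    case False then show ?thesis using \<open>u (1/2) = - u 0\<close> by (intro IVT2' uc) auto
  qed
  then obtain t where "\<psi> (t + 1/2) = \<psi> t" by (auto simp: u_def)
  then have "1/2 \<in> (\<int> :: real set)" using p[of "t + 1/2" t] by simp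
  then obtain k :: int where "(1/2 :: real) = of_int k" by (elim Ints_cases)
  then have "2 * k = 1" by linarith
  then show False by presburger
qed

text \<open>Near \<open>t0\<close> the lift \<open>G\<close> is strictly monotone, so it leaves its
  value at \<open>t0\<close> on one side and, if the net change \<open>d\<close> were 0, would
  return to it from the other side. By the intermediate value theorem it would take that value again
  inside the period, where \<open>only\<close> forbids it.\<close>

lemma winding_nonzero:
  fixes f :: "real \<Rightarrow> complex"
  assumes fc: "continuous_on UNIV f" and nf: "\<And>t. norm (f t) = 1" and per: "\<And>t. f (t + 1) = f t"
    and only: "\<And>t. f t = f t0 \<Longrightarrow> t - t0 \<in> \<int>"
    and \<epsilon>: "0 < \<epsilon>" and inj: "inj_on f {t0 - \<epsilon><..<t0 + \<epsilon>}"
  obtains G d where "continuous_on UNIV G" "\<And>t. f t = cis (2 * pi * G t)" "\<And>t. G (t + 1) = G t + d" "d \<noteq> 0"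
proof -
  obtain G where G: "continuous_on UNIV G" "\<And>t. f t = cis (2 * pi * G t)"
    using continuous_circle_lift[OF fc nf] by blast
  define d where "d = G 1 - G 0"
  have shift: "G (t + 1) = G t + d" for t
  proof -
    have "G (t + 1) - G t = G (0 + 1) - G 0"
    proof (rule continuous_on_Ints_constant[of UNIV "\<lambda>t. G (t + 1) - G t"])
      show "continuous_on UNIV (\<lambda>t. G (t + 1) - G t)"
        by (intro continuous_on_diff continuous_on_compose2[OF G(1)] continuous_intros G(1)) auto
      show "G (x + 1) - G x \<in> \<int>" for x
        using per[of x] unfolding G(2) cis_2pi_eq_iff .
    qed auto
    then show ?thesis by (simp add: d_def)
  qed
  have ne: "G s \<noteq> G t0" if "t0 < s" "s < t0 + 1" for s
  proof
    assume "G s = G t0"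
    then have "s - t0 \<in> \<int>" using only G(2) by metis
    then obtain k :: int where "s - t0 = of_int k" by (elim Ints_cases)
    then have "0 < k" "k < 1" using that by linarith+
    then show False by simp
  qed
  \<comment> \<open>Inside the interval of injectivity, and at most half a period, so that
    \<open>t0 + \<eta>\<close> does not exceed \<open>t0 + 1 - \<eta>\<close>.\<close>
  define \<eta> where "\<eta> = min \<epsilon> 1 / 2"
  have \<eta>: "0 < \<eta>" "\<eta> < \<epsilon>" "\<eta> \<le> 1/2" using \<epsilon> by (auto simp: \<eta>_def)
  have "inj_on G {t0 - \<epsilon><..<t0 + \<epsilon>}" by (rule inj_onI) (metis inj inj_onD G(2))
  then have "inj_on G {t0 - \<eta>..t0 + \<eta>}" by (rule inj_on_subset) (use \<eta> in auto)
  then have mono: "(G (t0 - \<eta>) < G t0 \<and> G t0 < G (t0 + \<eta>)) \<or> (G (t0 + \<eta>) < G t0 \<and> G t0 < G (t0 - \<eta>))"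
    by (intro continuous_inj_imp_mono) (use \<eta> G(1) continuous_on_subset in auto)
  have "d \<noteq> 0"
  proof
    assume "d = 0"
    then have sh: "G (t0 + 1 - \<eta>) = G (t0 - \<eta>)" using shift[of "t0 - \<eta>"] by (simp add: algebra_simps)
    have le: "t0 + \<eta> \<le> t0 + 1 - \<eta>" using \<eta> by simp
    have Gc: "continuous_on {t0 + \<eta>..t0 + 1 - \<eta>} G" using G(1) continuous_on_subset by blast
    have "\<exists>s\<ge>t0 + \<eta>. s \<le> t0 + 1 - \<eta> \<and> G s = G t0"
      using mono
    proof
      assume "G (t0 - \<eta>) < G t0 \<and> G t0 < G (t0 + \<eta>)"
      then show ?thesis using sh by (intro IVT2'[OF _ _ le Gc]) auto
    next
      assume "G (t0 + \<eta>) < G t0 \<and> G t0 < G (t0 - \<eta>)"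
      then show ?thesis using sh by (intro IVT'[OF _ _ le Gc]) auto
    qed
    then obtain s where "t0 + \<eta> \<le> s" "s \<le> t0 + 1 - \<eta>" "G s = G t0" by blast
    then show False using ne[of s] \<eta> by simp
  qed
  then show ?thesis using that[OF G shift] by blast
qed

text \<open>Cycles are handled as loops on the real line, so that tori have real coordinates modulo
  integers and lifts are real functions.\<close>

lemma cycle_loop:
  assumes "cycle_in Y C"
  obtains g where "continuous_map euclideanreal Y g" "range g = C" "\<And>s t. g s = g t \<longleftrightarrow> s - t \<in> \<int>"
proof -
  let ?S = "sphere (0::complex) 1"
  have CY: "C \<subseteq> topspace Y" using assms by (simp add: cycle_in_def)
  have "top_of_set ?S homeomorphic_space subtopology Y C"
    using assms homeomorphic_space_sym by (auto simp: cycle_in_def)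
  then obtain k where k: "homeomorphic_map (top_of_set ?S) (subtopology Y C) k"
    unfolding homeomorphic_space by blast
  have kc: "continuous_map (top_of_set ?S) Y k"
    using homeomorphic_imp_continuous_map[OF k] by (simp add: continuous_map_in_subtopology)
  have ki: "k ` ?S = C" using homeomorphic_imp_surjective_map[OF k] CY by (simp add: Int_absorb1)
  have kinj: "inj_on k ?S" using homeomorphic_imp_injective_map[OF k] by simp
  define c where "c t = cis (2 * pi * t)" for t
  have "continuous_map euclideanreal (top_of_set ?S) c"
    by (auto simp: c_def continuous_map_in_subtopology intro!: continuous_intros)
  from continuous_map_compose[OF this kc] have "continuous_map euclideanreal Y (k \<circ> c)" .
  moreover have "range c = ?S"
  proof
    show "?S \<subseteq> range c"
    proof
      fix z assume "z \<in> ?S"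
      then have "z = cis (Arg z)" using rcis_cmod_Arg[of z] by (simp add: rcis_def)
      then have "z = c (Arg z / (2 * pi))" by (simp add: c_def)
      then show "z \<in> range c" by blast
    qed
  qed (auto simp: c_def)
  then have "range (k \<circ> c) = C" using ki by (metis image_comp)
  moreover have "(k \<circ> c) s = (k \<circ> c) t \<longleftrightarrow> s - t \<in> \<int>" for s t
  proof -
    have "(k \<circ> c) s = (k \<circ> c) t \<longleftrightarrow> c s = c t" using kinj by (auto simp: inj_on_def c_def)
    then show ?thesis by (simp add: c_def cis_2pi_eq_iff)
  qed
  ultimately show ?thesis using that by blast
qed

text \<open>A circle minus a point embeds into the line, a circle does not. For \<open>n = 1\<close>
  this makes the two distinct cycles incomparable.\<close>

lemma cycle_subset_imp_eq:
  assumes C: "cycle_in Y C" and C': "cycle_in Y C'" and sub: "C \<subseteq> C'"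
  shows "C = C'"
proof (rule ccontr)
  assume "C \<noteq> C'"
  then obtain p where p: "p \<in> C'" "p \<notin> C" using sub by blast
  obtain g where g: "continuous_map euclideanreal Y g" "range g = C" "\<And>s t. g s = g t \<longleftrightarrow> s - t \<in> \<int>"
    using cycle_loop[OF C] by blast
  let ?S = "sphere (0::complex) 1"
  obtain k where k: "homeomorphic_map (subtopology Y C') (top_of_set ?S) k"
    using C' unfolding cycle_in_def homeomorphic_space by blast
  have tC: "topspace (subtopology Y C') = C'" using C' by (auto simp: cycle_in_def)
  have kS: "k x \<in> ?S" if "x \<in> C'" for x using homeomorphic_imp_surjective_map[OF k] tC that by auto
  have kinj: "k x = k y \<longleftrightarrow> x = y" if "x \<in> C'" "y \<in> C'" for x y
    using homeomorphic_imp_injective_map[OF k] tC that by (auto simp: inj_on_def)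
  have gC: "g t \<in> C'" for t using g(2) sub by blast
  \<comment> \<open>Rotated so that the missing point \<open>p\<close> would go to -1, on the branch
    cut of \<open>Ln\<close>.\<close>
  define w where "w t = - (k (g t) / k p)" for t
  have kp: "k p \<noteq> 0" using kS[OF p(1)] by auto
  have nw: "norm (w t) = 1" for t using kS[OF gC] kS[OF p(1)] by (simp add: w_def norm_divide)
  have "continuous_map euclideanreal (subtopology Y C') g"
    using g(1) gC by (auto simp: continuous_map_in_subtopology)
  from continuous_map_compose[OF this homeomorphic_imp_continuous_map[OF k]]
  have "continuous_on UNIV (\<lambda>t. k (g t))" by (simp add: continuous_map_in_subtopology o_def)
  then have wc: "continuous_on UNIV w" unfolding w_def by (intro continuous_intros) (use kp in auto)
  have "w t \<noteq> -1" for t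
  proof
    assume "w t = -1"
    then have "k (g t) = k p" using kp by (simp add: w_def)
    then show False using kinj[OF gC p(1)] p(2) g(2) by auto
  qed
  then have w_not: "w t \<notin> \<real>\<^sub>\<le>\<^sub>0" for t
  proof -
    have "w t = -1" if "w t \<in> \<real>\<^sub>\<le>\<^sub>0"
    proof -
      have "Re (w t) \<le> 0" "Im (w t) = 0" using that by (auto simp: complex_nonpos_Reals_iff)
      moreover from this have "\<bar>Re (w t)\<bar> = 1" using nw[of t] cmod_eq_Re by metis
      ultimately show ?thesis by (simp add: complex_eq_iff)
    qed
    then show ?thesis using \<open>\<And>t. w t \<noteq> -1\<close> by blast
  qed
  have "continuous_on UNIV (\<lambda>t. Im (Ln (w t)))" by (intro continuous_intros wc) (use w_not in auto)
  moreover have "Im (Ln (w s)) = Im (Ln (w t)) \<longleftrightarrow> s - t \<in> \<int>" for s t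
  proof -
    have Re0: "Re (Ln (w t)) = 0" for t using nw[of t] by (metis Re_Ln ln_one norm_zero zero_neq_one)
    have "w t \<noteq> 0" for t using nw by (metis norm_zero zero_neq_one)
    then have "Im (Ln (w s)) = Im (Ln (w t)) \<longleftrightarrow> w s = w t"
      using Re0 by (metis complex_eq_iff exp_Ln)
    also have "\<dots> \<longleftrightarrow> g s = g t" using kp kinj[OF gC gC] by (simp add: w_def)
    finally show ?thesis using g(3) by simp
  qed
  ultimately show False by (rule not_injective_on_circle)
qed

text \<open>If \<open>k \<le> m\<close>, the set \<open>U (Suc j)\<close> can be reserved for
  coordinate \<open>j\<close>: its motion planner compares \<open>r j\<close> at the two points of a
  pair, one value being constantly 1, so up to sign its \<open>h\<close> agrees with
  \<open>G j\<close> modulo integers. Such a cover of the torus is impossible.\<close>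

lemma TC_cover_lower_bound:
  fixes X :: "'x topology" and \<tau> :: "(nat \<Rightarrow> real) \<Rightarrow> 'x \<times> 'x" and r :: "nat \<Rightarrow> 'x \<Rightarrow> complex"
  assumes A: "A \<subseteq> topspace (prod_topology X X)"
    and \<tau>: "continuous_map euclidean (prod_topology X X) \<tau>" "range \<tau> \<subseteq> A"
    and \<tau>_per: "\<And>x y. (\<And>i. i < m \<Longrightarrow> x i - y i \<in> \<int>) \<Longrightarrow> \<tau> x = \<tau> y"
    and r: "\<And>j. j < m \<Longrightarrow> continuous_map X euclidean (r j)"
    and norm_r: "\<And>j x. j < m \<Longrightarrow> x \<in> topspace X \<Longrightarrow> norm (r j x) = 1"
    and G_cont: "\<And>j. j < m \<Longrightarrow> continuous_on UNIV (G j)"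
    and G_shift: "\<And>j t. j < m \<Longrightarrow> G j (t + 1) = G j t + d j"
    and d: "\<And>j. j < m \<Longrightarrow> d j \<noteq> (0::real)"
    and sep: "\<And>j. j < m \<Longrightarrow>
       (\<forall>x. r j (fst (\<tau> x)) = cis (2 * pi * G j (x j)) \<and> r j (snd (\<tau> x)) = 1) \<or>
       (\<forall>x. r j (snd (\<tau> x)) = cis (2 * pi * G j (x j)) \<and> r j (fst (\<tau> x)) = 1)"
    and cover: "(\<Union>i\<in>{1..k}. U i) = A"
    and U: "\<And>i. i \<in> {1..k} \<Longrightarrow> openin (subtopology (prod_topology X X) A) (U i)"
    and s: "\<And>i. i \<in> {1..k} \<Longrightarrow> continuous_map (subtopology (prod_topology X X) (U i)) (path_space X) (s i)"
    and ends: "\<And>i p. i \<in> {1..k} \<Longrightarrow> p \<in> U i \<Longrightarrow> s i p 0 = fst p \<and> s i p 1 = snd p"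
  shows "m < k"
proof (rule ccontr)
  assume "\<not> m < k"
  then have km: "k \<le> m" by simp
  have "\<exists>h. continuous_map (subtopology (prod_topology X X) (U (Suc j))) euclideanreal h \<and>
      (\<forall>p\<in>U (Suc j). r j (fst p) = r j (snd p) * cis (2 * pi * h p))" if j: "j < k" for j
  proof -
    have jm: "j < m" and jk: "Suc j \<in> {1..k}" using j km by auto
    have Ut: "U (Suc j) \<subseteq> topspace (subtopology (prod_topology X X) (U (Suc j)))"
      using openin_subset[OF U[OF jk]] by auto
    obtain h where h: "continuous_map (subtopology (prod_topology X X) (U (Suc j))) euclideanreal h"
      "\<And>z. z \<in> topspace (subtopology (prod_topology X X) (U (Suc j))) \<Longrightarrow>
         r j (s (Suc j) z 0) = r j (s (Suc j) z 1) * cis (2 * pi * h z)"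
      using lift_to_real_along_paths[OF s[OF jk] r[OF jm] norm_r[OF jm]] by blast
    have "r j (fst p) = r j (snd p) * cis (2 * pi * h p)" if p: "p \<in> U (Suc j)" for p
      using h(2)[OF subsetD[OF Ut p]] ends[OF jk p] by simp
    then show ?thesis using h(1) by blast
  qed
  then obtain h where hc: "\<And>j. j < k \<Longrightarrow> continuous_map (subtopology (prod_topology X X) (U (Suc j))) euclideanreal (h j)"
    and h: "\<And>j p. j < k \<Longrightarrow> p \<in> U (Suc j) \<Longrightarrow> r j (fst p) = r j (snd p) * cis (2 * pi * h j p)"
    by metis
  \<comment> \<open>Covers are numbered from 1 and coordinates from 0, hence \<open>Suc\<close>;
    coordinates left over get the empty set.\<close>
  define W where "W j = (if j < k then {x. \<tau> x \<in> U (Suc j)} else {})" for j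
  define first where "first j \<longleftrightarrow> (\<forall>x. r j (fst (\<tau> x)) = cis (2 * pi * G j (x j)) \<and> r j (snd (\<tau> x)) = 1)" for j
  \<comment> \<open>If \<open>r j\<close> is 1 at the first point, the relation along the path reads
    \<open>1 = cis (2 * pi * G j (x j)) * cis (2 * pi * h j (\<tau> x))\<close>, hence the
    sign.\<close>
  define H where "H j x = (if first j then h j (\<tau> x) else - h j (\<tau> x))" for j x
  have \<tau>A: "continuous_map euclidean (subtopology (prod_topology X X) A) \<tau>"
    using \<tau> by (auto simp: continuous_map_in_subtopology)
  show False
  proof (rule no_cover_of_torus[where W=W and h=H and G=G and d=d and m=m])
    fix j assume j: "j < m"
    show "open (W j)"
    proof (cases "j < k")
      case True
      then have "openin euclidean {x \<in> topspace euclidean. \<tau> x \<in> U (Suc j)}"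
        by (intro openin_continuous_map_preimage[OF \<tau>A] U) auto
      then show ?thesis using True by (simp add: W_def)
    qed (simp add: W_def)
    show "continuous_on (W j) (H j)"
    proof (cases "j < k")
      case True
      have "continuous_map (top_of_set (W j)) (subtopology (prod_topology X X) (U (Suc j))) \<tau>"
        using \<tau>(1) True by (auto simp: continuous_map_in_subtopology continuous_map_from_subtopology W_def)
      from continuous_map_compose[OF this hc[OF True]]
      have "continuous_on (W j) (\<lambda>x. h j (\<tau> x))" by (simp add: o_def)
      then show ?thesis unfolding H_def by (cases "first j") (auto intro!: continuous_intros)
    qed (simp add: W_def)
    show "continuous_on UNIV (G j)" "\<And>t. G j (t + 1) = G j t + d j" "d j \<noteq> 0"
      using G_cont G_shift d j by blast+
    show "G j (x j) - H j x \<in> \<int>" if x: "x \<in> W j" for x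
    proof -
      have jk: "j < k" "\<tau> x \<in> U (Suc j)" using x by (auto simp: W_def split: if_splits)
      note hx = h[OF jk]
      have "cis (2 * pi * G j (x j)) = cis (2 * pi * H j x)"
      proof (cases "first j")
        case True
        then show ?thesis using hx by (simp add: first_def H_def)
      next
        case False
        then have "1 = cis (2 * pi * G j (x j)) * cis (2 * pi * h j (\<tau> x))"
          using sep[OF j] hx unfolding first_def by metis
        then have "cis (2 * pi * G j (x j)) = inverse (cis (2 * pi * h j (\<tau> x)))"
          by (simp add: field_simps cis_neq_zero)
        then show ?thesis using False by (simp add: H_def)
      qed
      then show ?thesis by (simp only: cis_2pi_eq_iff)
    qed
    show "(x \<in> W j \<longleftrightarrow> y \<in> W j) \<and> H j x = H j y" if "\<And>i. i < m \<Longrightarrow> x i - y i \<in> \<int>" for x y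
      using \<tau>_per[OF that] by (simp add: W_def H_def)
  next
    fix x
    have "\<tau> x \<in> A" using \<tau>(2) by blast
    then obtain i where "i \<in> {1..k}" "\<tau> x \<in> U i" using cover by blast
    then show "\<exists>j<m. x \<in> W j" using km by (intro exI[of _ "i - 1"]) (auto simp: W_def)
  qed
qed

section \<open>Circle-valued maps that separate a loop from a closed set\<close>

context cw_graph begin

text \<open>The vertices are discrete: \<open>vdist\<close> takes only the values 0 and 1 on them,
  so a path inside the vertices is constant, while the loop is injective on short intervals.\<close>

lemma loop_leaves_vertices:
  assumes g: "continuous_map euclideanreal Y g" "\<And>s t. g s = g t \<longleftrightarrow> s - t \<in> \<int>"
    and C': "closedin Y C'" and t1: "g t1 \<notin> C'"
  obtains e t where "e \<in> E" "g t \<in> e" "g t \<notin> C'"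
proof -
  have gY: "g t \<in> topspace Y" for t using g(1) by (auto simp: continuous_map_def)
  have "openin euclideanreal {t \<in> topspace euclideanreal. g t \<in> topspace Y - C'}"
    by (rule openin_continuous_map_preimage[OF g(1)]) (use C' in auto)
  then have "open {t. g t \<in> topspace Y - C'}" by simp
  then obtain \<epsilon> where \<epsilon>: "0 < \<epsilon>" "ball t1 \<epsilon> \<subseteq> {t. g t \<in> topspace Y - C'}"
    using t1 gY unfolding open_contains_ball by blast
  define \<eta> where "\<eta> = min \<epsilon> 1 / 2"
  have \<eta>: "0 < \<eta>" "\<eta> < \<epsilon>" "\<eta> \<le> 1/2" using \<epsilon> by (auto simp: \<eta>_def)
  have notC: "g t \<notin> C'" if "t \<in> {t1..t1 + \<eta>}" for t
  proof -
    have "t \<in> ball t1 \<epsilon>" using that \<eta> by (auto simp: dist_real_def)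
    then show ?thesis using \<epsilon>(2) by blast
  qed
  have "\<exists>t\<in>{t1..t1 + \<eta>}. g t \<notin> V"
  proof (rule ccontr)
    assume "\<not> (\<exists>t\<in>{t1..t1 + \<eta>}. g t \<notin> V)"
    then have inV: "g t \<in> V" if "t \<in> {t1..t1 + \<eta>}" for t using that by blast
    have "continuous_map euclideanreal euclideanreal (vdist (g t1) \<circ> g)"
      by (rule continuous_map_compose[OF g(1) continuous_map_vdist])
    then have "continuous_on UNIV (\<lambda>t. vdist (g t1) (g t))" by (simp add: o_def)
    then have c: "continuous_on {t1..t1 + \<eta>} (\<lambda>t. vdist (g t1) (g t))"
      by (rule continuous_on_subset) simp
    have "vdist (g t1) (g t1) = vdist (g t1) (g (t1 + \<eta>))"
      by (rule continuous_on_Ints_constant[OF _ c]) (use inV \<eta> in \<open>auto simp: vdist_vertex\<close>)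
    then have "vdist (g t1) (g (t1 + \<eta>)) = 0" using inV[of t1] \<eta> by (simp add: vdist_vertex)
    then have "g (t1 + \<eta>) = g t1" using vdist_eq_0[OF gY] by blast
    then have "\<eta> \<in> \<int>" using g(2) by simp
    then obtain n :: int where "\<eta> = of_int n" by (elim Ints_cases)
    then have "0 < n" "n < 1" using \<eta> by linarith+
    then show False by simp
  qed
  then obtain t where t: "t \<in> {t1..t1 + \<eta>}" "g t \<notin> V" by blast
  then obtain e where "e \<in> E" "g t \<in> e" using gY[of t] cells_cover by blast
  then show ?thesis using that notC[OF t(1)] by blast
qed

text \<open>A short interval of the edge around \<open>p\<close> is wrapped once around the circle
  and everything else goes to 1. The point \<open>p\<close> goes to -1, which has no other
  preimage.\<close>

lemma circle_valued_bump:
  assumes e: "e \<in> E" and p: "p \<in> e" and C': "closedin Y C'" "p \<notin> C'"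
  obtains r :: "'a \<Rightarrow> complex" and N where "continuous_map Y euclidean r" "\<And>y. norm (r y) = 1"
    "\<And>y. y \<in> C' \<Longrightarrow> r y = 1" "\<And>y. y \<in> topspace Y \<Longrightarrow> r y = r p \<Longrightarrow> y = p"
    "openin Y N" "p \<in> N" "inj_on r N"
proof -
  define \<tau> where "\<tau> = coord e p"
  have \<tau>: "0 < \<tau>" "\<tau> < 1" "\<Phi> e \<tau> = p" using coord_bounds[OF e p] \<Phi>_coord[OF e p] by (simp_all add: \<tau>_def)
  have "openin unit_interval {t \<in> topspace unit_interval. \<Phi> e t \<in> topspace Y - C'}"
    by (rule openin_continuous_map_preimage[OF \<Phi>_continuous[OF e]]) (use C' in auto)
  moreover have "\<tau> \<in> {t \<in> topspace unit_interval. \<Phi> e t \<in> topspace Y - C'}"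
    using \<tau> \<Phi>_in[OF e, of \<tau>] C'(2) by simp
  ultimately obtain \<epsilon> where \<epsilon>: "0 < \<epsilon>" "ball \<tau> \<epsilon> \<inter> {0..1} \<subseteq> {t \<in> topspace unit_interval. \<Phi> e t \<in> topspace Y - C'}"
    unfolding openin_contains_ball by blast
  \<comment> \<open>Small enough to stay inside the edge and off \<open>C'\<close>.\<close>
  define \<delta> where "\<delta> = min \<epsilon> (min \<tau> (1 - \<tau>))"
  have \<delta>: "0 < \<delta>" "\<delta> \<le> \<epsilon>" "\<delta> \<le> \<tau>" "\<delta> \<le> 1 - \<tau>" using \<epsilon> \<tau> by (auto simp: \<delta>_def)
  have far: "\<Phi> e t \<notin> C'" if "\<bar>t - \<tau>\<bar> < \<delta>" for t
  proof -
    have "t \<in> ball \<tau> \<epsilon> \<inter> {0..1}" using that \<delta> by (auto simp: dist_real_def abs_less_iff)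
    then show ?thesis using \<epsilon>(2) by blast
  qed
  \<comment> \<open>A ramp from 0 to 1 across the interval, with \<open>c \<tau>\<close> equal to
    1/2.\<close>
  define c where "c t = max 0 (min 1 ((t - (\<tau> - \<delta>)) / (2 * \<delta>)))" for t
  have c_mid: "c t = (t - (\<tau> - \<delta>)) / (2 * \<delta>)" "0 < c t" "c t < 1" if "\<bar>t - \<tau>\<bar> < \<delta>" for t
    using that \<delta>(1) by (auto simp: c_def abs_less_iff divide_less_eq min_def max_def field_simps)
  have c_out: "c t = 0 \<or> c t = 1" if "\<not> \<bar>t - \<tau>\<bar> < \<delta>" for t
    using that \<delta>(1) by (auto simp: c_def abs_less_iff min_def max_def field_simps)
  have c01: "c 0 = 0" "c 1 = 1" using \<delta> by (auto simp: c_def min_def max_def field_simps)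
  have cis01: "cis (2 * pi * c 0) = 1" "cis (2 * pi * c 1) = 1" by (simp_all add: c01)
  define \<phi> where "\<phi> e' t = (if e' = e then cis (2 * pi * c t) else 1)" for e' t
  define r where "r = glue (\<lambda>_. 1) \<phi>"
  have r\<Phi>: "r (\<Phi> e' t) = \<phi> e' t" if "e' \<in> E" "t \<in> {0..1}" for e' t
    unfolding r_def by (rule glue_\<Phi>[OF that]) (simp_all add: \<phi>_def cis01)
  have rc: "continuous_map Y euclidean r" unfolding r_def
  proof (rule continuous_map_glue)
    fix e' show "continuous_map unit_interval euclidean (\<phi> e')"
      unfolding \<phi>_def[abs_def] c_def[abs_def] by (cases "e' = e") (use \<delta>(1) in \<open>auto intro!: continuous_intros\<close>)
  qed (simp add: \<phi>_def cis01)
  have nr: "norm (r y) = 1" for y by (simp add: r_def glue_def \<phi>_def Let_def)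
  define N where "N = \<Phi> e ` {\<tau> - \<delta><..<\<tau> + \<delta>}"
  have N: "openin Y N" unfolding N_def by (rule openin_edge_piece[OF e]) (use \<delta> in auto)
  have pN: "p \<in> N" unfolding N_def using \<tau>(3) \<delta>(1) by (intro image_eqI[of _ _ \<tau>]) auto
  have rN: "r y = cis (2 * pi * c t)" "t \<in> {0..1}" if "y = \<Phi> e t" "\<bar>t - \<tau>\<bar> < \<delta>" for y t
  proof -
    show "t \<in> {0..1}" using that(2) \<delta> by (auto simp: abs_less_iff)
    then show "r y = cis (2 * pi * c t)" using r\<Phi>[OF e] that(1) by (simp add: \<phi>_def)
  qed
  have c_inj: "t = t'" if "\<bar>t - \<tau>\<bar> < \<delta>" "\<bar>t' - \<tau>\<bar> < \<delta>" "cis (2 * pi * c t) = cis (2 * pi * c t')" for t t'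
  proof -
    have "c t - c t' \<in> \<int>" using that(3) by (simp only: cis_2pi_eq_iff)
    then obtain n :: int where n: "c t - c t' = of_int n" by (elim Ints_cases)
    then have "n = 0" using c_mid[OF that(1)] c_mid[OF that(2)] by linarith
    then have "c t = c t'" using n by simp
    then have "(t - (\<tau> - \<delta>)) / (2 * \<delta>) = (t' - (\<tau> - \<delta>)) / (2 * \<delta>)"
      unfolding c_mid(1)[OF that(1)] c_mid(1)[OF that(2)] .
    then show ?thesis using \<delta>(1) by simp
  qed
  have "inj_on r N"
  proof (rule inj_onI)
    fix y y' assume "y \<in> N" "y' \<in> N" and eq: "r y = r y'"
    then obtain t t' where t: "y = \<Phi> e t" "\<bar>t - \<tau>\<bar> < \<delta>" "y' = \<Phi> e t'" "\<bar>t' - \<tau>\<bar> < \<delta>"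
      unfolding N_def by (auto simp: abs_less_iff)
    then show "y = y'" using eq rN(1)[OF t(1,2)] rN(1)[OF t(3,4)] c_inj by metis
  qed
  moreover have "r y = 1" if y: "y \<in> C'" for y
  proof -
    have "y \<in> topspace Y" using y C'(1) closedin_subset by blast
    then obtain e' t where t: "e' \<in> E" "t \<in> {0..1}" "y = \<Phi> e' t" by (rule point_on_edge)
    show ?thesis
    proof (cases "e' = e")
      case True
      then have "\<not> \<bar>t - \<tau>\<bar> < \<delta>" using far y t by blast
      then have "cis (2 * pi * c t) = 1" using c_out by force
      then show ?thesis using r\<Phi>[OF t(1,2)] t(3) True by (simp add: \<phi>_def)
    next
      case False
      then show ?thesis using r\<Phi>[OF t(1,2)] t(3) by (simp add: \<phi>_def)
    qed
  qed
  moreover have "y = p" if y: "y \<in> topspace Y" "r y = r p" for y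
  proof -
    have rp: "r p = cis (2 * pi * c \<tau>)" using rN(1)[of p \<tau>] \<tau>(3) \<delta>(1) by simp
    have "c \<tau> \<notin> \<int>"
    proof
      assume "c \<tau> \<in> \<int>"
      then obtain n :: int where "c \<tau> = of_int n" by (elim Ints_cases)
      then have "0 < n" "n < 1" using c_mid[of \<tau>] \<delta>(1) by simp_all
      then show False by simp
    qed
    then have rp1: "r p \<noteq> 1" using cis_2pi_eq_iff[of "c \<tau>" 0] rp by simp
    obtain e' t where t: "e' \<in> E" "t \<in> {0..1}" "y = \<Phi> e' t" using y(1) by (rule point_on_edge)
    have e': "e' = e"
    proof (rule ccontr)
      assume "e' \<noteq> e"
      then have "r y = 1" using r\<Phi>[OF t(1,2)] t(3) by (simp add: \<phi>_def)
      then show False using rp1 y(2) by simp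
    qed
    have ry: "r y = cis (2 * pi * c t)" using r\<Phi>[OF t(1,2)] t(3) e' by (simp add: \<phi>_def)
    have near: "\<bar>t - \<tau>\<bar> < \<delta>"
    proof (rule ccontr)
      assume "\<not> \<bar>t - \<tau>\<bar> < \<delta>"
      then have "r y = 1" using c_out ry by force
      then show False using rp1 y(2) by simp
    qed
    have "t = \<tau>" using c_inj[OF near, of \<tau>] \<delta>(1) ry rp y(2) by simp
    then show ?thesis using t(3) e' \<tau>(3) by simp
  qed
  ultimately show ?thesis using that[OF rc nr] N pN by blast
qed

text \<open>The bump is placed at a point of the loop in an open edge off \<open>C'\<close>. Its
  value there is taken just once per period, with the composite injective nearby, which forces a
  nonzero winding number.\<close>

lemma separating_circle_map:
  assumes g: "continuous_map euclideanreal Y g" "\<And>s t. g s = g t \<longleftrightarrow> s - t \<in> \<int>"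
    and C': "closedin Y C'" and t1: "g t1 \<notin> C'"
  obtains r G d where "continuous_map Y euclidean r" "\<And>y. norm (r y) = 1" "\<And>y. y \<in> C' \<Longrightarrow> r y = 1"
    "continuous_on UNIV G" "\<And>t. r (g t) = cis (2 * pi * G t)" "\<And>t. G (t + 1) = G t + d" "d \<noteq> (0::real)"
proof -
  obtain e t0 where e: "e \<in> E" "g t0 \<in> e" "g t0 \<notin> C'" using loop_leaves_vertices[OF g C' t1] by blast
  obtain r :: "'a \<Rightarrow> complex" and N where r: "continuous_map Y euclidean r" "\<And>y. norm (r y) = 1"
    "\<And>y. y \<in> C' \<Longrightarrow> r y = 1" and ronly: "\<And>y. y \<in> topspace Y \<Longrightarrow> r y = r (g t0) \<Longrightarrow> y = g t0"
    and N: "openin Y N" "g t0 \<in> N" "inj_on r N"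
    using circle_valued_bump[OF e(1,2) C' e(3)] by blast
  have gY: "g t \<in> topspace Y" for t using g(1) by (auto simp: continuous_map_def)
  have "openin euclideanreal {t \<in> topspace euclideanreal. g t \<in> N}"
    by (rule openin_continuous_map_preimage[OF g(1) N(1)])
  then have "open {t. g t \<in> N}" by simp
  then obtain \<epsilon> where \<epsilon>: "0 < \<epsilon>" "ball t0 \<epsilon> \<subseteq> {t. g t \<in> N}"
    using N(2) unfolding open_contains_ball by blast
  define \<eta> where "\<eta> = min \<epsilon> (1/2)"
  have \<eta>: "0 < \<eta>" "\<eta> \<le> \<epsilon>" "\<eta> \<le> 1/2" using \<epsilon>(1) by (auto simp: \<eta>_def)
  have "continuous_map euclideanreal euclidean (r \<circ> g)" by (rule continuous_map_compose[OF g(1) r(1)])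
  then have fc: "continuous_on UNIV (\<lambda>t. r (g t))" by (simp add: o_def)
  have inj: "inj_on (\<lambda>t. r (g t)) {t0 - \<eta><..<t0 + \<eta>}"
  proof (rule inj_onI)
    fix s t assume st: "s \<in> {t0 - \<eta><..<t0 + \<eta>}" "t \<in> {t0 - \<eta><..<t0 + \<eta>}" and eq: "r (g s) = r (g t)"
    have "s \<in> ball t0 \<epsilon>" "t \<in> ball t0 \<epsilon>" using st \<eta> by (auto simp: dist_real_def abs_less_iff)
    then have "g s \<in> N" "g t \<in> N" using \<epsilon>(2) by blast+
    then have "g s = g t" using N(3) eq by (metis inj_onD)
    then have "s - t \<in> \<int>" using g(2) by simp
    then obtain n :: int where n: "s - t = of_int n" by (elim Ints_cases)
    then have "n < 1" "-1 < n" using st \<eta> by simp_all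
    then show "s = t" using n by simp
  qed
  have per: "r (g (t + 1)) = r (g t)" for t using g(2)[of "t + 1" t] by simp
  have only: "t - t0 \<in> \<int>" if "r (g t) = r (g t0)" for t using ronly[OF gY that] g(2) by blast
  obtain G d where "continuous_on UNIV G" "\<And>t. r (g t) = cis (2 * pi * G t)" "\<And>t. G (t + 1) = G t + d" "d \<noteq> 0"
    using winding_nonzero[OF fc r(2) per only \<eta>(1) inj] by blast
  then show ?thesis using that r by blast
qed

end

lemma closedin_cycle: assumes "Hausdorff_space Y" "cycle_in Y C" shows "closedin Y C"
proof -
  have "compact_space (top_of_set (sphere (0::complex) 1))" by (simp add: compact_space_subtopology)
  then have "compact_space (subtopology Y C)"
    using assms(2) homeomorphic_compact_space unfolding cycle_in_def by blast
  then have "compactin Y C" using assms(2) by (simp add: compactin_subspace cycle_in_def)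
  then show ?thesis using assms(1) compactin_imp_closedin by blast
qed

section \<open>Lower bounds from the torus of pairs of loops\<close>

lemma TC_geI:
  assumes "\<And>k U s. (\<Union>i\<in>{1..k}. U i) = topspace (prod_topology X X) \<Longrightarrow>
     (\<And>i. i \<in> {1..k} \<Longrightarrow> openin (prod_topology X X) (U i)) \<Longrightarrow>
     (\<And>i. i \<in> {1..k} \<Longrightarrow> continuous_map (subtopology (prod_topology X X) (U i)) (path_space X) (s i)) \<Longrightarrow>
     (\<And>i p. i \<in> {1..k} \<Longrightarrow> p \<in> U i \<Longrightarrow> s i p 0 = fst p \<and> s i p 1 = snd p) \<Longrightarrow> m < k"
  shows "enat (m + 1) \<le> TC X"
  unfolding TC_def
proof (rule Inf_greatest)
  fix x assume "x \<in> {enat k | k. \<exists>U s.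
     (\<Union>i\<in>{1..k}. U i) = topspace (prod_topology X X) \<and>
     (\<forall>i\<in>{1..k}. openin (prod_topology X X) (U i) \<and>
        continuous_map (subtopology (prod_topology X X) (U i)) (path_space X) (s i) \<and>
        (\<forall>(x, y)\<in>U i. s i (x, y) 0 = x \<and> s i (x, y) 1 = y))}"
  then obtain k U s where x: "x = enat k" and "(\<Union>i\<in>{1..k}. U i) = topspace (prod_topology X X)"
     and *: "\<forall>i\<in>{1..k}. openin (prod_topology X X) (U i) \<and>
        continuous_map (subtopology (prod_topology X X) (U i)) (path_space X) (s i) \<and>
        (\<forall>(x, y)\<in>U i. s i (x, y) 0 = x \<and> s i (x, y) 1 = y)" by blast
  then have "m < k" by (intro assms[where k=k and U=U and s=s]) (auto split: prod.splits)
  then show "enat (m + 1) \<le> x" by (simp add: x)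
qed

lemma relative_TC_geI:
  assumes "\<And>k U s. (\<Union>i\<in>{1..k}. U i) = A \<Longrightarrow>
     (\<And>i. i \<in> {1..k} \<Longrightarrow> openin (subtopology (prod_topology X X) A) (U i)) \<Longrightarrow>
     (\<And>i. i \<in> {1..k} \<Longrightarrow> continuous_map (subtopology (prod_topology X X) (U i)) (path_space X) (s i)) \<Longrightarrow>
     (\<And>i p. i \<in> {1..k} \<Longrightarrow> p \<in> U i \<Longrightarrow> s i p 0 = fst p \<and> s i p 1 = snd p) \<Longrightarrow> m < k"
  shows "enat (m + 1) \<le> relative_TC X A"
  unfolding relative_TC_def
proof (rule Inf_greatest)
  fix x assume "x \<in> {enat k | k. \<exists>U s.
     (\<Union>i\<in>{1..k}. U i) = A \<and>
     (\<forall>i\<in>{1..k}. openin (subtopology (prod_topology X X) A) (U i) \<and>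
        continuous_map (subtopology (prod_topology X X) (U i)) (path_space_on X A) (s i) \<and>
        (\<forall>(x, y)\<in>U i. s i (x, y) 0 = x \<and> s i (x, y) 1 = y))}"
  then obtain k U s where x: "x = enat k" and "(\<Union>i\<in>{1..k}. U i) = A"
     and *: "\<forall>i\<in>{1..k}. openin (subtopology (prod_topology X X) A) (U i) \<and>
        continuous_map (subtopology (prod_topology X X) (U i)) (path_space_on X A) (s i) \<and>
        (\<forall>(x, y)\<in>U i. s i (x, y) 0 = x \<and> s i (x, y) 1 = y)" by blast
  then have "m < k"
    by (intro assms[where k=k and U=U and s=s]) (auto simp: path_space_on_def continuous_map_in_subtopology split: prod.splits)
  then show "enat (m + 1) \<le> x" by (simp add: x)
qed

text \<open>\<open>\<alpha> i\<close> and \<open>\<beta> i\<close> run through the cycles used for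
  the first and the second point of a pair. Between these two only incomparability is asked for,
  since in the case \<open>n = 1\<close> they may intersect.\<close>

locale graph_with_loops = cw_graph +
  fixes n :: nat and \<alpha> \<beta> :: "nat \<Rightarrow> real \<Rightarrow> 'a"
  assumes \<alpha>: "i \<in> {1..n} \<Longrightarrow> continuous_map euclideanreal Y (\<alpha> i)"
      "i \<in> {1..n} \<Longrightarrow> \<alpha> i s = \<alpha> i t \<longleftrightarrow> s - t \<in> \<int>" "i \<in> {1..n} \<Longrightarrow> closedin Y (range (\<alpha> i))"
    and \<beta>: "i \<in> {1..n} \<Longrightarrow> continuous_map euclideanreal Y (\<beta> i)"
      "i \<in> {1..n} \<Longrightarrow> \<beta> i s = \<beta> i t \<longleftrightarrow> s - t \<in> \<int>" "i \<in> {1..n} \<Longrightarrow> closedin Y (range (\<beta> i))"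
    and \<alpha>_disjoint: "i \<in> {1..n} \<Longrightarrow> j \<in> {1..n} \<Longrightarrow> i \<noteq> j \<Longrightarrow> range (\<alpha> i) \<inter> range (\<alpha> j) = {}"
    and \<beta>_disjoint: "i \<in> {1..n} \<Longrightarrow> j \<in> {1..n} \<Longrightarrow> i \<noteq> j \<Longrightarrow> range (\<beta> i) \<inter> range (\<beta> j) = {}"
    and not_subset: "i \<in> {1..n} \<Longrightarrow> \<not> range (\<alpha> i) \<subseteq> range (\<beta> i)" "i \<in> {1..n} \<Longrightarrow> \<not> range (\<beta> i) \<subseteq> range (\<alpha> i)"
begin

text \<open>Real coordinates are counted from 0 and points from 1: the first \<open>n\<close> reals
  move along the \<open>\<alpha> i\<close>, the next \<open>n\<close> along the
  \<open>\<beta> i\<close>.\<close>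

definition torus_point :: "(nat \<Rightarrow> real) \<Rightarrow> (nat \<Rightarrow> 'a) \<times> (nat \<Rightarrow> 'a)" where
  "torus_point x = (\<lambda>i\<in>{1..n}. \<alpha> i (x (i - 1)), \<lambda>i\<in>{1..n}. \<beta> i (x (n + i - 1)))"

lemma continuous_map_torus_point:
  assumes R: "\<And>i j. R i j \<Longrightarrow> i \<noteq> j"
  shows "continuous_map euclidean (prod_topology (partial_config_space n R Y) (partial_config_space n R Y)) torus_point"
proof -
  have co: "continuous_map euclidean euclideanreal (\<lambda>x :: nat \<Rightarrow> real. x k)" for k
    by (auto intro: continuous_on_product_coordinates)
  have a: "continuous_map euclidean Y (\<lambda>x :: nat \<Rightarrow> real. \<alpha> i (x k))" and b: "continuous_map euclidean Y (\<lambda>x :: nat \<Rightarrow> real. \<beta> i (x k))" if "i \<in> {1..n}" for i k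
    using continuous_map_compose[OF co[of k] \<alpha>(1)[OF that]] continuous_map_compose[OF co[of k] \<beta>(1)[OF that]]
    by (simp_all add: o_def)
  have "continuous_map euclidean (partial_config_space n R Y) (\<lambda>x. \<lambda>i\<in>{1..n}. \<alpha> i (x (i - 1)))"
    by (rule continuous_map_into_partial_config) (use a R \<alpha>_disjoint in \<open>blast+\<close>)
  moreover have "continuous_map euclidean (partial_config_space n R Y) (\<lambda>x. \<lambda>i\<in>{1..n}. \<beta> i (x (n + i - 1)))"
    by (rule continuous_map_into_partial_config) (use b R \<beta>_disjoint in \<open>blast+\<close>)
  ultimately show ?thesis unfolding torus_point_def[abs_def] by (intro continuous_map_pairedI)
qed

lemma torus_point_periodic:
  assumes "\<And>i. i < 2 * n \<Longrightarrow> x i - y i \<in> \<int>" shows "torus_point x = torus_point y"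
proof -
  have "\<alpha> i (x (i - 1)) = \<alpha> i (y (i - 1)) \<and> \<beta> i (x (n + i - 1)) = \<beta> i (y (n + i - 1))" if i: "i \<in> {1..n}" for i
    using \<alpha>(2)[OF i] \<beta>(2)[OF i] assms[of "i - 1"] assms[of "n + i - 1"] i by auto
  then show ?thesis by (auto simp: torus_point_def)
qed

text \<open>\<open>X\<close> is only required to project to \<open>Y\<close> in each coordinate.
  This treats the power, the configuration space and the slice of the thickened space alike, with
  planners free to use all of \<open>X\<close>.\<close>

lemma torus_lower_bound:
  fixes X :: "'x topology" and proj :: "nat \<Rightarrow> 'x \<Rightarrow> 'a" and emb :: "(nat \<Rightarrow> 'a) \<Rightarrow> 'x"
  assumes A: "A \<subseteq> topspace (prod_topology X X)"
    and proj: "\<And>i. i \<in> {1..n} \<Longrightarrow> continuous_map X Y (proj i)"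
    and proj_emb: "\<And>i z. i \<in> {1..n} \<Longrightarrow> proj i (emb z) = z i"
    and \<tau>: "continuous_map euclidean (prod_topology X X) (\<lambda>x. map_prod emb emb (torus_point x))"
       "range (\<lambda>x. map_prod emb emb (torus_point x)) \<subseteq> A"
    and cover: "(\<Union>i\<in>{1..k}. U i) = A"
    and U: "\<And>i. i \<in> {1..k} \<Longrightarrow> openin (subtopology (prod_topology X X) A) (U i)"
    and s: "\<And>i. i \<in> {1..k} \<Longrightarrow> continuous_map (subtopology (prod_topology X X) (U i)) (path_space X) (s i)"
    and ends: "\<And>i p. i \<in> {1..k} \<Longrightarrow> p \<in> U i \<Longrightarrow> s i p 0 = fst p \<and> s i p 1 = snd p"
  shows "2 * n < k"
proof -
  define P where "P g C r G d \<longleftrightarrow> continuous_map Y euclidean r \<and> (\<forall>y. norm (r y) = 1) \<and> (\<forall>y\<in>C. r y = 1) \<and>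
    continuous_on UNIV G \<and> (\<forall>t. r (g t) = cis (2 * pi * G t)) \<and> (\<forall>t. G (t + 1) = G t + d) \<and> d \<noteq> 0"
    for g :: "real \<Rightarrow> 'a" and C :: "'a set" and r :: "'a \<Rightarrow> complex" and G :: "real \<Rightarrow> real" and d :: real
  \<comment> \<open>\<open>g j\<close> is the loop along which real coordinate \<open>j\<close>
    moves; \<open>g' j\<close> is the loop at the same position in the other point of the pair,
    where \<open>r j\<close> has to be 1.\<close>
  define g where "g j = (if j < n then \<alpha> (j + 1) else \<beta> (j - n + 1))" for j
  define g' where "g' j = (if j < n then \<beta> (j + 1) else \<alpha> (j - n + 1))" for j
  define idx where "idx j = (if j < n then j + 1 else j - n + 1)" for j
  have idx: "idx j \<in> {1..n}" if "j < 2 * n" for j using that by (auto simp: idx_def)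
  have ex: "\<exists>r G d. P (g j) (range (g' j)) r G d" if j: "j < 2 * n" for j
  proof -
    have gj: "continuous_map euclideanreal Y (g j)" "\<And>s t. g j s = g j t \<longleftrightarrow> s - t \<in> \<int>"
      "closedin Y (range (g' j))" "\<not> range (g j) \<subseteq> range (g' j)"
      using idx[OF j] \<alpha>[OF idx[OF j]] \<beta>[OF idx[OF j]] not_subset[OF idx[OF j]]
      by (simp_all add: idx_def g_def g'_def split: if_splits)
    then obtain t1 where "g j t1 \<notin> range (g' j)" by blast
    then show ?thesis unfolding P_def using separating_circle_map[OF gj(1,2,3)] by metis
  qed
  then obtain r G d where rGd: "\<And>j. j < 2 * n \<Longrightarrow> P (g j) (range (g' j)) (r j) (G j) (d j)" by metis
  show ?thesis
  proof (rule TC_cover_lower_bound[OF A \<tau>, where r="\<lambda>j x. r j (proj (idx j) x)" and G=G and d=d])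
    show "map_prod emb emb (torus_point x) = map_prod emb emb (torus_point y)"
      if "\<And>i. i < 2 * n \<Longrightarrow> x i - y i \<in> \<int>" for x y
      using torus_point_periodic[OF that] by simp
    fix j assume j: "j < 2 * n"
    note P = rGd[OF j, unfolded P_def]
    show "continuous_map X euclidean (\<lambda>x. r j (proj (idx j) x))"
      using continuous_map_compose[OF proj[OF idx[OF j]] conjunct1[OF P]] by (simp add: o_def)
    show "norm (r j (proj (idx j) x)) = 1" for x using P by blast
    show "continuous_on UNIV (G j)" "\<And>t. G j (t + 1) = G j t + d j" "d j \<noteq> 0" using P by blast+
    have fs: "proj (idx j) (fst (map_prod emb emb (torus_point x))) = \<alpha> (idx j) (x (idx j - 1))"
      "proj (idx j) (snd (map_prod emb emb (torus_point x))) = \<beta> (idx j) (x (n + idx j - 1))" for x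
      using proj_emb[OF idx[OF j]] idx[OF j] by (simp_all add: torus_point_def)
    show "(\<forall>x. r j (proj (idx j) (fst (map_prod emb emb (torus_point x)))) = cis (2 * pi * G j (x j)) \<and>
               r j (proj (idx j) (snd (map_prod emb emb (torus_point x)))) = 1) \<or>
          (\<forall>x. r j (proj (idx j) (snd (map_prod emb emb (torus_point x)))) = cis (2 * pi * G j (x j)) \<and>
               r j (proj (idx j) (fst (map_prod emb emb (torus_point x)))) = 1)"
    proof (cases "j < n")
      case True
      then show ?thesis using P unfolding fs by (intro disjI1) (simp add: idx_def g_def g'_def)
    next
      case False
      then show ?thesis using P unfolding fs by (intro disjI2) (simp add: idx_def g_def g'_def)
    qed
  qed (use cover U s ends in auto)
qed

lemma TC_partial_config_ge:
  assumes R: "\<And>i j. R i j \<Longrightarrow> i \<noteq> j"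
  shows "enat (2 * n + 1) \<le> TC (partial_config_space n R Y)"
proof (rule TC_geI)
  let ?Z = "partial_config_space n R Y"
  fix k :: nat and U s
  assume *: "(\<Union>i\<in>{1..k}. U i) = topspace (prod_topology ?Z ?Z)"
     "\<And>i. i \<in> {1..k} \<Longrightarrow> openin (prod_topology ?Z ?Z) (U i)"
     "\<And>i. i \<in> {1..k} \<Longrightarrow> continuous_map (subtopology (prod_topology ?Z ?Z) (U i)) (path_space ?Z) (s i)"
     "\<And>i p. i \<in> {1..k} \<Longrightarrow> p \<in> U i \<Longrightarrow> s i p 0 = fst p \<and> s i p 1 = snd p"
  have c: "continuous_map euclidean (prod_topology ?Z ?Z) torus_point" by (rule continuous_map_torus_point[OF R])
  show "2 * n < k"
  proof (rule torus_lower_bound[where proj="\<lambda>i z. z i" and emb=id and A="topspace (prod_topology ?Z ?Z)" and X="?Z"])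
    show "range (\<lambda>x. map_prod id id (torus_point x)) \<subseteq> topspace (prod_topology ?Z ?Z)"
      using continuous_map_image_subset_topspace[OF c] by (simp add: map_prod.id)
    show "continuous_map euclidean (prod_topology ?Z ?Z) (\<lambda>x. map_prod id id (torus_point x))"
      using c by (simp add: map_prod.id)
    show "continuous_map ?Z Y (\<lambda>z. z i)" if "i \<in> {1..n}" for i using that by (rule continuous_map_partial_config_proj)
    show "openin (subtopology (prod_topology ?Z ?Z) (topspace (prod_topology ?Z ?Z))) (U i)" if "i \<in> {1..k}" for i
      using *(2)[OF that] by (simp only: subtopology_topspace)
  qed (use * in auto)
qed

end

section \<open>The slice of configurations at height zero\<close>

definition at_zero :: "nat \<Rightarrow> (nat \<Rightarrow> 'a) \<Rightarrow> nat \<Rightarrow> 'a \<times> real" where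
  "at_zero n y = (\<lambda>i\<in>{1..n}. (y i, 0))"

lemma config_at_zero_eq: "config_at_zero n Y = at_zero n ` topspace (config_space n Y)"
  by (simp add: config_at_zero_def at_zero_def[abs_def])

lemma continuous_map_at_zero:
  "continuous_map (config_space n Y) (config_space n (prod_topology Y unit_interval)) (at_zero n)"
  unfolding config_space_eq_partial at_zero_def[abs_def]
proof (rule continuous_map_into_partial_config)
  fix i assume i: "i \<in> {1..n}"
  show "continuous_map (partial_config_space n (\<noteq>) Y) (prod_topology Y unit_interval) (\<lambda>y. (y i, 0))"
    by (intro continuous_map_pairedI continuous_map_partial_config_proj[OF i]) auto
next
  fix x i j assume "x \<in> topspace (partial_config_space n (\<noteq>) Y)" "i \<in> {1..n}" "j \<in> {1..n}" "i \<noteq> j"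
  then show "(x i, 0::real) \<noteq> (x j, 0)" by (auto simp: topspace_partial_config_space)
qed

text \<open>The paths may run through the thickened space, where the projections of distinct points
  to \<open>Y\<close> may coincide. This does no harm, since each coordinate is lifted
  separately.\<close>

lemma (in graph_with_loops) relative_TC_config_ge:
  "enat (2 * n + 1) \<le> relative_TC (config_space n (prod_topology Y unit_interval))
     (config_at_zero n Y \<times> config_at_zero n Y)"
proof (rule relative_TC_geI)
  let ?Z = "config_space n Y" and ?X = "config_space n (prod_topology Y unit_interval)"
  let ?A = "config_at_zero n Y \<times> config_at_zero n Y"
  fix k :: nat and U s
  assume *: "(\<Union>i\<in>{1..k}. U i) = ?A"
     "\<And>i. i \<in> {1..k} \<Longrightarrow> openin (subtopology (prod_topology ?X ?X) ?A) (U i)"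
     "\<And>i. i \<in> {1..k} \<Longrightarrow> continuous_map (subtopology (prod_topology ?X ?X) (U i)) (path_space ?X) (s i)"
     "\<And>i p. i \<in> {1..k} \<Longrightarrow> p \<in> U i \<Longrightarrow> s i p 0 = fst p \<and> s i p 1 = snd p"
  have c: "continuous_map euclidean (prod_topology ?Z ?Z) torus_point"
    unfolding config_space_eq_partial by (rule continuous_map_torus_point)
  have cf: "continuous_map euclidean ?Z (\<lambda>x. fst (torus_point x))" and cs: "continuous_map euclidean ?Z (\<lambda>x. snd (torus_point x))"
    using continuous_map_compose[OF c continuous_map_fst] continuous_map_compose[OF c continuous_map_snd] by (simp_all add: o_def)
  have "continuous_map euclidean ?X (at_zero n \<circ> (\<lambda>x. fst (torus_point x)))"
    "continuous_map euclidean ?X (at_zero n \<circ> (\<lambda>x. snd (torus_point x)))"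
    by (rule continuous_map_compose[OF cf continuous_map_at_zero] continuous_map_compose[OF cs continuous_map_at_zero])+
  then have cA: "continuous_map euclidean (prod_topology ?X ?X) (\<lambda>x. map_prod (at_zero n) (at_zero n) (torus_point x))"
    by (simp add: map_prod_def case_prod_unfold continuous_map_paired o_def)
  have "config_at_zero n Y \<subseteq> topspace ?X"
    using continuous_map_image_subset_topspace[OF continuous_map_at_zero] by (simp add: config_at_zero_eq)
  then have A: "?A \<subseteq> topspace (prod_topology ?X ?X)" by auto
  have prj: "continuous_map ?X Y (\<lambda>z. fst (z i))" if "i \<in> {1..n}" for i
    using continuous_map_compose[OF continuous_map_partial_config_proj[OF that] continuous_map_fst]
    unfolding config_space_eq_partial by (simp add: o_def)
  show "2 * n < k"
  proof (rule torus_lower_bound[OF A, where proj="\<lambda>i z. fst (z i)" and emb="at_zero n"])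
    show "range (\<lambda>x. map_prod (at_zero n) (at_zero n) (torus_point x)) \<subseteq> ?A"
      using continuous_map_image_subset_topspace[OF cf] continuous_map_image_subset_topspace[OF cs]
      by (auto simp: config_at_zero_eq map_prod_def case_prod_unfold)
    show "fst (at_zero n z i) = z i" if "i \<in> {1..n}" for i and z :: "nat \<Rightarrow> 'a" using that by (simp add: at_zero_def)
  qed (use * cA prj in auto)
qed

text \<open>The slice is a copy of \<open>config_space n Y\<close>; planners there become planners
  in the thickened space by composition with \<open>at_zero\<close>, and their paths never leave the
  slice.\<close>

lemma relative_TC_config_le:
  assumes "(\<Union>k\<in>{..m}. U k) = topspace (prod_topology (config_space n Y) (config_space n Y))"
    and U: "\<And>k. openin (prod_topology (config_space n Y) (config_space n Y)) (U k)"
    and hom: "\<And>k. homotopic_with (\<lambda>_. True) (subtopology (prod_topology (config_space n Y) (config_space n Y)) (U k)) (config_space n Y) fst snd"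
  shows "relative_TC (config_space n (prod_topology Y unit_interval)) (config_at_zero n Y \<times> config_at_zero n Y) \<le> enat (m + 1)"
proof -
  let ?Z = "config_space n Y" and ?X = "config_space n (prod_topology Y unit_interval)"
  let ?ZZ = "prod_topology ?Z ?Z" and ?XX = "prod_topology ?X ?X"
  let ?B = "config_at_zero n Y"
  define \<pi> where "\<pi> x = (\<lambda>i\<in>{1..n}. fst (x i))" for x :: "nat \<Rightarrow> 'a \<times> real"
  have \<pi>_at: "\<pi> (at_zero n y) = y" if "y \<in> topspace ?Z" for y
    using that by (auto simp: \<pi>_def at_zero_def config_space_eq_partial topspace_partial_config_space fun_eq_iff PiE_iff extensional_def)
  have BX: "?B \<subseteq> topspace ?X"
    using continuous_map_image_subset_topspace[OF continuous_map_at_zero] by (simp add: config_at_zero_eq)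
  have at_\<pi>: "at_zero n (\<pi> x) = x" "\<pi> x \<in> topspace ?Z" if "x \<in> ?B" for x
    using that \<pi>_at by (auto simp: config_at_zero_eq)
  \<comment> \<open>Off the slice, points that differ only in height would be identified, so
    \<open>\<pi>\<close> is a map into configurations only after restriction to
    \<open>?B\<close>.\<close>
  have \<pi>c: "continuous_map (subtopology ?X ?B) ?Z \<pi>"
    unfolding config_space_eq_partial[of n Y] \<pi>_def[abs_def]
  proof (rule continuous_map_into_partial_config)
    fix i assume i: "i \<in> {1..n}"
    show "continuous_map (subtopology ?X ?B) Y (\<lambda>x. fst (x i))"
      using continuous_map_compose[OF continuous_map_partial_config_proj[OF i] continuous_map_fst]
      unfolding config_space_eq_partial by (intro continuous_map_from_subtopology) (simp add: o_def)
  next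
    fix x i j assume "x \<in> topspace (subtopology ?X ?B)" "i \<in> {1..n}" "j \<in> {1..n}" "i \<noteq> j"
    then have "\<pi> x \<in> topspace ?Z" using at_\<pi> by simp
    then have "\<pi> x i \<noteq> \<pi> x j" using \<open>i \<in> {1..n}\<close> \<open>j \<in> {1..n}\<close> \<open>i \<noteq> j\<close>
      by (auto simp: config_space_eq_partial topspace_partial_config_space)
    then show "fst (x i) \<noteq> fst (x j)" using \<open>i \<in> {1..n}\<close> \<open>j \<in> {1..n}\<close> by (simp add: \<pi>_def)
  qed
  define \<rho> where "\<rho> p = (\<pi> (fst p), \<pi> (snd p))" for p
  let ?S = "subtopology ?XX (?B \<times> ?B)"
  have \<rho>c: "continuous_map ?S ?ZZ \<rho>"
  proof -
    have "?S = prod_topology (subtopology ?X ?B) (subtopology ?X ?B)"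
      by (rule subtopology_Times)
    moreover have "continuous_map (prod_topology (subtopology ?X ?B) (subtopology ?X ?B)) ?ZZ \<rho>"
      unfolding \<rho>_def[abs_def]
      using continuous_map_compose[OF continuous_map_fst \<pi>c] continuous_map_compose[OF continuous_map_snd \<pi>c]
      by (intro continuous_map_pairedI) (simp_all add: o_def)
    ultimately show ?thesis by simp
  qed
  have tS: "topspace ?S = ?B \<times> ?B" using BX by auto
  define U' where "U' k = {p \<in> topspace ?S. \<rho> p \<in> U k}" for k
  have U'B: "U' k \<subseteq> ?B \<times> ?B" for k by (auto simp: U'_def tS)
  show ?thesis
  proof (rule relative_TC_le[where U=U'])
    show "(\<Union>k\<in>{..m}. U' k) = ?B \<times> ?B"
    proof -
      have "\<rho> p \<in> (\<Union>k\<in>{..m}. U k)" if "p \<in> ?B \<times> ?B" for p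
        unfolding assms(1) using that at_\<pi>(2) by (auto simp: \<rho>_def)
      then show ?thesis unfolding U'_def tS by blast
    qed
    show "?B \<times> ?B \<subseteq> topspace ?XX" using BX by auto
    show "openin ?S (U' k)" for k unfolding U'_def by (rule openin_continuous_map_preimage[OF \<rho>c U])
    fix k
    have "continuous_map (subtopology ?S (U' k)) ?ZZ \<rho>" using \<rho>c by (rule continuous_map_from_subtopology)
    moreover have "subtopology ?S (U' k) = subtopology ?XX (U' k)"
      using U'B by (simp add: subtopology_subtopology inf.absorb2)
    ultimately have "continuous_map (subtopology ?XX (U' k)) (subtopology ?ZZ (U k)) \<rho>"
      by (auto simp: continuous_map_in_subtopology U'_def)
    from homotopic_with_compose_continuous_map_right[OF hom this, of "\<lambda>_. True"]
    have "homotopic_with (\<lambda>_. True) (subtopology ?XX (U' k)) ?Z (fst \<circ> \<rho>) (snd \<circ> \<rho>)" by simp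
    from homotopic_with_compose_continuous_map_left[OF this continuous_map_at_zero, of "\<lambda>_. True"]
    have "homotopic_with (\<lambda>_. True) (subtopology ?XX (U' k)) ?X (at_zero n \<circ> (fst \<circ> \<rho>)) (at_zero n \<circ> (snd \<circ> \<rho>))" by simp
    then show "homotopic_with (\<lambda>_. True) (subtopology ?XX (U' k)) ?X fst snd"
    proof (rule homotopic_with_eq)
      fix p assume "p \<in> topspace (subtopology ?XX (U' k))"
      then have "p \<in> ?B \<times> ?B" using U'B[of k] by auto
      then have "fst p \<in> ?B" "snd p \<in> ?B" by auto
      then show "fst p = (at_zero n \<circ> (fst \<circ> \<rho>)) p" "snd p = (at_zero n \<circ> (snd \<circ> \<rho>)) p"
        by (simp_all add: \<rho>_def at_\<pi>)
    qed simp
  qed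
qed

section \<open>Path connectedness of configuration spaces\<close>

text \<open>Paths of configurations are replaced by moves of one token at a time. Moves are
  concatenated, reversed and carried over to larger sets of tokens combinatorially, and become paths
  only at the end. \<open>J\<close> is the set of active tokens; \<open>S\<close> has to avoid only
  these.\<close>

definition token_move :: "'a topology \<Rightarrow> nat set \<Rightarrow> 'a set \<Rightarrow> (nat \<Rightarrow> 'a) \<Rightarrow> (nat \<Rightarrow> 'a) \<Rightarrow> bool" where
  "token_move Y J U z z' \<longleftrightarrow> (\<exists>i\<in>J. \<exists>S. path_connectedin Y S \<and> z i \<in> S \<and> S \<subseteq> U \<and>
     S \<inter> z ` (J - {i}) = {} \<and> (\<exists>q\<in>S. z' = z(i := q)))"

abbreviation token_reach :: "'a topology \<Rightarrow> nat set \<Rightarrow> 'a set \<Rightarrow> (nat \<Rightarrow> 'a) \<Rightarrow> (nat \<Rightarrow> 'a) \<Rightarrow> bool" where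
  "token_reach Y J U \<equiv> (token_move Y J U)\<^sup>*\<^sup>*"

lemma token_moveI:
  assumes "i \<in> J" "path_connectedin Y S" "z i \<in> S" "q \<in> S" "S \<subseteq> U" "\<And>l. l \<in> J \<Longrightarrow> l \<noteq> i \<Longrightarrow> z l \<notin> S"
  shows "token_move Y J U z (z(i := q))"
  unfolding token_move_def
  by (rule bexI[OF _ assms(1)], rule exI[of _ S]) (use assms in blast)

lemma token_move_sym: assumes "token_move Y J U z z'" shows "token_move Y J U z' z"
proof -
  obtain i S q where *: "i \<in> J" "path_connectedin Y S" "z i \<in> S" "S \<subseteq> U" "S \<inter> z ` (J - {i}) = {}" "q \<in> S" "z' = z(i := q)"
    using assms unfolding token_move_def by blast
  have "token_move Y J U z' (z'(i := z i))"
    by (rule token_moveI[where S=S]) (use * in auto)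
  then show ?thesis using *(7) by simp
qed

lemma token_reach_sym: "token_reach Y J U z z' \<Longrightarrow> token_reach Y J U z' z"
proof (induction rule: rtranclp_induct)
  case (step y x)
  then show ?case
    using converse_rtranclp_into_rtranclp[of "token_move Y J U" x y z] token_move_sym[OF step(2)] by blast
qed simp

lemma token_move_inj: assumes "token_move Y J U z z'" "inj_on z J" shows "inj_on z' J"
proof -
  obtain i S q where *: "i \<in> J" "z i \<in> S" "S \<inter> z ` (J - {i}) = {}" "q \<in> S" "z' = z(i := q)"
    using assms(1) unfolding token_move_def by blast
  have "q \<notin> z ` (J - {i})" using * by blast
  moreover have "inj_on z (J - {i})" using assms(2) by (rule inj_on_subset) blast
  ultimately have "inj_on z' (insert i (J - {i}))" unfolding *(5) by (auto simp: inj_on_def)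
  then show ?thesis using *(1) by (simp add: insert_absorb)
qed

lemma token_reach_inj: "token_reach Y J U z z' \<Longrightarrow> inj_on z J \<Longrightarrow> inj_on z' J"
  by (induction rule: rtranclp_induct) (auto intro: token_move_inj)

lemma token_move_outside: "token_move Y J U z z' \<Longrightarrow> l \<notin> J \<Longrightarrow> z' l = z l"
  unfolding token_move_def by auto

lemma token_reach_outside: "token_reach Y J U z z' \<Longrightarrow> l \<notin> J \<Longrightarrow> z' l = z l"
  by (induction rule: rtranclp_induct) (auto dest: token_move_outside)

text \<open>Activating further tokens is harmless if they lie outside the region in which the motion
  takes place. This is how the induction ignores an outermost token.\<close>

lemma token_move_mono:
  assumes "token_move Y J' U' z z'" "J' \<subseteq> J" "U' \<subseteq> U" "\<And>l. l \<in> J - J' \<Longrightarrow> z l \<notin> U'"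
  shows "token_move Y J U z z'"
proof -
  obtain i S q where *: "i \<in> J'" "path_connectedin Y S" "z i \<in> S" "S \<subseteq> U'" "S \<inter> z ` (J' - {i}) = {}" "q \<in> S" "z' = z(i := q)"
    using assms(1) unfolding token_move_def by blast
  have "z l \<notin> S" if "l \<in> J" "l \<noteq> i" for l
  proof (cases "l \<in> J'")
    case True then show ?thesis using *(5) that by blast
  next
    case False then show ?thesis using assms(4)[of l] *(4) that by blast
  qed
  then show ?thesis unfolding *(7) using assms(2,3) * by (intro token_moveI[where S=S]) auto
qed

lemma token_reach_mono:
  assumes "token_reach Y J' U' z z'" "J' \<subseteq> J" "U' \<subseteq> U" "\<And>l. l \<in> J - J' \<Longrightarrow> z l \<notin> U'"
  shows "token_reach Y J U z z'"
  using assms(1)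
proof (induction rule: rtranclp_induct)
  case (step y x)
  have "y l \<notin> U'" if "l \<in> J - J'" for l using token_reach_outside[OF step(1), of l] assms(4)[OF that] that by simp
  then have "token_move Y J U y x" using token_move_mono[OF step(2) assms(2,3)] by blast
  then show ?case using step(3) by simp
qed simp

lemma config_space_path_component:
  assumes m: "token_move Y {1..n} (topspace Y) z z'" and z: "z \<in> topspace (config_space n Y)"
  shows "path_component_of (config_space n Y) z z'"
proof -
  obtain i S q where *: "i \<in> {1..n}" "path_connectedin Y S" "z i \<in> S" "S \<subseteq> topspace Y"
    "S \<inter> z ` ({1..n} - {i}) = {}" "q \<in> S" "z' = z(i := q)"
    using m unfolding token_move_def by blast
  obtain \<gamma> where \<gamma>: "pathin (subtopology Y S) \<gamma>" "\<gamma> 0 = z i" "\<gamma> 1 = q"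
  proof -
    have "topspace (subtopology Y S) = S" using *(4) by auto
    then show ?thesis using that *(2,3,6) unfolding path_connectedin_def path_connected_space_def by metis
  qed
  have \<gamma>c: "continuous_map unit_interval Y \<gamma>" and \<gamma>S: "\<gamma> t \<in> S" if "t \<in> {0..1}" for t
    using \<gamma>(1) that by (auto simp: pathin_def continuous_map_in_subtopology Pi_iff)
  have zP: "z \<in> {1..n} \<rightarrow>\<^sub>E topspace Y" "\<And>j l. j \<in> {1..n} \<Longrightarrow> l \<in> {1..n} \<Longrightarrow> j \<noteq> l \<Longrightarrow> z j \<noteq> z l"
    using z by (auto simp: config_space_eq_partial topspace_partial_config_space)
  define \<Gamma> where "\<Gamma> t = (\<lambda>j\<in>{1..n}. (if j = i then \<gamma> t else z j))" for t
  have "continuous_map unit_interval (config_space n Y) \<Gamma>"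
    unfolding config_space_eq_partial \<Gamma>_def[abs_def]
  proof (rule continuous_map_into_partial_config)
    fix j assume "j \<in> {1..n}"
    then show "continuous_map unit_interval Y (\<lambda>t. if j = i then \<gamma> t else z j)"
      using \<gamma>c[of 0] zP(1) by (cases "j = i") auto
  next
    fix t j l assume "t \<in> topspace unit_interval" "j \<in> {1..n}" "l \<in> {1..n}" "j \<noteq> l"
    show "(if j = i then \<gamma> t else z j) \<noteq> (if l = i then \<gamma> t else z l)"
    proof -
      have "\<gamma> t \<noteq> z m" if "m \<in> {1..n}" "m \<noteq> i" for m
        using \<gamma>S[of t] *(5) that \<open>t \<in> topspace unit_interval\<close> by auto
      then show ?thesis using zP(2) \<open>j \<in> {1..n}\<close> \<open>l \<in> {1..n}\<close> \<open>j \<noteq> l\<close> by metis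
    qed
  qed
  moreover have "\<Gamma> 0 = z" "\<Gamma> 1 = z'"
    using zP(1) *(1,7) \<gamma> by (auto simp: \<Gamma>_def fun_eq_iff PiE_iff extensional_def)
  ultimately show ?thesis unfolding path_component_of_def pathin_def by blast
qed

lemma token_reach_path_component:
  assumes "token_reach Y {1..n} (topspace Y) z z'" and z: "z \<in> topspace (config_space n Y)"
  shows "path_component_of (config_space n Y) z z'"
  using assms(1)
proof (induction rule: rtranclp_induct)
  case base
  then show ?case using z by (simp add: path_component_of_refl)
next
  case (step y x)
  then have "y \<in> topspace (config_space n Y)" using path_component_in_topspace by metis
  then show ?case using config_space_path_component[OF step(2)] step(3) path_component_of_trans by metis
qed

section \<open>Rearranging tokens in a triod\<close>

locale triod =
  fixes Y :: "'a topology" and c :: 'a and L :: "nat \<Rightarrow> real \<Rightarrow> 'a"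
  assumes leg_cont: "a < 3 \<Longrightarrow> continuous_map unit_interval Y (L a)"
    and leg_0: "a < 3 \<Longrightarrow> L a 0 = c"
    and leg_inj: "a < 3 \<Longrightarrow> b < 3 \<Longrightarrow> 0 < t \<Longrightarrow> t \<le> 1 \<Longrightarrow> 0 < s \<Longrightarrow> s \<le> 1 \<Longrightarrow> L a t = L b s \<longleftrightarrow> a = b \<and> t = s"
    and leg_ne: "a < 3 \<Longrightarrow> 0 < t \<Longrightarrow> t \<le> 1 \<Longrightarrow> L a t \<noteq> c"
    and leg_open: "a < 3 \<Longrightarrow> openin Y (L a ` {0<..<1})"
    and Hausdorff_Y: "Hausdorff_space Y"
    and path_connected_Y: "path_connected_space Y"
begin

text \<open>Tokens rest on the open legs and travel through \<open>tree\<close>, which also contains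
  the centre. Only the open legs have to be open in \<open>Y\<close>, so further branches at
  \<open>c\<close> are allowed.\<close>

definition legs :: "real \<Rightarrow> 'a set" where "legs \<epsilon> = (\<Union>a<3. L a ` {0<..<\<epsilon>})"

definition tree :: "real \<Rightarrow> 'a set" where "tree \<epsilon> = (\<Union>a<3. L a ` {0..<\<epsilon>})"

lemma leg_in: "a < 3 \<Longrightarrow> t \<in> {0..1} \<Longrightarrow> L a t \<in> topspace Y"
  using continuous_map_image_subset_topspace[OF leg_cont] by fastforce

lemma leg_path_connected:
  assumes "a < 3" "0 \<le> t" "s \<le> 1" shows "path_connectedin Y (L a ` {t..s})"
proof -
  have "path_connectedin unit_interval {t..s}" using assms by (auto simp: path_connectedin_subtopology)
  then show ?thesis by (rule path_connectedin_continuous_map_image[OF leg_cont[OF assms(1)]])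
qed

lemma two_legs_path_connected:
  assumes "a < 3" "b < 3" "0 \<le> t" "t \<le> 1" "0 \<le> s" "s \<le> 1"
  shows "path_connectedin Y (L a ` {0..t} \<union> L b ` {0..s})"
proof (rule path_connectedin_Un)
  have "c \<in> L a ` {0..t} \<inter> L b ` {0..s}" using assms leg_0 by (auto intro!: image_eqI[of c _ 0])
  then show "L a ` {0..t} \<inter> L b ` {0..s} \<noteq> {}" by blast
qed (use assms leg_path_connected in auto)

lemma leg_notin_image:
  assumes "a < 3" "b < 3" "0 < t" "t \<le> 1" "0 \<le> u" "v \<le> 1" "a \<noteq> b \<or> t < u \<or> v < t"
  shows "L a t \<notin> L b ` {u..v}"
proof
  assume "L a t \<in> L b ` {u..v}"
  then obtain s where s: "u \<le> s" "s \<le> v" "L a t = L b s" by auto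
  show False
  proof (cases "s = 0")
    case True then show ?thesis using leg_0[OF assms(2)] leg_ne[OF assms(1,3,4)] s by simp
  next
    case False
    then have "a = b \<and> t = s" using leg_inj[of a b t s] assms s by simp
    then show ?thesis using assms s by auto
  qed
qed

lemma leg_notin_tree: assumes "a < 3" "0 < s" "s \<le> 1" shows "L a s \<notin> tree s"
proof
  assume "L a s \<in> tree s"
  then obtain b t where bt: "b < 3" "0 \<le> t" "t < s" "L a s = L b t" by (auto simp: tree_def)
  then show False using leg_notin_image[of a b s t t] assms by auto
qed

lemma leg_image_tree: "a < 3 \<Longrightarrow> 0 \<le> u \<Longrightarrow> v < \<epsilon> \<Longrightarrow> L a ` {u..v} \<subseteq> tree \<epsilon>"
  unfolding tree_def by force

lemma tree_mono: "s \<le> \<epsilon> \<Longrightarrow> tree s \<subseteq> tree \<epsilon>" and legs_mono: "s \<le> \<epsilon> \<Longrightarrow> legs s \<subseteq> legs \<epsilon>"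
  unfolding tree_def legs_def by force+

lemma legsE: assumes "x \<in> legs \<epsilon>" obtains a t where "a < 3" "0 < t" "t < \<epsilon>" "x = L a t"
  using assms by (auto simp: legs_def)

lemma legsI: "a < 3 \<Longrightarrow> 0 < t \<Longrightarrow> t < \<epsilon> \<Longrightarrow> L a t \<in> legs \<epsilon>"
  unfolding legs_def by (rule UN_I[of a]) auto

lemma tree_subset: assumes "\<epsilon> \<le> 1" shows "tree \<epsilon> \<subseteq> topspace Y"
proof
  fix x assume "x \<in> tree \<epsilon>"
  then obtain a t where "a < 3" "0 \<le> t" "t < \<epsilon>" "x = L a t" by (auto simp: tree_def)
  then show "x \<in> topspace Y" using leg_in[of a t] assms by auto
qed

text \<open>The induction hypothesis for fewer than \<open>m\<close> tokens. The size
  \<open>s\<close> is quantified because the induction shrinks the triod.\<close>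

definition rearrangeable :: "nat \<Rightarrow> bool" where
  "rearrangeable m \<longleftrightarrow> (\<forall>J s z w. finite J \<longrightarrow> card J < m \<longrightarrow> 0 < s \<longrightarrow> s \<le> 1 \<longrightarrow> inj_on z J \<longrightarrow> inj_on w J \<longrightarrow>
     z ` J \<subseteq> legs s \<longrightarrow> w ` J \<subseteq> legs s \<longrightarrow> (\<forall>l. l \<notin> J \<longrightarrow> z l = w l) \<longrightarrow> token_reach Y J (tree s) z w)"

lemma rearrangeableD:
  assumes "rearrangeable m" "finite J" "card J < m" "0 < s" "s \<le> 1" "inj_on z J" "inj_on w J"
    "z ` J \<subseteq> legs s" "w ` J \<subseteq> legs s" "\<And>l. l \<notin> J \<Longrightarrow> z l = w l"
  shows "token_reach Y J (tree s) z w"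
  using assms(1)[unfolded rearrangeable_def, rule_format, of J s z w] assms(2-) by blast

text \<open>The induction hypothesis is applied in a smaller triod, which leaves out the outermost token.\<close>

lemma token_to_outermost:
  assumes IH: "rearrangeable (card J)"
    and J: "finite J" "N \<in> J" and \<epsilon>: "0 < \<epsilon>" "\<epsilon> \<le> 1"
    and z: "inj_on z J" "z ` J \<subseteq> legs \<epsilon>"
  obtains z' s where "token_reach Y J (tree \<epsilon>) z z'" "0 < s" "s < \<epsilon>" "z' N = L 0 s" "z' ` (J - {N}) \<subseteq> legs s"
proof -
  have "\<forall>l\<in>J. \<exists>a t. a < 3 \<and> 0 < t \<and> t < \<epsilon> \<and> z l = L a t"
  proof
    fix l assume "l \<in> J"
    then have "z l \<in> legs \<epsilon>" using z(2) by blast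
    then obtain a t where "a < 3" "0 < t" "t < \<epsilon>" "z l = L a t" by (rule legsE)
    then show "\<exists>a t. a < 3 \<and> 0 < t \<and> t < \<epsilon> \<and> z l = L a t" by blast
  qed
  then obtain a t where at: "\<And>l. l \<in> J \<Longrightarrow> a l < 3 \<and> 0 < t l \<and> t l < \<epsilon> \<and> z l = L (a l) (t l)" by metis
  have "Max (t ` J) \<in> t ` J" using J by (intro Max_in) auto
  then obtain j where j: "j \<in> J" "t j = Max (t ` J)" by auto
  have tmax: "t l \<le> t j" if "l \<in> J" for l using j(2) J that by simp
  \<comment> \<open>Room beyond all tokens: \<open>s1\<close> for the token \<open>j\<close> that is
    outermost at first, \<open>s2\<close> farther out for \<open>N\<close>.\<close>
  obtain s1 where s1: "t j < s1" "s1 < \<epsilon>" using at[OF j(1)] dense by blast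
  obtain s2 where s2: "s1 < s2" "s2 < \<epsilon>" using s1(2) dense by blast
  have s1pos: "0 < s1" "s1 \<le> 1" using at[OF j(1)] s1 \<epsilon> by auto
  define z1 where "z1 = z(j := L (a j) s1)"
  have aj: "a j < 3" using at j by blast
  have "token_move Y J (tree \<epsilon>) z z1" unfolding z1_def
  proof (rule token_moveI[OF j(1), where S="L (a j) ` {t j..s1}"])
    show "path_connectedin Y (L (a j) ` {t j..s1})" using leg_path_connected aj at[OF j(1)] s1pos by simp
    show "z j \<in> L (a j) ` {t j..s1}" "L (a j) s1 \<in> L (a j) ` {t j..s1}" using at[OF j(1)] s1 by auto
    show "L (a j) ` {t j..s1} \<subseteq> tree \<epsilon>" by (rule leg_image_tree) (use aj at[OF j(1)] s1 in auto)
    fix l assume l: "l \<in> J" "l \<noteq> j"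
    have "z l \<noteq> z j" using z(1) l j(1) by (meson inj_onD)
    then have "a l \<noteq> a j \<or> t l < t j" using at[OF l(1)] at[OF j(1)] tmax[OF l(1)] by force
    then show "z l \<notin> L (a j) ` {t j..s1}"
      using at[OF l(1)] at[OF j(1)] s1pos \<epsilon> leg_notin_image[of "a l" "a j" "t l" "t j" s1] by auto
  qed
  then have r1: "token_reach Y J (tree \<epsilon>) z z1" by blast
  have z1: "inj_on z1 J" using r1 z(1) token_reach_inj by blast
  have z1j: "z1 j = L (a j) s1" by (simp add: z1_def)
  have z1o: "z1 l \<in> legs s1" if "l \<in> J - {j}" for l
    using at[of l] that tmax[of l] s1(1) by (auto simp: z1_def intro!: legsI)
  \<comment> \<open>Distinct parking places below \<open>s1\<close>: \<open>N\<close> at a quarter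
    of \<open>s1\<close>, every other token beyond the half, depending on its number.\<close>
  define pos where "pos l = (if l = N then s1 / 4 else s1 / 2 + s1 / (2 * (real l + 2)))" for l
  have pos: "0 < pos l" "pos l < s1" for l
  proof -
    define d where "d = s1 / (2 * (real l + 2))"
    have "d \<le> s1 / 4" unfolding d_def by (rule divide_left_mono) (use s1pos in auto)
    moreover have "0 < d" using s1pos by (simp add: d_def)
    moreover have "pos l = (if l = N then s1 / 4 else s1 / 2 + d)" unfolding pos_def d_def ..
    ultimately show "0 < pos l" "pos l < s1" using s1pos by auto
  qed
  have posN: "pos N < pos l" if "l \<noteq> N" for l
  proof -
    define d where "d = s1 / (2 * (real l + 2))"
    have "0 < d" using s1pos by (simp add: d_def)
    moreover have "pos l = s1 / 2 + d" using that unfolding pos_def d_def by simp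
    ultimately show ?thesis using s1pos by (simp add: pos_def)
  qed
  have pos_inj: "pos l \<noteq> pos k" if "l \<noteq> k" for l k
  proof (cases "l = N \<or> k = N")
    case True then show ?thesis using posN[of l] posN[of k] that by auto
  next
    case False
    then show ?thesis using that s1pos by (simp add: pos_def frac_eq_eq)
  qed
  \<comment> \<open>Token \<open>j\<close> sits at distance \<open>s1\<close>, outside
    \<open>tree s1\<close>, so the induction hypothesis applies to the others and moves them to leg
    \<open>b\<close>.\<close>
  have park: "token_reach Y J (tree \<epsilon>) z1 (\<lambda>l. if l \<in> J - {j} then L b (pos l) else z1 l)" if b: "b < 3" for b
  proof (rule token_reach_mono[where J'="J - {j}" and U'="tree s1"])
    show "token_reach Y (J - {j}) (tree s1) z1 (\<lambda>l. if l \<in> J - {j} then L b (pos l) else z1 l)"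
    proof (rule rearrangeableD[OF IH])
      show "card (J - {j}) < card J" using J(1) j(1) by (rule card_Diff1_less)
      show "inj_on z1 (J - {j})" using z1 by (rule inj_on_subset) blast
      show "inj_on (\<lambda>l. if l \<in> J - {j} then L b (pos l) else z1 l) (J - {j})"
      proof (rule inj_onI)
        fix l k assume "l \<in> J - {j}" "k \<in> J - {j}"
          "(if l \<in> J - {j} then L b (pos l) else z1 l) = (if k \<in> J - {j} then L b (pos k) else z1 k)"
        then have "L b (pos l) = L b (pos k)" by simp
        then have "pos l = pos k" using leg_inj[OF b b] pos s1pos by (meson less_le_trans less_imp_le)
        then show "l = k" using pos_inj by blast
      qed
      show "(\<lambda>l. if l \<in> J - {j} then L b (pos l) else z1 l) ` (J - {j}) \<subseteq> legs s1"
        using pos b by (auto intro: legsI)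
    qed (use J s1pos z1o in auto)
    show "tree s1 \<subseteq> tree \<epsilon>" using s1 by (intro tree_mono) simp
    fix l assume "l \<in> J - (J - {j})"
    then show "z1 l \<notin> tree s1" using z1j leg_notin_tree[OF aj s1pos] by auto
  qed blast
  show ?thesis
  proof (cases "j = N")
    case jN: True
    show ?thesis
    proof (cases "a j = 0")
      case True
      show ?thesis
        by (rule that[OF r1 s1pos(1) s1(2)]) (use z1j z1o True jN in auto)
    next
      case False
      \<comment> \<open>\<open>j\<close> is on leg 1 or 2; \<open>b\<close> is the other of the two,
        so that leg 0 becomes free.\<close>
      define b where "b = 3 - a j"
      have b: "b < 3" "b \<noteq> 0" "b \<noteq> a j" using False aj unfolding b_def by auto presburger
      define z2 where "z2 = (\<lambda>l. if l \<in> J - {j} then L b (pos l) else z1 l)"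
      have r2: "token_reach Y J (tree \<epsilon>) z1 z2" unfolding z2_def by (rule park[OF b(1)])
      have "token_move Y J (tree \<epsilon>) z2 (z2(j := L 0 s1))"
      proof (rule token_moveI[OF j(1), where S="L (a j) ` {0..s1} \<union> L 0 ` {0..s1}"])
        show "path_connectedin Y (L (a j) ` {0..s1} \<union> L 0 ` {0..s1})"
          using two_legs_path_connected aj s1pos by simp
        show "z2 j \<in> L (a j) ` {0..s1} \<union> L 0 ` {0..s1}" using z1j s1pos by (auto simp: z2_def)
        show "L 0 s1 \<in> L (a j) ` {0..s1} \<union> L 0 ` {0..s1}" using s1pos by auto
        show "L (a j) ` {0..s1} \<union> L 0 ` {0..s1} \<subseteq> tree \<epsilon>"
          using leg_image_tree[of "a j" 0 s1 \<epsilon>] leg_image_tree[of 0 0 s1 \<epsilon>] aj s1 by auto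
        fix l assume "l \<in> J" "l \<noteq> j"
        then have "z2 l = L b (pos l)" by (simp add: z2_def)
        then show "z2 l \<notin> L (a j) ` {0..s1} \<union> L 0 ` {0..s1}"
          using leg_notin_image[of b "a j" "pos l" 0 s1] leg_notin_image[of b 0 "pos l" 0 s1] b aj pos[of l] s1pos by auto
      qed
      then have r3: "token_reach Y J (tree \<epsilon>) z (z2(j := L 0 s1))" using r1 r2 by auto
      show ?thesis
      proof (rule that[OF r3 s1pos(1) s1(2)])
        show "(z2(j := L 0 s1)) N = L 0 s1" using jN by simp
        show "(z2(j := L 0 s1)) ` (J - {N}) \<subseteq> legs s1" using jN pos b by (auto simp: z2_def intro!: legsI)
      qed
    qed
  next
    case jN: False
    text \<open>All tokens but \<open>j\<close> are parked on leg \<open>b\<close> with \<open>N\<close> innermost, and \<open>j\<close> sits at the end of leg \<open>a'\<close>,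
      so that leg \<open>0\<close> is empty.\<close>
    obtain z2 b a' where z2: "token_reach Y J (tree \<epsilon>) z1 z2" and ba: "b < 3" "a' < 3" "b \<noteq> 0" "a' \<noteq> 0" "a' \<noteq> b"
      and z2l: "\<And>l. l \<in> J - {j} \<Longrightarrow> z2 l = L b (pos l)" and z2j: "z2 j = L a' s1"
    proof (cases "a j = 0")
      case False
      define b where "b = 3 - a j"
      have b: "b < 3" "b \<noteq> 0" "b \<noteq> a j" using False aj unfolding b_def by auto presburger
      show ?thesis by (rule that[OF park[OF b(1)] b(1) aj b(2) False]) (use b z1j in auto)
    next
      case True
      define z2 where "z2 = (\<lambda>l. if l \<in> J - {j} then L 1 (pos l) else z1 l)"
      have r2: "token_reach Y J (tree \<epsilon>) z1 z2" unfolding z2_def by (rule park) simp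
      have "token_move Y J (tree \<epsilon>) z2 (z2(j := L 2 s1))"
      proof (rule token_moveI[OF j(1), where S="L 0 ` {0..s1} \<union> L 2 ` {0..s1}"])
        show "path_connectedin Y (L 0 ` {0..s1} \<union> L 2 ` {0..s1})"
          using two_legs_path_connected s1pos by simp
        show "z2 j \<in> L 0 ` {0..s1} \<union> L 2 ` {0..s1}" using z1j s1pos True by (auto simp: z2_def)
        show "L 2 s1 \<in> L 0 ` {0..s1} \<union> L 2 ` {0..s1}" using s1pos by auto
        show "L 0 ` {0..s1} \<union> L 2 ` {0..s1} \<subseteq> tree \<epsilon>"
          using leg_image_tree[of 2 0 s1 \<epsilon>] leg_image_tree[of 0 0 s1 \<epsilon>] s1 by auto
        fix l assume "l \<in> J" "l \<noteq> j"
        then have "z2 l = L 1 (pos l)" by (simp add: z2_def)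
        then show "z2 l \<notin> L 0 ` {0..s1} \<union> L 2 ` {0..s1}"
          using leg_notin_image[of 1 2 "pos l" 0 s1] leg_notin_image[of 1 0 "pos l" 0 s1] pos[of l] s1pos by auto
      qed
      then have r3: "token_reach Y J (tree \<epsilon>) z1 (z2(j := L 2 s1))" using r2 by auto
      show ?thesis by (rule that[OF r3, of 1 2]) (auto simp: z2_def)
    qed
    have NJ: "N \<in> J - {j}" using J(2) jN by blast
    \<comment> \<open>\<open>N\<close> is the innermost token on leg \<open>b\<close>, so the way
      through the centre onto leg 0 is free.\<close>
    have "token_move Y J (tree \<epsilon>) z2 (z2(N := L 0 s2))"
    proof (rule token_moveI[OF J(2), where S="L b ` {0..pos N} \<union> L 0 ` {0..s2}"])
      show "path_connectedin Y (L b ` {0..pos N} \<union> L 0 ` {0..s2})"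
        using two_legs_path_connected[of b 0 "pos N" s2] ba pos[of N] s1pos s2 \<epsilon> by simp
      show "z2 N \<in> L b ` {0..pos N} \<union> L 0 ` {0..s2}" using z2l[OF NJ] pos[of N] by auto
      show "L 0 s2 \<in> L b ` {0..pos N} \<union> L 0 ` {0..s2}" using s1pos s2 by auto
      show "L b ` {0..pos N} \<union> L 0 ` {0..s2} \<subseteq> tree \<epsilon>"
        using leg_image_tree[of b 0 "pos N" \<epsilon>] leg_image_tree[of 0 0 s2 \<epsilon>] ba pos[of N] s1 s2 by auto
      fix l assume l: "l \<in> J" "l \<noteq> N"
      show "z2 l \<notin> L b ` {0..pos N} \<union> L 0 ` {0..s2}"
      proof (cases "l = j")
        case True
        then show ?thesis using z2j ba leg_notin_image[of a' b s1 0 "pos N"] leg_notin_image[of a' 0 s1 0 s2]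
          s1pos s2 \<epsilon> pos[of N] by auto
      next
        case False
        then have "z2 l = L b (pos l)" using z2l l by blast
        then show ?thesis using ba leg_notin_image[of b b "pos l" 0 "pos N"] leg_notin_image[of b 0 "pos l" 0 s2]
          posN[OF l(2)] s1pos s2 \<epsilon> pos[of N] pos[of l] by auto
      qed
    qed
    then have r3: "token_reach Y J (tree \<epsilon>) z (z2(N := L 0 s2))" using r1 z2 by auto
    have "(z2(N := L 0 s2)) l \<in> legs s2" if l: "l \<in> J - {N}" for l
    proof (cases "l = j")
      case True
      then show ?thesis using jN z2j ba s1pos s2 by (auto intro!: legsI)
    next
      case False
      then show ?thesis using l z2l[of l] ba pos[of l] s2 by (auto intro!: legsI)
    qed
    then show ?thesis using that[OF r3, of s2] s1pos s2 by auto
  qed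
qed

text \<open>Bring one token \<open>N\<close> to the same outermost place in both arrangements; what
  remains is the problem with one token less in a smaller triod. Reversibility of moves joins the
  two halves.\<close>

lemma rearrange_in_triod:
  assumes "finite J" "0 < \<epsilon>" "\<epsilon> \<le> 1" "inj_on z J" "inj_on w J" "z ` J \<subseteq> legs \<epsilon>" "w ` J \<subseteq> legs \<epsilon>"
    "\<And>l. l \<notin> J \<Longrightarrow> z l = w l"
  shows "token_reach Y J (tree \<epsilon>) z w"
  using assms
proof (induction "card J" arbitrary: J \<epsilon> z w rule: less_induct)
  case less
  have IH: "rearrangeable (card J)"
    unfolding rearrangeable_def
  proof (intro allI impI)
    fix J' :: "nat set" and s x y
    assume "finite J'" "card J' < card J" "0 < s" "s \<le> 1" "inj_on x J'" "inj_on y J'"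
      "x ` J' \<subseteq> legs s" "y ` J' \<subseteq> legs s" "\<forall>l. l \<notin> J' \<longrightarrow> x l = y l"
    then show "token_reach Y J' (tree s) x y" using less.hyps[of J' s x y] by blast
  qed
  show ?case
  proof (cases "J = {}")
    case True
    then have "z = w" using less.prems(8) by blast
    then show ?thesis by simp
  next
    case False
    then obtain N where N: "N \<in> J" by blast
    obtain z1 s where z1: "token_reach Y J (tree \<epsilon>) z z1" "0 < s" "s < \<epsilon>" "z1 N = L 0 s" "z1 ` (J - {N}) \<subseteq> legs s"
      using token_to_outermost[OF IH less.prems(1) N less.prems(2,3,4,6)] by blast
    obtain w1 u where w1: "token_reach Y J (tree \<epsilon>) w w1" "0 < u" "u < \<epsilon>" "w1 N = L 0 u" "w1 ` (J - {N}) \<subseteq> legs u"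
      using token_to_outermost[OF IH less.prems(1) N less.prems(2,3,5,7)] by blast
    \<comment> \<open>The larger of the two distances, reached by sliding \<open>N\<close> outwards
      on leg 0, where nothing lies beyond it.\<close>
    define m where "m = max s u"
    have m: "s \<le> m" "u \<le> m" "m < \<epsilon>" "0 < m" "m \<le> 1" using z1 w1 less.prems by (auto simp: m_def)
    have slide: "token_reach Y J (tree \<epsilon>) x (x(N := L 0 m))"
      if x: "x N = L 0 r" "x ` (J - {N}) \<subseteq> legs r" "0 < r" "r \<le> m" for x r
    proof -
      have "token_move Y J (tree \<epsilon>) x (x(N := L 0 m))"
      proof (rule token_moveI[OF N, where S="L 0 ` {r..m}"])
        show "path_connectedin Y (L 0 ` {r..m})" using leg_path_connected x m by simp
        show "x N \<in> L 0 ` {r..m}" "L 0 m \<in> L 0 ` {r..m}" using x by auto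
        show "L 0 ` {r..m} \<subseteq> tree \<epsilon>" by (rule leg_image_tree) (use x m in auto)
        fix l assume "l \<in> J" "l \<noteq> N"
        then have "x l \<in> legs r" using x(2) by blast
        then obtain a t where "a < 3" "0 < t" "t < r" "x l = L a t" by (rule legsE)
        then show "x l \<notin> L 0 ` {r..m}" using leg_notin_image[of a 0 t r m] x m by auto
      qed
      then show ?thesis by blast
    qed
    define z2 where "z2 = z1(N := L 0 m)"
    define w2 where "w2 = w1(N := L 0 m)"
    have rz: "token_reach Y J (tree \<epsilon>) z z2" using z1(1) slide[OF z1(4,5,2) m(1)] unfolding z2_def by (rule rtranclp_trans)
    have rw: "token_reach Y J (tree \<epsilon>) w w2" using w1(1) slide[OF w1(4,5,2) m(2)] unfolding w2_def by (rule rtranclp_trans)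
    have "token_reach Y J (tree \<epsilon>) z2 w2"
    proof (rule token_reach_mono[where J'="J - {N}" and U'="tree m"])
      show "token_reach Y (J - {N}) (tree m) z2 w2"
      proof (rule rearrangeableD[OF IH])
        show "card (J - {N}) < card J" using less.prems(1) N by (rule card_Diff1_less)
        have "inj_on z2 J" "inj_on w2 J"
          by (rule token_reach_inj[OF rz less.prems(4)], rule token_reach_inj[OF rw less.prems(5)])
        then show "inj_on z2 (J - {N})" "inj_on w2 (J - {N})" by (auto intro: inj_on_subset)
        show "z2 ` (J - {N}) \<subseteq> legs m" "w2 ` (J - {N}) \<subseteq> legs m"
          using z1(5) w1(5) legs_mono[OF m(1)] legs_mono[OF m(2)] by (auto simp: z2_def w2_def)
        fix l assume "l \<notin> J - {N}"
        then show "z2 l = w2 l"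
          using token_reach_outside[OF z1(1), of l] token_reach_outside[OF w1(1), of l] less.prems(8)[of l]
          by (cases "l = N") (auto simp: z2_def w2_def)
      qed (use less.prems m in auto)
      show "tree m \<subseteq> tree \<epsilon>" using m by (intro tree_mono) simp
      fix l assume "l \<in> J - (J - {N})"
      then show "z2 l \<notin> tree m" using leg_notin_tree[of 0 m] m by (auto simp: z2_def)
    qed blast
    then show ?thesis using rz token_reach_sym[OF rw] by (meson rtranclp_trans)
  qed
qed

section \<open>Gathering all tokens on the legs\<close>

lemma closedin_finite: "finite F \<Longrightarrow> F \<subseteq> topspace Y \<Longrightarrow> closedin Y F"
  using Hausdorff_Y by (meson Hausdorff_imp_t1_space t1_space_closedin_finite)

lemma avoid_finite:
  assumes \<gamma>: "continuous_map unit_interval Y \<gamma>" and F: "finite F" and t: "t \<in> {0..1}" "\<gamma> t \<notin> F"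
  obtains \<delta> where "0 < \<delta>" "\<And>s. s \<in> {0..1} \<Longrightarrow> \<bar>s - t\<bar> < \<delta> \<Longrightarrow> \<gamma> s \<notin> F"
proof -
  have "closedin Y (F \<inter> topspace Y)" by (rule closedin_finite) (use F in auto)
  then have "openin unit_interval {s \<in> topspace unit_interval. \<gamma> s \<in> topspace Y - F \<inter> topspace Y}"
    by (intro openin_continuous_map_preimage[OF \<gamma>]) auto
  moreover have "t \<in> {s \<in> topspace unit_interval. \<gamma> s \<in> topspace Y - F \<inter> topspace Y}"
    using continuous_map_image_subset_topspace[OF \<gamma>] t by auto
  ultimately obtain \<delta> where "0 < \<delta>" "ball t \<delta> \<inter> {0..1} \<subseteq> {s \<in> topspace unit_interval. \<gamma> s \<in> topspace Y - F \<inter> topspace Y}"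
    unfolding openin_contains_ball by blast
  moreover have "\<gamma> s \<notin> F" if "s \<in> {0..1}" "\<bar>s - t\<bar> < \<delta>" for s
  proof -
    have "s \<in> ball t \<delta> \<inter> {0..1}" using that by (simp add: dist_real_def abs_minus_commute)
    then have "\<gamma> s \<in> topspace Y - F \<inter> topspace Y" using \<open>ball t \<delta> \<inter> {0..1} \<subseteq> _\<close> by blast
    then show ?thesis by blast
  qed
  ultimately show ?thesis using that by blast
qed

text \<open>A path from an outside token to the centre is followed until it first meets the centre
  or the end of a leg. The token that moves is the last outside token on this stretch, which need
  not be \<open>i\<close>, so no other token blocks it.\<close>

lemma gather_one:
  assumes J: "finite J" and z: "inj_on z J" "z ` J \<subseteq> topspace Y" and out: "i \<in> J" "z i \<notin> legs 1"
  obtains z' where "token_reach Y J (topspace Y) z z'"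
    "card {l \<in> J. z' l \<notin> legs 1} < card {l \<in> J. z l \<notin> legs 1}"
proof -
  \<comment> \<open>The legs are open and together with \<open>F\<close> closed, so a path that
    starts off the legs cannot enter them before meeting \<open>F\<close>.\<close>
  define F where "F = insert c ((\<lambda>a. L a 1) ` {..<3})"
  define B where "B = z ` {l \<in> J. z l \<notin> legs 1}"
  have fin: "finite F" "finite B" using J by (auto simp: F_def B_def)
  have F_legs: "F \<inter> legs 1 = {}"
  proof -
    have "L a 1 \<notin> legs 1" if a: "a < 3" for a
    proof
      assume "L a 1 \<in> legs 1"
      then obtain b t where b: "b < 3" "0 < t" "t < 1" "L a 1 = L b t" by (rule legsE)
      then show False using leg_inj[OF a b(1), of 1 t] by simp
    qed
    moreover have "c \<notin> legs 1"
    proof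
      assume "c \<in> legs 1"
      then obtain b t where b: "b < 3" "0 < t" "t < 1" "c = L b t" by (rule legsE)
      then show False using leg_ne[OF b(1), of t] by simp
    qed
    ultimately show ?thesis by (auto simp: F_def)
  qed
  have cY: "c \<in> topspace Y" using leg_in[of 0 0] leg_0[of 0] by simp
  have FY: "F \<subseteq> topspace Y" using cY leg_in by (auto simp: F_def)
  have BY: "B \<subseteq> topspace Y" using z(2) by (auto simp: B_def)
  obtain P where "pathin Y P" "P 0 = z i" "P 1 = c"
    using path_connected_Y z(2) out(1) cY unfolding path_connected_space_def by blast
  then have P: "continuous_map unit_interval Y P" "P 0 = z i" "P 1 = c" by (auto simp: pathin_def)
  have pre_closed: "compact {t \<in> {u..v}. P t \<in> S}" if "closedin Y S" "0 \<le> u" "v \<le> 1" for S u v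
  proof -
    have "closedin unit_interval {t \<in> topspace unit_interval. P t \<in> S}"
      by (rule closedin_continuous_map_preimage[OF P(1) that(1)])
    then have "closed {t \<in> {0..1}. P t \<in> S}" by (simp add: closedin_closed_eq)
    moreover have "{t \<in> {u..v}. P t \<in> S} = {u..v} \<inter> {t \<in> {0..1}. P t \<in> S}" using that by auto
    ultimately show ?thesis by (simp add: compact_Int_closed)
  qed
  have cF: "compact {t \<in> {0..1}. P t \<in> F}" by (rule pre_closed) (use closedin_finite fin FY in auto)
  moreover have "{t \<in> {0..1}. P t \<in> F} \<noteq> {}" using P(3) by (auto simp: F_def intro!: exI[of _ 1])
  ultimately obtain t0 where t0: "t0 \<in> {0..1}" "P t0 \<in> F" "\<And>t. t \<in> {0..1} \<Longrightarrow> P t \<in> F \<Longrightarrow> t0 \<le> t"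
    using compact_attains_inf[OF cF] by blast
  have openlegs: "openin Y (legs 1)" unfolding legs_def using leg_open by blast
  have closed_tree: "closedin Y (F \<union> legs 1)"
  proof -
    have "compactin Y (L a ` {0..1})" if "a < 3" for a
      by (rule image_compactin[OF _ leg_cont[OF that]]) (simp add: compactin_subtopology)
    then have "closedin Y (\<Union>a<3. L a ` {0..1})"
      using Hausdorff_Y by (intro closedin_Union) (auto intro: compactin_imp_closedin)
    moreover have "(\<Union>a<3. L a ` {0..1}) = F \<union> legs 1"
    proof -
      have "L a ` {0..1} = insert c (insert (L a 1) (L a ` {0<..<1}))" if "a < 3" for a
      proof -
        have "{0..1::real} = insert 0 (insert 1 {0<..<1})" by auto
        then show ?thesis using leg_0[OF that] by (metis image_insert)
      qed
      then have "(\<Union>a<3. L a ` {0..1}) = (\<Union>a<3. insert c (insert (L a 1) (L a ` {0<..<1})))" by simp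
      also have "\<dots> = F \<union> legs 1"
      proof -
        have "{..<3::nat} \<noteq> {}" by (simp add: lessThan_empty_iff)
        then show ?thesis unfolding F_def legs_def by blast
      qed
      finally show ?thesis .
    qed
    ultimately show ?thesis by simp
  qed
  have notO: "P t \<notin> legs 1" if t: "t \<in> {0..t0}" for t
  proof (cases "t = t0")
    case True then show ?thesis using t0 F_legs by blast
  next
    case False
    then have tl: "0 \<le> t" "t < t0" "t \<le> 1" using t t0 by auto
    show ?thesis
    proof
      assume Pt: "P t \<in> legs 1"
      have eq: "{s \<in> {0..t}. P s \<in> legs 1} = {s \<in> {0..t}. P s \<in> F \<union> legs 1}"
        using t0(3) tl by force
      have "closed {s \<in> {0..t}. P s \<in> legs 1}"
        unfolding eq by (intro compact_imp_closed pre_closed[OF closed_tree]) (use tl in auto)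
      moreover have "closed {s \<in> {0..t}. P s \<in> topspace Y - legs 1}"
        by (intro compact_imp_closed pre_closed) (use tl openlegs in auto)
      moreover have "P s \<in> topspace Y" if "s \<in> {0..t}" for s
        using continuous_map_image_subset_topspace[OF P(1)] that tl by auto
      then have "{0..t} \<subseteq> {s \<in> {0..t}. P s \<in> legs 1} \<union> {s \<in> {0..t}. P s \<in> topspace Y - legs 1}" by blast
      moreover have "t \<in> {s \<in> {0..t}. P s \<in> legs 1}" "0 \<in> {s \<in> {0..t}. P s \<in> topspace Y - legs 1}"
        using Pt tl P(2) out z(2) by auto
      ultimately show False
        using connected_closedD[OF connected_Icc[of 0 t], of "{s \<in> {0..t}. P s \<in> legs 1}" "{s \<in> {0..t}. P s \<in> topspace Y - legs 1}"]
        by blast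
    qed
  qed
  have cB: "compact {t \<in> {0..t0}. P t \<in> B}" by (rule pre_closed) (use closedin_finite fin BY t0 in auto)
  moreover have "0 \<in> {t \<in> {0..t0}. P t \<in> B}" using P(2) out t0(1) by (auto simp: B_def)
  \<comment> \<open>The last time up to \<open>t0\<close> at which the path is at an outside token.
    Tokens on the legs are not met by \<open>notO\<close>.\<close>
  ultimately obtain t1 where t1: "t1 \<in> {0..t0}" "P t1 \<in> B" "\<And>t. t \<in> {0..t0} \<Longrightarrow> P t \<in> B \<Longrightarrow> t \<le> t1"
    using compact_attains_sup[OF cB] by blast
  obtain j where j: "j \<in> J" "z j \<notin> legs 1" "P t1 = z j" using t1(2) by (auto simp: B_def)
  have free: "z l \<notin> P ` {t1..t0}" if l: "l \<in> J" "l \<noteq> j" for l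
  proof
    assume "z l \<in> P ` {t1..t0}"
    then obtain t where t: "t1 \<le> t" "t \<le> t0" "z l = P t" by auto
    then have t': "t \<in> {0..t0}" using t1 by auto
    have "z l \<notin> legs 1" using notO[OF t'] t by simp
    then have "z l \<in> B" unfolding B_def using l by blast
    then have "P t \<in> B" using t(3) by simp
    then have "t = t1" using t1(3)[OF t'] t by simp
    then have "z l = z j" using t j by simp
    then show False using z(1) l j(1) by (meson inj_onD)
  qed
  \<comment> \<open>From \<open>P t0\<close> a short piece of a leg leads onto the open legs; it can
    avoid the other tokens because they are finitely many and none is at
    \<open>P t0\<close>.\<close>
  have "\<exists>S q. path_connectedin Y S \<and> P t0 \<in> S \<and> q \<in> S \<and> q \<in> legs 1 \<and> (\<forall>l\<in>J - {j}. z l \<notin> S)"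
  proof -
    have q0: "P t0 \<notin> z ` (J - {j})"
    proof
      assume "P t0 \<in> z ` (J - {j})"
      then obtain l where "P t0 = z l" "l \<in> J - {j}" by (rule imageE)
      then have "l \<in> J" "l \<noteq> j" "z l = P t0" by simp_all
      moreover have "P t0 \<in> P ` {t1..t0}" using t1(1) by auto
      ultimately show False using free by metis
    qed
    have fJ: "finite (z ` (J - {j}))" using J by simp
    from t0(2) consider "P t0 = c" | a where "a < 3" "P t0 = L a 1" by (auto simp: F_def)
    then show ?thesis
    proof cases
      case 1
      then have "L 0 0 \<notin> z ` (J - {j})" using q0 leg_0[of 0] by simp
      then obtain \<delta> where \<delta>: "0 < \<delta>" "\<And>s. s \<in> {0..1} \<Longrightarrow> \<bar>s - 0\<bar> < \<delta> \<Longrightarrow> L 0 s \<notin> z ` (J - {j})"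
        using avoid_finite[OF leg_cont[of 0] fJ, of 0] by auto
      define e where "e = min \<delta> 1 / 2"
      have e: "0 < e" "e < \<delta>" "e < 1" using \<delta>(1) by (auto simp: e_def)
      have "z l \<notin> L 0 ` {0..e}" if "l \<in> J - {j}" for l
      proof
        assume "z l \<in> L 0 ` {0..e}"
        then obtain s where s: "s \<in> {0..e}" "z l = L 0 s" by auto
        then have "L 0 s \<notin> z ` (J - {j})" by (intro \<delta>(2)) (use e in auto)
        then show False using s(2) imageI[OF that, of z] by simp
      qed
      moreover have "path_connectedin Y (L 0 ` {0..e})" using leg_path_connected e by simp
      moreover have "P t0 \<in> L 0 ` {0..e}" using 1 leg_0[of 0] e by (auto intro!: image_eqI[of _ _ 0])
      moreover have "L 0 e \<in> L 0 ` {0..e}" "L 0 e \<in> legs 1" using e legsI[of 0 e 1] by auto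
      ultimately show ?thesis by blast
    next
      case (2 a)
      then have "L a 1 \<notin> z ` (J - {j})" using q0 by simp
      then obtain \<delta> where \<delta>: "0 < \<delta>" "\<And>s. s \<in> {0..1} \<Longrightarrow> \<bar>s - 1\<bar> < \<delta> \<Longrightarrow> L a s \<notin> z ` (J - {j})"
        using avoid_finite[OF leg_cont[OF 2(1)] fJ, of 1] by auto
      define e where "e = 1 - min \<delta> 1 / 2"
      have e: "0 < e" "1 - \<delta> < e" "e < 1" using \<delta>(1) by (auto simp: e_def)
      have "z l \<notin> L a ` {e..1}" if "l \<in> J - {j}" for l
      proof
        assume "z l \<in> L a ` {e..1}"
        then obtain s where s: "s \<in> {e..1}" "z l = L a s" by auto
        then have "L a s \<notin> z ` (J - {j})" by (intro \<delta>(2)) (use e in auto)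
        then show False using s(2) imageI[OF that, of z] by simp
      qed
      moreover have "path_connectedin Y (L a ` {e..1})" using leg_path_connected 2 e by simp
      moreover have "P t0 \<in> L a ` {e..1}" using 2 e by auto
      moreover have "L a e \<in> L a ` {e..1}" "L a e \<in> legs 1" using e legsI[of a e 1] 2 by auto
      ultimately show ?thesis by blast
    qed
  qed
  then obtain S q where S: "path_connectedin Y S" "P t0 \<in> S" "q \<in> S" "q \<in> legs 1" "\<And>l. l \<in> J - {j} \<Longrightarrow> z l \<notin> S" by blast
  have t10: "0 \<le> t1" "t1 \<le> t0" "t0 \<le> 1" using t1 t0 by auto
  have Pin: "P t0 \<in> P ` {t1..t0}" "z j \<in> P ` {t1..t0}" using t10 j(3)[symmetric] by auto
  have "path_connectedin unit_interval {t1..t0}" using t10 by (auto simp: path_connectedin_subtopology)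
  then have "path_connectedin Y (P ` {t1..t0})" by (rule path_connectedin_continuous_map_image[OF P(1)])
  then have pc: "path_connectedin Y (P ` {t1..t0} \<union> S)"
    by (rule path_connectedin_Un[OF _ S(1)]) (use S(2) Pin(1) in blast)
  have "token_move Y J (topspace Y) z (z(j := q))"
    by (rule token_moveI[OF j(1) pc]) (use Pin S free path_connectedin_subset_topspace[OF pc] in auto)
  moreover have "{l \<in> J. (z(j := q)) l \<notin> legs 1} \<subset> {l \<in> J. z l \<notin> legs 1}" using S(4) j by auto
  then have "card {l \<in> J. (z(j := q)) l \<notin> legs 1} < card {l \<in> J. z l \<notin> legs 1}"
    using J by (intro psubset_card_mono) auto
  ultimately show ?thesis using that by blast
qed

lemma token_move_in: "token_move Y J (topspace Y) z z' \<Longrightarrow> z ` J \<subseteq> topspace Y \<Longrightarrow> z' ` J \<subseteq> topspace Y"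
  unfolding token_move_def by (auto simp: image_subset_iff)

lemma token_reach_in: "token_reach Y J (topspace Y) z z' \<Longrightarrow> z ` J \<subseteq> topspace Y \<Longrightarrow> z' ` J \<subseteq> topspace Y"
  by (induction rule: rtranclp_induct) (simp, metis token_move_in)

lemma gather:
  assumes "finite J" "inj_on z J" "z ` J \<subseteq> topspace Y"
  shows "\<exists>z'. token_reach Y J (topspace Y) z z' \<and> z' ` J \<subseteq> legs 1"
  using assms
proof (induction "card {l \<in> J. z l \<notin> legs 1}" arbitrary: z rule: less_induct)
  case less
  show ?case
  proof (cases "z ` J \<subseteq> legs 1")
    case False
    then obtain i where "i \<in> J" "z i \<notin> legs 1" by blast
    then obtain z1 where z1: "token_reach Y J (topspace Y) z z1"
      "card {l \<in> J. z1 l \<notin> legs 1} < card {l \<in> J. z l \<notin> legs 1}"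
      using gather_one[OF less.prems] by blast
    have "\<exists>z'. token_reach Y J (topspace Y) z1 z' \<and> z' ` J \<subseteq> legs 1"
      by (rule less.hyps[OF z1(2) less.prems(1) token_reach_inj[OF z1(1) less.prems(2)] token_reach_in[OF z1(1) less.prems(3)]])
    then show ?thesis using z1(1) by (meson rtranclp_trans)
  qed blast
qed

theorem path_connected_config_space: "path_connected_space (config_space n Y)"
  unfolding path_connected_space_iff_path_component
proof (intro ballI)
  fix z w assume z: "z \<in> topspace (config_space n Y)" and w: "w \<in> topspace (config_space n Y)"
  let ?J = "{1..n}"
  have inj: "inj_on x ?J" "x ` ?J \<subseteq> topspace Y" "\<And>l. l \<notin> ?J \<Longrightarrow> x l = undefined"
    if "x \<in> topspace (config_space n Y)" for x
    using that by (auto simp: config_space_def power_space_def PiE_iff extensional_def)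
  obtain z' where z': "token_reach Y ?J (topspace Y) z z'" "z' ` ?J \<subseteq> legs 1"
    using gather[OF _ inj(1,2)[OF z]] by auto
  obtain w' where w': "token_reach Y ?J (topspace Y) w w'" "w' ` ?J \<subseteq> legs 1"
    using gather[OF _ inj(1,2)[OF w]] by auto
  have "token_reach Y ?J (tree 1) z' w'"
  proof (rule rearrange_in_triod)
    show "inj_on z' ?J" by (rule token_reach_inj[OF z'(1) inj(1)[OF z]])
    show "inj_on w' ?J" by (rule token_reach_inj[OF w'(1) inj(1)[OF w]])
    fix l assume "l \<notin> ?J"
    then show "z' l = w' l"
      using token_reach_outside[OF z'(1)] token_reach_outside[OF w'(1)] inj(3)[OF z] inj(3)[OF w] by metis
  qed (use z' w' in auto)
  then have "token_reach Y ?J (topspace Y) z' w'"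
    by (rule token_reach_mono) (use tree_subset[of 1] in auto)
  then have "token_reach Y ?J (topspace Y) z w"
    using z'(1) token_reach_sym[OF w'(1)] by (meson rtranclp_trans)
  then show "path_component_of (config_space n Y) z w" by (rule token_reach_path_component[OF _ z])
qed

end

section \<open>Half-edges and a vertex with three of them\<close>

context cw_graph begin

text \<open>A half-edge is an edge with a chosen end, \<open>True\<close> standing for the end at
  parameter 1. A loop thus gives two half-edges at its vertex.\<close>

definition half_edge_map :: "'a set \<times> bool \<Rightarrow> real \<Rightarrow> 'a" where
  "half_edge_map h t = \<Phi> (fst h) (if snd h then 1 - t else t)"

definition half_edges :: "'a \<Rightarrow> ('a set \<times> bool) set" where
  "half_edges p = {h. fst h \<in> E \<and> half_edge_map h 0 = p}"

lemma half_edge_map_continuous: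
  assumes "fst h \<in> E" shows "continuous_map unit_interval Y (half_edge_map h)"
proof -
  have "continuous_map unit_interval unit_interval (\<lambda>t::real. if snd h then 1 - t else t)"
    by (cases "snd h") (auto simp: continuous_map_in_subtopology intro!: continuous_intros)
  from continuous_map_compose[OF this \<Phi>_continuous[OF assms]] show ?thesis
    by (simp add: half_edge_map_def[abs_def] o_def)
qed

lemma star_point:
  assumes "y \<in> topspace Y" "vdist p y < 1"
  obtains h s where "h \<in> half_edges p" "0 \<le> s" "3 * s < 1" "y = half_edge_map h s" "vdist p y = 3 * s"
proof -
  obtain e t where e: "e \<in> E" "t \<in> {0..1}" "y = \<Phi> e t" using assms(1) by (rule point_on_edge)
  have v: "vdist p y = min (if \<Phi> e 0 = p then min 1 (3*t) else 1) (if \<Phi> e 1 = p then min 1 (3*(1-t)) else 1)"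
    using vdist_\<Phi>[OF e(1,2)] e(3) by simp
  consider "\<Phi> e 0 = p" "3 * t < 1" | "\<Phi> e 1 = p" "3 * (1 - t) < 1"
    using assms(2) unfolding v by (auto simp: min_def split: if_splits)
  then show ?thesis
  proof cases
    case 1
    then have "vdist p y = 3 * t" using e(2) unfolding v by (auto simp: min_def)
    then show ?thesis using 1 e by (intro that[of "(e, False)" t]) (auto simp: half_edges_def half_edge_map_def)
  next
    case 2
    then have "vdist p y = 3 * (1 - t)" using e(2) unfolding v by (auto simp: min_def)
    then show ?thesis using 2 e by (intro that[of "(e, True)" "1 - t"]) (auto simp: half_edges_def half_edge_map_def)
  qed
qed

text \<open>Before the midpoint the two half-edges of one edge do not meet, even if the edge is a
  loop.\<close>

lemma half_edge_map_eq:
  assumes "fst h \<in> E" "fst k \<in> E" "0 < t" "2 * t < 1" "0 < s" "2 * s < 1"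
  shows "half_edge_map h t = half_edge_map k s \<longleftrightarrow> h = k \<and> t = s"
proof
  assume eq: "half_edge_map h t = half_edge_map k s"
  define t' where "t' = (if snd h then 1 - t else t)"
  define s' where "s' = (if snd k then 1 - s else s)"
  have ts: "0 < t'" "t' < 1" "0 < s'" "s' < 1" using assms by (auto simp: t'_def s'_def)
  have eq': "\<Phi> (fst h) t' = \<Phi> (fst k) s'" using eq by (simp add: half_edge_map_def t'_def s'_def)
  have "\<Phi> (fst h) t' \<in> fst h" "\<Phi> (fst k) s' \<in> fst k" using \<Phi>_mem_edge assms ts by simp_all
  then have f: "fst h = fst k" using edges_eq[OF assms(1,2)] eq' by simp
  then have "t' = s'" using \<Phi>_eq_iff[OF assms(1)] eq' ts by simp
  then have "snd h = snd k \<and> t = s" using assms by (simp add: t'_def s'_def split: if_splits)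
  then show "h = k \<and> t = s" using f by (simp add: prod_eq_iff)
qed simp

text \<open>With at most two half-edges at a vertex its star embeds into the line:
  \<open>\<psi>\<close> is plus the distance to the vertex on the half-edge \<open>a\<close> and
  minus the distance on the other one.\<close>

lemma local_coordinate:
  assumes y: "y \<in> topspace Y"
    and few: "\<And>p. p \<in> V \<Longrightarrow> \<exists>a b. half_edges p \<subseteq> {a, b}"
  obtains N \<psi> where "openin Y N" "y \<in> N" "continuous_map (subtopology Y N) euclideanreal \<psi>" "inj_on \<psi> N"
proof (cases "y \<in> V")
  case False
  then obtain e where e: "e \<in> E" "y \<in> e" using y cells_cover by blast
  have "inj_on (coord e) e" by (rule inj_onI) (metis \<Phi>_coord[OF e(1)])
  then show ?thesis using that[OF openin_edge[OF e(1)] e(2) continuous_map_coord[OF e(1)]] by blast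
next
  case True
  obtain a b where ab: "half_edges y \<subseteq> {a, b}" using few[OF True] by blast
  \<comment> \<open>Equal to \<open>3 * s\<close> on the first third of the half-edge and 0 on the
    last third, so that on a loop the opposite half-edge is not affected near the vertex.\<close>
  define bump where "bump s = max 0 (min (3 * s) (2 - 3 * s))" for s :: real
  define w where "w = glue (\<lambda>_. 0) (\<lambda>e t. if e = fst a then bump (if snd a then 1 - t else t) else 0)"
  have bump01: "bump 0 = 0" "bump 1 = 0" by (simp_all add: bump_def)
  have w\<Phi>: "w (\<Phi> e t) = (if e = fst a then bump (if snd a then 1 - t else t) else 0)" if "e \<in> E" "t \<in> {0..1}" for e t
    unfolding w_def by (rule glue_\<Phi>[OF that]) (simp_all add: bump01)
  have wc: "continuous_map Y euclideanreal w" unfolding w_def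
  proof (rule continuous_map_glue)
    fix e show "continuous_map unit_interval euclideanreal (\<lambda>t. if e = fst a then bump (if snd a then 1 - t else t) else 0)"
      unfolding bump_def by (cases "e = fst a"; cases "snd a") (auto intro!: continuous_intros)
  qed (simp add: bump01)
  define N where "N = {x \<in> topspace Y. vdist y x < 1}"
  define \<psi> where "\<psi> x = 2 * w x - vdist y x" for x
  have "openin Y N" unfolding N_def by (rule openin_less) (auto intro: continuous_map_vdist)
  moreover have "y \<in> N" using y True by (simp add: N_def vdist_vertex)
  moreover have "continuous_map Y euclideanreal \<psi>" unfolding \<psi>_def[abs_def]
    by (intro continuous_map_diff continuous_map_real_mult wc continuous_map_vdist) auto
  then have "continuous_map (subtopology Y N) euclideanreal \<psi>" by (rule continuous_map_from_subtopology)
  moreover have "inj_on \<psi> N"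
  proof -
    have \<psi>: "\<exists>h s. h \<in> half_edges y \<and> 0 \<le> s \<and> 3 * s < 1 \<and> x = half_edge_map h s \<and> \<psi> x = (if h = a then 3 * s else - (3 * s))"
      if x: "x \<in> N" for x
    proof -
      have "x \<in> topspace Y" "vdist y x < 1" using x by (simp_all add: N_def)
      then obtain h s where h: "h \<in> half_edges y" "0 \<le> s" "3 * s < 1" "x = half_edge_map h s" "vdist y x = 3 * s"
        by (rule star_point)
      have hE: "fst h \<in> E" using h(1) by (simp add: half_edges_def)
      have "w x = (if h = a then 3 * s else 0)"
      proof -
        have "w x = (if fst h = fst a then bump (if snd a then 1 - (if snd h then 1 - s else s) else (if snd h then 1 - s else s)) else 0)"
          unfolding h(4) half_edge_map_def by (rule w\<Phi>[OF hE]) (use h(2,3) in auto)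
        moreover have "bump s = 3 * s" "bump (1 - s) = 0" using h(2,3) by (simp_all add: bump_def)
        ultimately show ?thesis by (auto simp: prod_eq_iff)
      qed
      then show ?thesis using h by (intro exI[of _ h] exI[of _ s]) (auto simp: \<psi>_def)
    qed
    show ?thesis
    proof (rule inj_onI)
      fix x x' assume xx: "x \<in> N" "x' \<in> N" and eq: "\<psi> x = \<psi> x'"
      obtain h s where h: "h \<in> half_edges y" "0 \<le> s" "x = half_edge_map h s" "\<psi> x = (if h = a then 3 * s else - (3 * s))"
        using \<psi>[OF xx(1)] by blast
      obtain h' s' where h': "h' \<in> half_edges y" "0 \<le> s'" "x' = half_edge_map h' s'" "\<psi> x' = (if h' = a then 3 * s' else - (3 * s'))"
        using \<psi>[OF xx(2)] by blast
      have s: "s = s'" using eq h(2,4) h'(2,4) by (auto split: if_splits)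
      show "x = x'"
      proof (cases "s = 0")
        case True
        then show ?thesis using h(1,3) h'(1,3) s by (simp add: half_edges_def)
      next
        case False
        then have "h = a \<longleftrightarrow> h' = a" using eq h(2,4) h'(4) s by (auto split: if_splits)
        then have "h = h'" using ab h(1) h'(1) by blast
        then show ?thesis using h(3) h'(3) s by simp
      qed
    qed
  qed
  ultimately show ?thesis by (rule that)
qed

text \<open>If no vertex had three half-edges, \<open>Y\<close> would embed locally into the line,
  and by invariance of domain the cycle would be open. Being closed and nonempty as well, it would
  be all of the connected space \<open>Y\<close>.\<close>

lemma essential_vertex:
  assumes C: "cycle_in Y C" and ne: "C \<noteq> topspace Y"
  obtains p h1 h2 h3 where "p \<in> V" "h1 \<in> half_edges p" "h2 \<in> half_edges p" "h3 \<in> half_edges p"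
    "h1 \<noteq> h2" "h1 \<noteq> h3" "h2 \<noteq> h3"
proof -
  have "\<exists>p\<in>V. \<not> (\<exists>a b. half_edges p \<subseteq> {a, b})"
  proof (rule ccontr)
    assume "\<not> ?thesis"
    then have few: "\<And>p. p \<in> V \<Longrightarrow> \<exists>a b. half_edges p \<subseteq> {a, b}" by blast
    obtain g where g: "continuous_map euclideanreal Y g" "range g = C" "\<And>s t. g s = g t \<longleftrightarrow> s - t \<in> \<int>"
      using cycle_loop[OF C] by blast
    have gY: "g t \<in> topspace Y" for t using g(1) by (auto simp: continuous_map_def)
    have "openin Y C"
    proof (subst openin_subopen, intro ballI)
      fix y assume "y \<in> C"
      then obtain t0 where t0: "y = g t0" using g(2) by blast
      obtain N \<psi> where N: "openin Y N" "y \<in> N" "continuous_map (subtopology Y N) euclideanreal \<psi>" "inj_on \<psi> N"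
        using local_coordinate[of y] few gY t0 by metis
      have "openin euclideanreal {t \<in> topspace euclideanreal. g t \<in> N}"
        by (rule openin_continuous_map_preimage[OF g(1) N(1)])
      then have "open {t. g t \<in> N}" by simp
      then obtain \<epsilon> where \<epsilon>: "0 < \<epsilon>" "ball t0 \<epsilon> \<subseteq> {t. g t \<in> N}"
        using N(2) t0 unfolding open_contains_ball by blast
      define D where "D = ball t0 (min \<epsilon> (1/2))"
      have Do: "open D" and t0D: "t0 \<in> D" using \<epsilon>(1) by (simp_all add: D_def)
      have DN: "g t \<in> N" if "t \<in> D" for t using that \<epsilon>(2) by (auto simp: D_def)
      have "continuous_map (top_of_set D) (subtopology Y N) g"
        using g(1) DN by (auto simp: continuous_map_in_subtopology continuous_map_from_subtopology)
      from continuous_map_compose[OF this N(3)] have fc: "continuous_on D (\<lambda>t. \<psi> (g t))" by (simp add: o_def)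
      have fi: "inj_on (\<lambda>t. \<psi> (g t)) D"
      proof (rule inj_onI)
        fix s t assume st: "s \<in> D" "t \<in> D" "\<psi> (g s) = \<psi> (g t)"
        then have "g s = g t" using N(4) DN by (meson inj_onD)
        then have "s - t \<in> \<int>" using g(3) by simp
        then obtain k :: int where k: "s - t = of_int k" by (elim Ints_cases)
        have "\<bar>s - t0\<bar> < 1/2" "\<bar>t - t0\<bar> < 1/2" using st by (auto simp: D_def dist_real_def abs_minus_commute)
        then have "\<bar>s - t\<bar> < 1" by linarith
        then have "k = 0" using k by linarith
        then show "s = t" using k by simp
      qed
      have "open ((\<lambda>t. \<psi> (g t)) ` D)" by (rule invariance_of_domain[OF fc Do fi])
      then have "openin (subtopology Y N) {x \<in> topspace (subtopology Y N). \<psi> x \<in> (\<lambda>t. \<psi> (g t)) ` D}"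
        by (intro openin_continuous_map_preimage[OF N(3)]) simp
      then have op: "openin Y {x \<in> topspace (subtopology Y N). \<psi> x \<in> (\<lambda>t. \<psi> (g t)) ` D}"
        using N(1) openin_trans_full by blast
      have "x \<in> C" if x: "x \<in> N" "\<psi> x \<in> (\<lambda>t. \<psi> (g t)) ` D" for x
      proof -
        obtain t where "t \<in> D" "\<psi> x = \<psi> (g t)" using x(2) by blast
        then have "x = g t" using N(4) x(1) DN by (meson inj_onD)
        then show ?thesis using g(2) by blast
      qed
      then have "{x \<in> topspace (subtopology Y N). \<psi> x \<in> (\<lambda>t. \<psi> (g t)) ` D} \<subseteq> C" by auto
      moreover have "y \<in> {x \<in> topspace (subtopology Y N). \<psi> x \<in> (\<lambda>t. \<psi> (g t)) ` D}"
        using N(2) t0 t0D gY by auto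
      ultimately show "\<exists>T. openin Y T \<and> y \<in> T \<and> T \<subseteq> C" using op by blast
    qed
    moreover have "closedin Y C" by (rule closedin_cycle[OF Hausdorff C])
    moreover have "C \<noteq> {}" using g(2) by blast
    ultimately show False using connected ne unfolding connected_space_clopen_in by blast
  qed
  then obtain p where p: "p \<in> V" "\<And>a b. \<not> half_edges p \<subseteq> {a, b}" by blast
  obtain h1 where h1: "h1 \<in> half_edges p" using p(2) by blast
  obtain h2 where h2: "h2 \<in> half_edges p" "h2 \<noteq> h1" using p(2)[of h1 h1] by blast
  obtain h3 where h3: "h3 \<in> half_edges p" "h3 \<noteq> h1" "h3 \<noteq> h2" using p(2)[of h1 h2] by blast
  show ?thesis by (rule that[OF p(1) h1 h2(1) h3(1)]) (use h2 h3 in auto)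
qed

lemma half_edge_open:
  assumes "fst h \<in> E" shows "openin Y ((\<lambda>t. half_edge_map h (t / 3)) ` {0<..<1})"
proof -
  define T :: "real set" where "T = (if snd h then {2/3<..<1} else {0<..<1/3})"
  have "(\<lambda>t. half_edge_map h (t / 3)) ` {0<..<1} = \<Phi> (fst h) ` ((\<lambda>t. if snd h then 1 - t / 3 else t / 3) ` {0<..<1})"
    unfolding image_image half_edge_map_def ..
  also have "(\<lambda>t. if snd h then 1 - t / 3 else t / 3) ` {0<..<1} = T"
  proof (cases "snd h")
    case True
    have "x \<in> (\<lambda>t. 1 - t / 3) ` {0<..<1}" if "2/3 < x" "x < 1" for x :: real
      by (rule image_eqI[of _ _ "3 * (1 - x)"]) (use that in \<open>auto simp: field_simps\<close>)
    then show ?thesis using True by (auto simp: T_def)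
  next
    case False
    have "x \<in> (\<lambda>t. t / 3) ` {0<..<1}" if "0 < x" "x < 1/3" for x :: real
      by (rule image_eqI[of _ _ "3 * x"]) (use that in auto)
    then show ?thesis using False by (auto simp: T_def)
  qed
  finally have eq: "(\<lambda>t. half_edge_map h (t / 3)) ` {0<..<1} = \<Phi> (fst h) ` T" .
  show ?thesis unfolding eq by (rule openin_edge_piece[OF assms]) (auto simp: T_def)
qed

lemma path_connected_config_space_of_cycle:
  assumes "cycle_in Y C" "C \<noteq> topspace Y" shows "path_connected_space (config_space n Y)"
proof -
  obtain p h1 h2 h3 where p: "p \<in> V" and h: "h1 \<in> half_edges p" "h2 \<in> half_edges p" "h3 \<in> half_edges p"
    and ne: "h1 \<noteq> h2" "h1 \<noteq> h3" "h2 \<noteq> h3" using essential_vertex[OF assms] by blast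
  define H where "H a = (if a = 0 then h1 else if a = 1 then h2 else h3)" for a :: nat
  have H: "H a \<in> half_edges p" for a using h by (simp add: H_def)
  then have HE: "fst (H a) \<in> E" and H0: "half_edge_map (H a) 0 = p" for a by (auto simp: half_edges_def)
  have Hinj: "H a = H b \<longleftrightarrow> a = b" if "a < 3" "b < 3" for a b
  proof -
    have "a = 0 \<or> a = 1 \<or> a = 2" "b = 0 \<or> b = 1 \<or> b = 2" using that by auto
    then show ?thesis using ne by (elim disjE) (simp_all add: H_def)
  qed
  \<comment> \<open>Rescaling by 1/3 keeps the legs before the midpoints of their edges, so two legs
    on the same loop meet only at \<open>p\<close>.\<close>
  interpret triod Y p "\<lambda>a t. half_edge_map (H a) (t / 3)"
  proof
    fix a :: nat
    have "continuous_map unit_interval unit_interval (\<lambda>t::real. t / 3)"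
      by (auto simp: continuous_map_in_subtopology intro!: continuous_intros)
    from continuous_map_compose[OF this half_edge_map_continuous[OF HE]]
    show "continuous_map unit_interval Y (\<lambda>t. half_edge_map (H a) (t / 3))" by (simp add: o_def)
    show "half_edge_map (H a) (0 / 3) = p" using H0 by simp
    show "openin Y ((\<lambda>t. half_edge_map (H a) (t / 3)) ` {0<..<1})" by (rule half_edge_open[OF HE])
    show "half_edge_map (H a) (t / 3) \<noteq> p" if "0 < t" "t \<le> 1" for t
    proof
      assume "half_edge_map (H a) (t / 3) = p"
      then have "\<Phi> (fst (H a)) (if snd (H a) then 1 - t / 3 else t / 3) \<in> V" using p by (simp add: half_edge_map_def)
      then show False using \<Phi>_mem_V[OF HE[of a], of "if snd (H a) then 1 - t / 3 else t / 3"] that by (auto split: if_splits)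
    qed
    show "half_edge_map (H a) (t / 3) = half_edge_map (H b) (s / 3) \<longleftrightarrow> a = b \<and> t = s"
      if "a < 3" "b < 3" "0 < t" "t \<le> 1" "0 < s" "s \<le> 1" for b t s
      using half_edge_map_eq[OF HE[of a] HE[of b], of "t / 3" "s / 3"] Hinj[OF that(1,2)] that by simp
  qed (rule Hausdorff path_connected)+
  show ?thesis by (rule path_connected_config_space)
qed

end

text \<open>The condition for \<open>n = 1\<close> is forced: a connected graph with just one cycle
  is homotopy equivalent to a circle and has topological complexity 2, not 3. For
  \<open>n \<ge> 2\<close> the disjoint cycles themselves supply the second family, and for
  \<open>n = 0\<close> all spaces involved are points.\<close>

theorem proposition3p4:
  fixes Y :: "'a topology" and n :: nat and C :: "nat \<Rightarrow> 'a set"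
    and X :: "(nat \<Rightarrow> 'a \<times> real) topology"
  assumes "connected_graph Y"
    and "\<And>i. i \<in> {1..n} \<Longrightarrow> cycle_in Y (C i)"
    and "\<And>i j. i \<in> {1..n} \<Longrightarrow> j \<in> {1..n} \<Longrightarrow> i \<noteq> j \<Longrightarrow> C i \<inter> C j = {}"
    and "n = 1 \<Longrightarrow> \<exists>D D'. cycle_in Y D \<and> cycle_in Y D' \<and> D \<noteq> D'"
    and "X = config_space n (prod_topology Y unit_interval)"
  shows "relative_TC X (config_at_zero n Y \<times> config_at_zero n Y) = TC (config_space n Y)
       \<and> TC (config_space n Y) = TC (power_space n Y)
       \<and> TC (power_space n Y) = enat (2 * n + 1)"
proof -
  obtain V E \<Phi> where "connected_space Y" "one_dim_CW_structure Y V E \<Phi>"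
    using assms(1) unfolding connected_graph_def by blast
  then interpret cw_graph Y V E \<Phi> by unfold_locales
  have cyc_ne: "D \<noteq> {}" if "cycle_in Y D" for D using cycle_loop[OF that] by blast
  have "\<exists>A B. (\<forall>i\<in>{1..n}. cycle_in Y (A i) \<and> cycle_in Y (B i) \<and> \<not> A i \<subseteq> B i \<and> \<not> B i \<subseteq> A i) \<and>
     (\<forall>i\<in>{1..n}. \<forall>j\<in>{1..n}. i \<noteq> j \<longrightarrow> A i \<inter> A j = {} \<and> B i \<inter> B j = {})"
  proof (cases "n = 1")
    case True
    then obtain D D' where D: "cycle_in Y D" "cycle_in Y D'" "D \<noteq> D'" using assms(4) by blast
    then have "\<not> D \<subseteq> D'" "\<not> D' \<subseteq> D" using cycle_subset_imp_eq by metis+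
    then show ?thesis using True D by (intro exI[of _ "\<lambda>_. D"] exI[of _ "\<lambda>_. D'"]) auto
  next
    case False
    \<comment> \<open>The cyclic shift has no fixed point in \<open>{1..n}\<close> because
      \<open>n\<close> is not 1.\<close>
    define \<sigma> where "\<sigma> i = (if i = n then 1 else i + 1)" for i :: nat
    have \<sigma>: "\<sigma> i \<in> {1..n}" "\<sigma> i \<noteq> i" if "i \<in> {1..n}" for i using that False by (auto simp: \<sigma>_def)
    have \<sigma>_inj: "\<sigma> i \<noteq> \<sigma> j" if "i \<in> {1..n}" "j \<in> {1..n}" "i \<noteq> j" for i j using that by (auto simp: \<sigma>_def)
    have "\<not> C i \<subseteq> C j" if "i \<in> {1..n}" "j \<in> {1..n}" "i \<noteq> j" for i j
      using assms(3)[OF that] cyc_ne[OF assms(2)[OF that(1)]] by blast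
    then show ?thesis using assms(2,3) \<sigma> \<sigma>_inj
      by (intro exI[of _ C] exI[of _ "\<lambda>i. C (\<sigma> i)"]) metis
  qed
  then obtain A B
    where AB1: "\<forall>i\<in>{1..n}. cycle_in Y (A i) \<and> cycle_in Y (B i) \<and> \<not> A i \<subseteq> B i \<and> \<not> B i \<subseteq> A i"
      and AB2: "\<forall>i\<in>{1..n}. \<forall>j\<in>{1..n}. i \<noteq> j \<longrightarrow> A i \<inter> A j = {} \<and> B i \<inter> B j = {}"
    by (elim exE conjE)
  have AB: "cycle_in Y (A i)" "cycle_in Y (B i)" "\<not> A i \<subseteq> B i" "\<not> B i \<subseteq> A i" if "i \<in> {1..n}" for i
    using bspec[OF AB1 that] by simp_all
  have AB_disjoint: "A i \<inter> A j = {}" "B i \<inter> B j = {}" if "i \<in> {1..n}" "j \<in> {1..n}" "i \<noteq> j" for i j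
    using bspec[OF bspec[OF AB2 that(1)] that(2)] that(3) by simp_all
  have loop: "\<exists>g. continuous_map euclideanreal Y g \<and> range g = D \<and> (\<forall>s t. g s = g t \<longleftrightarrow> s - t \<in> \<int>)"
    if "cycle_in Y D" for D using cycle_loop[OF that] by metis
  have "\<forall>i\<in>{1..n}. \<exists>g. continuous_map euclideanreal Y g \<and> range g = A i \<and> (\<forall>s t. g s = g t \<longleftrightarrow> s - t \<in> \<int>)"
    using loop AB(1) by blast
  then obtain \<alpha> where \<alpha>: "\<forall>i\<in>{1..n}. continuous_map euclideanreal Y (\<alpha> i) \<and> range (\<alpha> i) = A i \<and> (\<forall>s t. \<alpha> i s = \<alpha> i t \<longleftrightarrow> s - t \<in> \<int>)"
    by (rule bchoice[THEN exE])
  have "\<forall>i\<in>{1..n}. \<exists>g. continuous_map euclideanreal Y g \<and> range g = B i \<and> (\<forall>s t. g s = g t \<longleftrightarrow> s - t \<in> \<int>)"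
    using loop AB(2) by blast
  then obtain \<beta> where \<beta>: "\<forall>i\<in>{1..n}. continuous_map euclideanreal Y (\<beta> i) \<and> range (\<beta> i) = B i \<and> (\<forall>s t. \<beta> i s = \<beta> i t \<longleftrightarrow> s - t \<in> \<int>)"
    by (rule bchoice[THEN exE])
  have closed: "closedin Y D" if "cycle_in Y D" for D by (rule closedin_cycle[OF Hausdorff that])
  interpret graph_with_loops Y V E \<Phi> n \<alpha> \<beta>
  proof
    fix i assume i: "i \<in> {1..n}"
    note a = bspec[OF \<alpha> i] and b = bspec[OF \<beta> i]
    show "continuous_map euclideanreal Y (\<alpha> i)" "continuous_map euclideanreal Y (\<beta> i)" using a b by blast+
    show "\<alpha> i s = \<alpha> i t \<longleftrightarrow> s - t \<in> \<int>" "\<beta> i s = \<beta> i t \<longleftrightarrow> s - t \<in> \<int>" for s t using a b by blast+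
    show "closedin Y (range (\<alpha> i))" "closedin Y (range (\<beta> i))" using a b closed AB(1,2)[OF i] by simp_all
    show "\<not> range (\<alpha> i) \<subseteq> range (\<beta> i)" "\<not> range (\<beta> i) \<subseteq> range (\<alpha> i)" using a b AB(3,4)[OF i] by simp_all
    fix j assume j: "j \<in> {1..n}" "i \<noteq> j"
    note a' = bspec[OF \<alpha> j(1)] and b' = bspec[OF \<beta> j(1)]
    show "range (\<alpha> i) \<inter> range (\<alpha> j) = {}" "range (\<beta> i) \<inter> range (\<beta> j) = {}"
      using a b a' b' AB_disjoint[OF i j] by simp_all
  qed
  have pc_power: "path_connected_space (power_space n Y)"
    unfolding power_space_def path_connected_space_product_topology using path_connected by blast
  have pc_config: "path_connected_space (config_space n Y)"
  proof (cases "n \<le> 1")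
    case True
    \<comment> \<open>For at most one point injectivity is no condition, and the configuration space
      is the power.\<close>
    then have "{z. inj_on z {1..n}} = (UNIV :: (nat \<Rightarrow> 'a) set)" by (auto simp: inj_on_def)
    then show ?thesis using pc_power by (simp add: config_space_def)
  next
    case False
    then have 12: "1 \<in> {1..n}" "2 \<in> {1..n}" by auto
    \<comment> \<open>The nonempty cycle \<open>C 2\<close> misses \<open>C 1\<close>, so
      \<open>C 1\<close> is not the whole graph and forces an essential vertex.\<close>
    have "C 1 \<inter> C 2 = {}" using assms(3)[OF 12] by simp
    moreover have "C 2 \<subseteq> topspace Y" "C 2 \<noteq> {}" using assms(2)[OF 12(2)] cyc_ne by (auto simp: cycle_in_def)
    ultimately have "C 1 \<noteq> topspace Y" by blast
    then show ?thesis using path_connected_config_space_of_cycle assms(2)[OF 12(1)] by blast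
  qed
  have power_le: "TC (power_space n Y) \<le> enat (2 * n + 1)"
    using pc_power unfolding power_space_eq_partial by (rule TC_partial_config_le)
  obtain U where U: "(\<Union>k\<in>{..2*n}. U k) = topspace (prod_topology (config_space n Y) (config_space n Y))"
    "\<And>k. openin (prod_topology (config_space n Y) (config_space n Y)) (U k)"
    "\<And>k. homotopic_with (\<lambda>_. True)
       (subtopology (prod_topology (config_space n Y) (config_space n Y)) (U k)) (config_space n Y) fst snd"
    using partial_config_motion_planning[of n "(\<noteq>)"] pc_config unfolding config_space_eq_partial by metis
  have config_le: "TC (config_space n Y) \<le> enat (2 * n + 1)" by (rule TC_le[OF U])
  have relative_le: "relative_TC X (config_at_zero n Y \<times> config_at_zero n Y) \<le> enat (2 * n + 1)"
    unfolding assms(5) by (rule relative_TC_config_le[OF U])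
  have power_ge: "enat (2 * n + 1) \<le> TC (power_space n Y)"
    unfolding power_space_eq_partial by (rule TC_partial_config_ge) simp
  have config_ge: "enat (2 * n + 1) \<le> TC (config_space n Y)"
    unfolding config_space_eq_partial by (rule TC_partial_config_ge) simp
  have relative_ge: "enat (2 * n + 1) \<le> relative_TC X (config_at_zero n Y \<times> config_at_zero n Y)"
    unfolding assms(5) by (rule relative_TC_config_ge)
  show ?thesis using power_le config_le relative_le power_ge config_ge relative_ge by (simp add: antisym)
qed

end
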